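(* Let $K$ be one of the fields $\mathbb{R}((t_1))$, $\mathbb{R}((t_1))((t_2))$, $\mathbb{R}((t_1))((t_2))((t_3))$, and so on (i.e. $K=\mathbb{R}((t_1))\cdots((t_n))$ for some integer $n\ge 1$). Then $$H(K,\mathcal{L}_{\rm ring})=\mathbb{Z}.$$ Endow $K$ with a valuation onto a group of the form $\mathbb{Z}^k$ with lexicographical order, $k>0$, and with a natural angular component map, and let $\mathcal{L}_{\rm Pas}$ be a language of Denef–Pas for $K$ with this valuation and angular component map. Then $$K_0(K,\mathcal{L}_{\rm Pas})=\{0\},$$ and there exists an $\mathcal{L}_{\rm Pas}$-definable bijection $K\to K^\times$, where $K^\times=K\setminus\{0\}$.
   Context: Iterated Laurent series fields: $L((t_1))$ is the field of formal Laurent series in $t_1$ over $L$, and inductively $L((t_1))\cdots((t_n))$ is the field of formal Laurent series in $t_n$ over $L((t_1))\cdots((t_{n-1}))$. $\mathcal{L}_{\rm ring}=(+,-,\cdot,0,1)$ is the language of rings. Definable always means definable with parameters; a function is definable if its graph is. The group $H(K,\mathcal{L})$: let $K$ be a field and $\mathcal{L}$ an expansion of $\mathcal{L}_{\rm ring}$ (interpreted on $K$). Let $P_n=P_n(K)$ be the set of $n$-th powers in $K^\times$. For $n>1$ put $r_n(K)=\#\{x\in K\mid x^n=1\}$ and $s_n(K)=[K^\times:P_n(K)]$ (possibly $\infty$). Put $\lambda_n(K,\mathcal{L})=s_n(K)/r_n(K)$ if both of the following hold: (1) $s_n(K)<\infty$ and $s_n(K)/r_n(K)\in\mathbb{Z}$;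 (2) there is an $\mathcal{L}$-definable $n$-th root function, i.e. there exist a definable set $\sqrt[n]{P_n}\subset K^\times$ and a definable bijection $\sqrt[n]{\ }:P_n(K)\to\sqrt[n]{P_n}$ with $(\sqrt[n]{x})^n=x$ for each $x\in P_n(K)$. Otherwise put $\lambda_n(K,\mathcal{L})=1$. $H(K,\mathcal{L})$ is the subgroup of $\mathbb{Z}$ generated by the numbers $\lambda_n(K,\mathcal{L})-1$ for all $n>1$. Valuations: a valuation on $K$ is a map $v:K\to G\cup\{\infty\}$, $G$ an ordered abelian group, with $v(x)=\infty$ iff $x=0$, $v(xy)=v(x)+v(y)$, $v(x+y)\ge\min\{v(x),v(y)\}$. Write $R=\{x\in K\mid v(x)\ge 0\}$, $M$ for its maximal ideal, and $k_K=R/M$ for the residue field. An angular component map is a group homomorphism $\mathrm{ac}:K^\times\to k_K^\times$, extended by $\mathrm{ac}(0)=0$, with $\mathrm{ac}(x)=x\bmod M$ whenever $v(x)=0$. If the value group is $\mathbb{Z}^k$ and $\tau_1,\dots,\tau_k\in K$ satisfy $v(\tau_1)=(1,0,\dots,0),\dots,v(\tau_k)=(0,\dots,0,1)$, the natural angular component map (canonical up to the choice of the $\tau_i$) is $\mathrm{ac}(x)=x\prod_i\tau_i^{-r_i}\bmod M$ for $x\neq 0$ with $v(x)=(r_1,\dots,r_k)$. A language of Denef–Pas $\mathcal{L}_{\rm Pas}$ is a three-sorted language $(\mathcal{L}_k,\mathcal{L}_{\rm ring},\mathcal{L}_G,v,\mathrm{ac})$ with a residue field sort (with language $\mathcal{L}_k$,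 an arbitrary expansion of $\mathcal{L}_{\rm ring}$), a valued field sort $K$ (with language $\mathcal{L}_{\rm ring}$), a value group sort $G\cup\{\infty\}$ (with language $\mathcal{L}_G$, an arbitrary expansion of $(+,-,0,\infty,\le)$), and function symbols $v$ for the valuation $K\to G\cup\{\infty\}$ and $\mathrm{ac}$ for the angular component map from $K$ to the residue field. Grothendieck ring: for $\mathcal{L}$-definable sets $X\subset K^m$, $Y\subset K^n$ ($m,n>0$), write $X\cong_{\mathcal{L}}Y$ if there is an $\mathcal{L}$-definable bijection $X\to Y$. $K_0(K,\mathcal{L})$ is the abelian group generated by symbols $[A]$, for $A$ an $\mathcal{L}$-definable set, with the relations $[A]=[A']$ if $A\cong_{\mathcal{L}}A'$, and $[A]=[B]+[C]$ if $A$ is the disjoint union of the definable sets $B$ and $C$; it is a ring with multiplication induced by $[A\times B]=[A][B]$ (the unit is the class of a point). *)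

theory Defs
  imports
    "HOL-Algebra.QuotRing"
    "HOL-Algebra.Multiplicative_Group"
    "HOL-Algebra.Free_Abelian_Groups"
    "HOL-Computational_Algebra.Formal_Laurent_Series"
    "HOL-Library.Fun_Lexorder"
begin

section \<open>Iterated Laurent series fields\<close>

definition ring_on :: "'a::field set \<Rightarrow> 'a ring" where
  "ring_on A = \<lparr>carrier = A, monoid.mult = (*), one = 1, ring.zero = 0, add = (+)\<rparr>"

text \<open>
  The number of iterations is a natural number, so the iterated fields do not all live in one
  type \<open>'a fls\<close>.  \<open>iterated_laurent n F\<close> says that the subset \<open>F\<close> of \<open>'k\<close> is isomorphic to
  $R((t_1)) \cdots ((t_n))$, with $R$ the reals.  In the step, the Laurent series over \<open>L\<close>
  are the elements of \<open>'k fls\<close> all of whose coefficients lie in \<open>L\<close>.  Lemma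
  \<open>iterated_laurent_fls\<close> below shows that \<open>real fls\<close>, \<open>real fls fls\<close>, ... satisfy the
  predicate with \<open>F = UNIV\<close>.
\<close>

inductive iterated_laurent :: "nat \<Rightarrow> 'k::field set \<Rightarrow> bool" where
  base: "ring_on (UNIV :: real set) \<simeq> ring_on F \<Longrightarrow> iterated_laurent 0 F"
| step: "iterated_laurent n L \<Longrightarrow> ring_on {f :: 'k fls. \<forall>i. fls_nth f i \<in> L} \<simeq> ring_on F \<Longrightarrow>
    iterated_laurent (Suc n) F"

lemma ring_iso_ring_on_iff:
  "h \<in> ring_iso (ring_on A) (ring_on B) \<longleftrightarrow>
     bij_betw h A B \<and> h 1 = 1 \<and>
     (\<forall>x\<in>A. \<forall>y\<in>A. h (x + y) = h x + h y \<and> h (x * y) = h x * h y)"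
  by (auto simp: ring_iso_def ring_hom_def ring_on_def bij_betw_def)

definition subring_set :: "'a::field set \<Rightarrow> bool" where
  "subring_set A \<longleftrightarrow> 0 \<in> A \<and> 1 \<in> A \<and> (\<forall>x\<in>A. \<forall>y\<in>A. x + y \<in> A \<and> x * y \<in> A)"

lemma subring_set_sum:
  assumes "subring_set A" "\<And>i. i \<in> I \<Longrightarrow> f i \<in> A"
  shows "sum f I \<in> A"
  using assms by (induction I rule: infinite_finite_induct) (auto simp: subring_set_def)

lemma iso_zero:
  fixes h :: "'a::field \<Rightarrow> 'b::field"
  assumes "h \<in> ring_iso (ring_on A) (ring_on B)" "subring_set A"
  shows "h 0 = 0"
proof -
  have "h (0 + 0) = h 0 + h 0" 
    using assms unfolding ring_iso_ring_on_iff subring_set_def by blast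
  then show ?thesis by (metis add_0 add_cancel_right_right)
qed

lemma iso_sum:
  fixes h :: "'a::field \<Rightarrow> 'b::field"
  assumes "h \<in> ring_iso (ring_on A) (ring_on B)" "subring_set A" "\<And>i. i \<in> I \<Longrightarrow> f i \<in> A"
  shows "h (sum f I) = (\<Sum>i\<in>I. h (f i))"
  using assms(3)
proof (induction I rule: infinite_finite_induct)
  case (insert x F)
  have "sum f F \<in> A" using subring_set_sum[OF assms(2)] insert by blast
  then show ?case using insert assms(1) by (simp add: ring_iso_ring_on_iff)
qed (use iso_zero[OF assms(1,2)] in auto)

lemma subring_set_iso:
  assumes "h \<in> ring_iso (ring_on A) (ring_on B)" "subring_set A"
  shows "subring_set B"
proof -
  have B: "B = h ` A" using assms(1) by (auto simp: ring_iso_ring_on_iff bij_betw_def)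
  have "0 \<in> B" using iso_zero[OF assms] assms(2) unfolding B subring_set_def by (metis imageI)
  moreover have "1 \<in> B" using assms unfolding B subring_set_def ring_iso_ring_on_iff by (metis imageI)
  moreover have "x + y \<in> B \<and> x * y \<in> B" if xy: "x \<in> B" "y \<in> B" for x y
  proof -
    obtain a b where ab: "a \<in> A" "b \<in> A" "x = h a" "y = h b" using xy unfolding B by blast
    then have "x + y = h (a + b)" "x * y = h (a * b)" using assms(1) 
      by (auto simp: ring_iso_ring_on_iff)
    then show ?thesis using ab assms(2) unfolding B subring_set_def by simp
  qed
  ultimately show ?thesis unfolding subring_set_def by blast
qed

lemma ring_iso_ring_on_inv:
  assumes "h \<in> ring_iso (ring_on A) (ring_on B)" "subring_set A"
  shows "inv_into A h \<in> ring_iso (ring_on B) (ring_on A)"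
proof -
  have b: "bij_betw h A B" and one: "h 1 = 1" 
    and hom: "\<And>x y. x \<in> A \<Longrightarrow> y \<in> A \<Longrightarrow> h (x + y) = h x + h y \<and> h (x * y) = h x * h y"
    using assms(1) by (auto simp: ring_iso_ring_on_iff)
  have inj: "inj_on h A" using b by (simp add: bij_betw_def)
  have "inv_into A h 1 = 1"
    using inv_into_f_f[OF inj, of 1] one assms(2) by (simp add: subring_set_def)
  moreover have "inv_into A h (x + y) = inv_into A h x + inv_into A h y \<and>
      inv_into A h (x * y) = inv_into A h x * inv_into A h y" if xy: "x \<in> B" "y \<in> B" for x y
  proof -
    obtain a b where ab: "a \<in> A" "b \<in> A" "x = h a" "y = h b" 
      using xy b unfolding bij_betw_def by blast
    then have "x + y = h (a + b)" "x * y = h (a * b)" "a + b \<in> A" "a * b \<in> A"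
      using hom assms(2) by (auto simp: subring_set_def)
    then show ?thesis using ab by (simp add: inv_into_f_f[OF inj])
  qed
  ultimately show ?thesis using bij_betw_inv_into[OF b] unfolding ring_iso_ring_on_iff by blast
qed

lemma subring_set_fls:
  assumes "subring_set (L :: 'a::field set)"
  shows "subring_set {f :: 'a fls. \<forall>i. fls_nth f i \<in> L}"
  unfolding subring_set_def
proof (intro conjI ballI)
  fix f g :: "'a fls" assume fg: "f \<in> {f. \<forall>i. fls_nth f i \<in> L}" "g \<in> {f. \<forall>i. fls_nth f i \<in> L}"
  show "f + g \<in> {f. \<forall>i. fls_nth f i \<in> L}" using fg assms by (auto simp: subring_set_def)
  show "f * g \<in> {f. \<forall>i. fls_nth f i \<in> L}" 
    unfolding fls_times_nth(2) mem_Collect_eq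
    by (intro allI subring_set_sum[OF assms]) (use fg assms in \<open>auto simp: subring_set_def\<close>)
qed (use assms in \<open>auto simp: subring_set_def\<close>)

lemma fls_map_iso:
  fixes h :: "'a::field \<Rightarrow> 'b::field"
  assumes h: "h \<in> ring_iso (ring_on A) (ring_on B)" and A: "subring_set A"
  shows "(\<lambda>f. Abs_fls (\<lambda>n. h (fls_nth f n))) \<in>
    ring_iso (ring_on {f. \<forall>i. fls_nth f i \<in> A}) (ring_on {f. \<forall>i. fls_nth f i \<in> B})"
    (is "?m \<in> ring_iso (ring_on ?A) (ring_on ?B)")
proof -
  let ?k = "inv_into A h"
  have k: "?k \<in> ring_iso (ring_on B) (ring_on A)" using ring_iso_ring_on_inv[OF h A] .
  have B: "subring_set B" using subring_set_iso[OF h A] .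
  have h0: "h 0 = 0" using iso_zero[OF h A] .
  have k0: "?k 0 = 0" using iso_zero[OF k B] .
  have bij: "bij_betw h A B" using h by (simp add: ring_iso_ring_on_iff)
  have hk: "h (?k b) = b" "?k b \<in> A" if "b \<in> B" for b
    using that bij by (auto simp: bij_betw_def f_inv_into_f inv_into_into)
  have kh: "?k (h a) = a" "h a \<in> B" if "a \<in> A" for a
    using that bij by (auto simp: bij_betw_def)
  have mh: "fls_nth (?m f) n = h (fls_nth f n)" for f n
    by (rule nth_Abs_fls_lower_bound[of "fls_subdegree f"]) (simp add: h0)
  have mk: "fls_nth (Abs_fls (\<lambda>n. ?k (fls_nth f n))) n = ?k (fls_nth f n)" for f n
    by (rule nth_Abs_fls_lower_bound[of "fls_subdegree f"]) (simp add: k0)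
  have "bij_betw ?m ?A ?B"
    by (rule bij_betw_byWitness[where f' = "\<lambda>f. Abs_fls (\<lambda>n. ?k (fls_nth f n))"])
       (auto simp: mh mk hk kh intro!: fls_eqI)
  moreover have "?m 1 = 1"
    using h by (intro fls_eqI) (simp only: mh, simp add: h0 ring_iso_ring_on_iff)
  moreover have "?m (f + g) = ?m f + ?m g \<and> ?m (f * g) = ?m f * ?m g" if "f \<in> ?A" "g \<in> ?A" for f g
  proof
    show "?m (f + g) = ?m f + ?m g"
      using that h by (intro fls_eqI) (simp only: mh, simp add: mh ring_iso_ring_on_iff)
    have sd: "fls_subdegree (?m f) = fls_subdegree f" if "f \<in> ?A" for f
    proof (cases "f = 0")
      case True
      then have "?m f = 0" by (intro fls_eqI) (simp only: mh, simp add: h0)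
      then show ?thesis using True by simp
    next
      case False
      have "h (fls_nth f (fls_subdegree f)) \<noteq> 0"
        using kh(1)[of "fls_nth f (fls_subdegree f)"] that False k0 by force
      then show ?thesis by (intro fls_subdegree_eqI) (simp_all add: mh h0)
    qed
    show "?m (f * g) = ?m f * ?m g"
    proof (intro fls_eqI)
      fix n
      have "fls_nth (?m (f * g)) n = h (\<Sum>i=fls_subdegree f..n - fls_subdegree g. fls_nth f i * fls_nth g (n - i))"
        by (subst mh) (simp only: fls_times_nth(2))
      also have "\<dots> = (\<Sum>i=fls_subdegree f..n - fls_subdegree g. h (fls_nth f i * fls_nth g (n - i)))"
        by (rule iso_sum[OF h A]) (use that A in \<open>auto simp: subring_set_def\<close>)
      also have "\<dots> = (\<Sum>i=fls_subdegree f..n - fls_subdegree g. h (fls_nth f i) * h (fls_nth g (n - i)))"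
        using that h by (intro sum.cong) (auto simp: ring_iso_ring_on_iff)
      also have "\<dots> = fls_nth (?m f * ?m g) n"
        unfolding fls_times_nth(2) sd[OF that(1)] sd[OF that(2)] mh ..
      finally show "fls_nth (?m (f * g)) n = fls_nth (?m f * ?m g) n" .
    qed
  qed
  ultimately show ?thesis unfolding ring_iso_ring_on_iff by blast
qed

lemma iterated_laurent_subring: "iterated_laurent n F \<Longrightarrow> subring_set F"
proof (induction rule: iterated_laurent.induct)
  case (base F)
  then show ?case using subring_set_iso[of _ UNIV F] by (auto simp: is_ring_iso_def subring_set_def)
next
  case (step n L F)
  then show ?case using subring_set_iso subring_set_fls by (fastforce simp: is_ring_iso_def)
qed

lemma iterated_laurent_iso:
  fixes F :: "'a::field set" and F' :: "'b::field set"
  assumes "iterated_laurent n F" "ring_on F \<simeq> ring_on F'"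
  shows "iterated_laurent n F'"
  using assms
proof (induction arbitrary: F' rule: iterated_laurent.induct)
  case (base F)
  then show ?case using ring_iso_trans iterated_laurent.base by blast
next
  case (step n L F)
  let ?S = "{f :: 'a fls. \<forall>i. fls_nth f i \<in> L}"
  have L: "subring_set L" using iterated_laurent_subring[OF step.hyps(1)] .
  from step.hyps(2) step.prems obtain g where g: "g \<in> ring_iso (ring_on ?S) (ring_on F')"
    unfolding is_ring_iso_def using ring_iso_set_trans by blast
  define j where "j a = g (fls_const a)" for a
  have cS: "fls_const a \<in> ?S" if "a \<in> L" for a
    using that L by (auto simp: subring_set_def)
  have inj: "inj_on j L"
  proof (rule inj_onI)
    fix a b assume "a \<in> L" "b \<in> L" "j a = j b"
    then have "fls_const a = fls_const b"
      using g cS unfolding j_def ring_iso_ring_on_iff bij_betw_def by (meson inj_onD)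
    then show "a = b" by (metis fls_const_nth)
  qed
  have hom: "j (a + b) = j a + j b \<and> j (a * b) = j a * j b" if "a \<in> L" "b \<in> L" for a b
  proof -
    have "g (fls_const a + fls_const b) = g (fls_const a) + g (fls_const b) \<and>
          g (fls_const a * fls_const b) = g (fls_const a) * g (fls_const b)"
      using g cS[OF that(1)] cS[OF that(2)] unfolding ring_iso_ring_on_iff by blast
    then show ?thesis unfolding j_def by (simp add: fls_plus_const)
  qed
  have "j 1 = 1" using g unfolding j_def ring_iso_ring_on_iff by simp
  then have j: "j \<in> ring_iso (ring_on L) (ring_on (j ` L))"
    using inj hom unfolding ring_iso_ring_on_iff by (blast intro: inj_on_imp_bij_betw)
  then have il: "iterated_laurent n (j ` L)" using step.IH unfolding is_ring_iso_def by blast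
  have "\<exists>m. m \<in> ring_iso (ring_on {f. \<forall>i. fls_nth f i \<in> j ` L}) (ring_on ?S)"
    using fls_map_iso[OF ring_iso_ring_on_inv[OF j L] subring_set_iso[OF j L]] by blast
  then have "ring_on {f. \<forall>i. fls_nth f i \<in> j ` L} \<simeq> ring_on F'"
    using g ring_iso_set_trans unfolding is_ring_iso_def by blast
  then show ?case using iterated_laurent.step[OF il] by blast
qed

lemma iterated_laurent_real: "iterated_laurent 0 (UNIV :: real set)"
  by (rule iterated_laurent.base) (rule ring_iso_refl)

lemma iterated_laurent_fls:
  assumes "iterated_laurent n (UNIV :: 'k::field set)"
  shows "iterated_laurent (Suc n) (UNIV :: 'k fls set)"
proof -
  have "inj (fls_const :: 'k \<Rightarrow> _)" by (rule injI) (metis fls_const_nth)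
  then have c: "fls_const \<in> ring_iso (ring_on (UNIV :: 'k set)) (ring_on (range fls_const))"
    unfolding ring_iso_ring_on_iff
    by (auto simp: fls_plus_const inj_on_imp_bij_betw)
  have U: "subring_set (UNIV :: 'k set)" by (simp add: subring_set_def)
  have "iterated_laurent n (range (fls_const :: 'k \<Rightarrow> _))"
    using iterated_laurent_iso[OF assms] c unfolding is_ring_iso_def by blast
  moreover have "ring_on {f. \<forall>i. fls_nth f i \<in> range (fls_const :: 'k \<Rightarrow> _)} \<simeq> ring_on (UNIV :: 'k fls set)"
    using fls_map_iso[OF ring_iso_ring_on_inv[OF c U] subring_set_iso[OF c U]]
    unfolding is_ring_iso_def by auto
  ultimately show ?thesis by (rule iterated_laurent.step)
qed


section \<open>Definable sets\<close>

text \<open>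
  A notion of definability on \<open>'k\<close> is a predicate \<open>D\<close> of type \<open>nat \<Rightarrow> 'k list set \<Rightarrow> bool\<close>:
  \<open>D m X\<close> means that \<open>X\<close> is a definable set of \<open>m\<close>-tuples, a tuple being a list of length \<open>m\<close>.
\<close>

definition definable_bij ::
  "(nat \<Rightarrow> 'k list set \<Rightarrow> bool) \<Rightarrow> nat \<Rightarrow> 'k list set \<Rightarrow> nat \<Rightarrow> 'k list set \<Rightarrow>
    ('k list \<Rightarrow> 'k list) \<Rightarrow> bool" where
  "definable_bij D m X n Y f \<longleftrightarrow>
     D m X \<and> D n Y \<and> bij_betw f X Y \<and> D (m + n) ((\<lambda>x. x @ f x) ` X)"

definition singles :: "'k set \<Rightarrow> 'k list set" where
  "singles A = (\<lambda>x. [x]) ` A"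


subsection \<open>The language of rings\<close>

datatype ring_term = TVar nat | TZero | TOne | TNeg ring_term
  | TAdd ring_term ring_term | TMul ring_term ring_term

datatype ring_formula = FEq ring_term ring_term | FNot ring_formula
  | FAnd ring_formula ring_formula | FEx nat ring_formula

primrec ring_eval :: "(nat \<Rightarrow> 'k::field) \<Rightarrow> ring_term \<Rightarrow> 'k" where
  "ring_eval e (TVar i) = e i"
| "ring_eval e TZero = 0"
| "ring_eval e TOne = 1"
| "ring_eval e (TNeg s) = - ring_eval e s"
| "ring_eval e (TAdd s t) = ring_eval e s + ring_eval e t"
| "ring_eval e (TMul s t) = ring_eval e s * ring_eval e t"

primrec ring_sat :: "(nat \<Rightarrow> 'k::field) \<Rightarrow> ring_formula \<Rightarrow> bool" where
  "ring_sat e (FEq s t) \<longleftrightarrow> ring_eval e s = ring_eval e t"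
| "ring_sat e (FNot \<phi>) \<longleftrightarrow> \<not> ring_sat e \<phi>"
| "ring_sat e (FAnd \<phi> \<psi>) \<longleftrightarrow> ring_sat e \<phi> \<and> ring_sat e \<psi>"
| "ring_sat e (FEx i \<phi>) \<longleftrightarrow> (\<exists>a. ring_sat (e(i := a)) \<phi>)"

text \<open>The tuple fills the variables \<open>0, ..., m - 1\<close>; the values that \<open>e\<close> gives to the
  remaining variables are the parameters.\<close>

definition assign :: "'k list \<Rightarrow> (nat \<Rightarrow> 'k) \<Rightarrow> nat \<Rightarrow> 'k" where
  "assign x e i = (if i < length x then x ! i else e i)"

definition ring_definable :: "nat \<Rightarrow> 'k::field list set \<Rightarrow> bool" where
  "ring_definable m X \<longleftrightarrow>
     (\<exists>\<phi> e. X = {x. length x = m \<and> ring_sat (assign x e) \<phi>})"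


section \<open>The group \<open>H\<close>\<close>

definition nth_powers :: "nat \<Rightarrow> 'k::field set" where
  "nth_powers n = {x ^ n | x. x \<noteq> 0}"

definition root_count :: "'k::field itself \<Rightarrow> nat \<Rightarrow> nat" where
  "root_count _ n = card {x :: 'k. x ^ n = 1}"

definition power_cosets :: "nat \<Rightarrow> 'k::field set set" where
  "power_cosets n = {(*) x ` nth_powers n | x. x \<noteq> 0}"

definition has_definable_root :: "(nat \<Rightarrow> 'k::field list set \<Rightarrow> bool) \<Rightarrow> nat \<Rightarrow> bool" where
  "has_definable_root D n \<longleftrightarrow>
     (\<exists>S r. 0 \<notin> S \<and> definable_bij D 1 (singles (nth_powers n)) 1 (singles S) (map r) \<and>
        (\<forall>x \<in> nth_powers n. r x ^ n = x))"

text \<open>The index of the \<open>n\<close>-th powers is the number of their cosets; it is finite iff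
  the set of cosets is.\<close>

definition lam :: "(nat \<Rightarrow> 'k::field list set \<Rightarrow> bool) \<Rightarrow> nat \<Rightarrow> nat" where
  "lam D n =
     (let r = root_count TYPE('k) n; C = power_cosets n :: 'k set set in
      if finite C \<and> r dvd card C \<and> has_definable_root D n then card C div r else 1)"

definition H_group :: "(nat \<Rightarrow> 'k::field list set \<Rightarrow> bool) \<Rightarrow> int set" where
  "H_group D = generate integer_group {int (lam D n) - 1 | n. n > 1}"


section \<open>The Grothendieck ring\<close>

definition definable_sets :: "(nat \<Rightarrow> 'k list set \<Rightarrow> bool) \<Rightarrow> 'k list set set" where
  "definable_sets D = {X. \<exists>m > 0. D m X}"

definition K0_relations :: "(nat \<Rightarrow> 'k list set \<Rightarrow> bool) \<Rightarrow> ('k list set \<Rightarrow>\<^sub>0 int) set" where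
  "K0_relations D =
     {frag_of X - frag_of Y | X Y. \<exists>m > 0. \<exists>n > 0. \<exists>f. definable_bij D m X n Y f} \<union>
     {frag_of (X \<union> Y) - (frag_of X + frag_of Y) | X Y.
        \<exists>m > 0. D m (X \<union> Y) \<and> D m X \<and> D m Y \<and> X \<inter> Y = {}}"

definition tuple_prod :: "'k list set \<Rightarrow> 'k list set \<Rightarrow> 'k list set" where
  "tuple_prod X Y = {x @ y | x y. x \<in> X \<and> y \<in> Y}"

definition formal_prod ::
  "('k list set \<Rightarrow>\<^sub>0 int) \<Rightarrow> ('k list set \<Rightarrow>\<^sub>0 int) \<Rightarrow> ('k list set \<Rightarrow>\<^sub>0 int)" where
  "formal_prod a b = frag_extend (\<lambda>X. frag_extend (\<lambda>Y. frag_of (tuple_prod X Y)) b) a"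

text \<open>Tuples are lists, so the empty set is the same object in every arity; its class is zero
  in any case.  Cosets are multiplied as by \<open>rcoset_mult\<close>, along the bilinear extension of the
  cartesian product.\<close>

definition K0 :: "(nat \<Rightarrow> 'k::zero list set \<Rightarrow> bool) \<Rightarrow> ('k list set \<Rightarrow>\<^sub>0 int) set ring" where
  "K0 D =
     (let F = free_Abelian_group (definable_sets D); N = generate F (K0_relations D) in
      \<lparr>carrier = carrier (F Mod N),
       monoid.mult = (\<lambda>A B. \<Union>a\<in>A. \<Union>b\<in>B. N #>\<^bsub>F\<^esub> formal_prod a b),
       one = N #>\<^bsub>F\<^esub> frag_of {[0]},
       ring.zero = \<one>\<^bsub>F Mod N\<^esub>,
       add = (\<otimes>\<^bsub>F Mod N\<^esub>)\<rparr>)"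


section \<open>Valuations\<close>

text \<open>\<open>'g adjoin_inf\<close> is $G \cup \{\infty\}$; as usual $- \infty$ is read as $\infty$.\<close>

datatype 'g adjoin_inf = Fin 'g | Infty

instantiation adjoin_inf :: (plus) plus
begin
fun plus_adjoin_inf :: "'a adjoin_inf \<Rightarrow> 'a adjoin_inf \<Rightarrow> 'a adjoin_inf" where
  "plus_adjoin_inf (Fin a) (Fin b) = Fin (a + b)"
| "plus_adjoin_inf _ _ = Infty"
instance ..
end

instantiation adjoin_inf :: (zero) zero
begin
definition zero_adjoin_inf :: "'a adjoin_inf" where "0 = Fin 0"
instance ..
end

instantiation adjoin_inf :: (uminus) uminus
begin
fun uminus_adjoin_inf :: "'a adjoin_inf \<Rightarrow> 'a adjoin_inf" where
  "uminus_adjoin_inf (Fin a) = Fin (- a)"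
| "uminus_adjoin_inf Infty = Infty"
instance ..
end

instantiation adjoin_inf :: (linorder) linorder
begin
fun less_eq_adjoin_inf :: "'a adjoin_inf \<Rightarrow> 'a adjoin_inf \<Rightarrow> bool" where
  "less_eq_adjoin_inf (Fin a) (Fin b) = (a \<le> b)"
| "less_eq_adjoin_inf _ Infty = True"
| "less_eq_adjoin_inf Infty (Fin _) = False"
definition less_adjoin_inf :: "'a adjoin_inf \<Rightarrow> 'a adjoin_inf \<Rightarrow> bool" where
  "less_adjoin_inf x y \<longleftrightarrow> x \<le> y \<and> \<not> y \<le> x"
instance
proof
  fix x y z :: "'a adjoin_inf"
  show "x < y \<longleftrightarrow> x \<le> y \<and> \<not> y \<le> x" by (rule less_adjoin_inf_def)
  show "x \<le> x" by (cases x) auto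
  show "x \<le> y \<Longrightarrow> y \<le> z \<Longrightarrow> x \<le> z" by (cases x; cases y; cases z) auto
  show "x \<le> y \<Longrightarrow> y \<le> x \<Longrightarrow> x = y" by (cases x; cases y) auto
  show "x \<le> y \<or> y \<le> x" by (cases x; cases y) auto
qed
end

definition valuation :: "('k::field \<Rightarrow> 'g::linordered_ab_group_add adjoin_inf) \<Rightarrow> bool" where
  "valuation v \<longleftrightarrow>
     (\<forall>x. v x = Infty \<longleftrightarrow> x = 0) \<and>
     (\<forall>x y. v (x * y) = v x + v y) \<and>
     (\<forall>x y. min (v x) (v y) \<le> v (x + y))"

definition val_ring :: "('k::field \<Rightarrow> 'g::linordered_ab_group_add adjoin_inf) \<Rightarrow> 'k ring" where
  "val_ring v = ring_on {x. 0 \<le> v x}"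

definition val_ideal :: "('k::field \<Rightarrow> 'g::linordered_ab_group_add adjoin_inf) \<Rightarrow> 'k set" where
  "val_ideal v = {x. 0 < v x}"

definition residue_field ::
  "('k::field \<Rightarrow> 'g::linordered_ab_group_add adjoin_inf) \<Rightarrow> 'k set ring" where
  "residue_field v = val_ring v Quot val_ideal v"

definition res_class :: "('k::field \<Rightarrow> 'g::linordered_ab_group_add adjoin_inf) \<Rightarrow> 'k \<Rightarrow> 'k set" where
  "res_class v x = val_ideal v +>\<^bsub>val_ring v\<^esub> x"

definition angular_component ::
  "('k::field \<Rightarrow> 'g::linordered_ab_group_add adjoin_inf) \<Rightarrow> ('k \<Rightarrow> 'k set) \<Rightarrow> bool" where
  "angular_component v ac \<longleftrightarrow>
     ac \<in> hom (mult_of (ring_on UNIV)) (mult_of (residue_field v)) \<and>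
     ac 0 = \<zero>\<^bsub>residue_field v\<^esub> \<and>
     (\<forall>x. v x = 0 \<longrightarrow> ac x = res_class v x)"


subsection \<open>The lexicographically ordered group of integer vectors\<close>

text \<open>\<open>'d lex_int\<close> is $Z^k$ with $k =$ \<open>CARD('d)\<close>, which is an arbitrary positive number;
  the coordinates are indexed by the finite linear order \<open>'d\<close>, the least index being the
  most significant one.\<close>

typedef 'd lex_int = "UNIV :: ('d \<Rightarrow> int) set"
  morphisms coord Lex ..

setup_lifting type_definition_lex_int

instantiation lex_int :: ("{finite,linorder}") linordered_ab_group_add
begin

lift_definition zero_lex_int :: "'a lex_int" is "\<lambda>_. 0" .
lift_definition plus_lex_int :: "'a lex_int \<Rightarrow> 'a lex_int \<Rightarrow> 'a lex_int" is "\<lambda>r s i. r i + s i" .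
lift_definition minus_lex_int :: "'a lex_int \<Rightarrow> 'a lex_int \<Rightarrow> 'a lex_int" is "\<lambda>r s i. r i - s i" .
lift_definition uminus_lex_int :: "'a lex_int \<Rightarrow> 'a lex_int" is "\<lambda>r i. - r i" .
lift_definition less_lex_int :: "'a lex_int \<Rightarrow> 'a lex_int \<Rightarrow> bool" is less_fun .
lift_definition less_eq_lex_int :: "'a lex_int \<Rightarrow> 'a lex_int \<Rightarrow> bool"
  is "\<lambda>r s. less_fun r s \<or> r = s" .

instance
proof
  fix a b c :: "'a lex_int"
  show "a + b + c = a + (b + c)" "a + b = b + a" "0 + a = a" "- a + a = 0" "a - b = a + - b"
    by (transfer; simp add: fun_eq_iff)+
  show "a < b \<longleftrightarrow> a \<le> b \<and> \<not> b \<le> a"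
    by transfer (metis less_fun_asym less_fun_irrefl)
  show "a \<le> a" by transfer simp
  show "a \<le> b \<Longrightarrow> b \<le> c \<Longrightarrow> a \<le> c" by transfer (metis less_fun_trans)
  show "a \<le> b \<Longrightarrow> b \<le> a \<Longrightarrow> a = b" by transfer (metis less_fun_asym)
  show "a \<le> b \<or> b \<le> a" by transfer (metis less_fun_trichotomy finite)
  show "a \<le> b \<Longrightarrow> c + a \<le> c + b" by transfer (auto simp: less_fun_def)
qed

end

definition unit_vec :: "'d \<Rightarrow> 'd lex_int" where
  "unit_vec i = Lex (\<lambda>j. if j = i then 1 else 0)"

text \<open>The natural angular component map with respect to elements \<open>\<tau> i\<close> of value \<open>unit_vec i\<close>.\<close>

definition natural_ac ::
  "('k::field \<Rightarrow> 'd::{finite,linorder} lex_int adjoin_inf) \<Rightarrow> ('d \<Rightarrow> 'k) \<Rightarrow> 'k \<Rightarrow> 'k set" where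
  "natural_ac v \<tau> x =
     (case v x of
        Fin r \<Rightarrow> res_class v (x * (\<Prod>i\<in>UNIV. \<tau> i powi (- coord r i)))
      | Infty \<Rightarrow> \<zero>\<^bsub>residue_field v\<^esub>)"

lemma Fin_less: "Fin a < Fin b \<longleftrightarrow> a < b" "Fin a < Infty" "\<not> Infty < x"
  by (cases x; auto simp: less_adjoin_inf_def)+

lemma val_one:
  assumes "valuation v"
  shows "v 1 = 0"
proof -
  from assms have "v 1 \<noteq> Infty" "v (1 * 1) = v 1 + v 1" unfolding valuation_def by (metis zero_neq_one)+
  then show ?thesis by (cases "v 1") (auto simp: zero_adjoin_inf_def)
qed

lemma val_uminus:
  fixes v :: "'k::field \<Rightarrow> 'g::linordered_ab_group_add adjoin_inf"
  assumes v: "valuation v"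
  shows "v (- x) = v x"
proof -
  from v have m: "v (- 1) \<noteq> Infty" "v (- 1) + v (- 1) = v ((-1) * (-1))" 
    unfolding valuation_def by (metis neg_equal_0_iff_equal zero_neq_one)+
  then have "v (- 1) = 0"
    using val_one[OF v] by (cases "v (- 1)") (auto simp: zero_adjoin_inf_def)
  moreover have "v (- 1 * x) = v (- 1) + v x" using v unfolding valuation_def by blast
  ultimately show ?thesis by (cases "v x") (simp_all add: zero_adjoin_inf_def)
qed

lemma cring_val_ring:
  fixes v :: "'k::field \<Rightarrow> 'g::linordered_ab_group_add adjoin_inf"
  assumes v: "valuation v"
  shows "cring (val_ring v)"
proof -
  have vm: "v (x * y) = v x + v y" for x y using v unfolding valuation_def by blast
  have add: "0 \<le> v x \<Longrightarrow> 0 \<le> v y \<Longrightarrow> 0 \<le> v (x + y)" for x y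
    using v unfolding valuation_def by (meson min.boundedI order_trans)
  have mul: "0 \<le> v x \<Longrightarrow> 0 \<le> v y \<Longrightarrow> 0 \<le> v (x * y)" for x y
    by (cases "v x"; cases "v y") (auto simp: zero_adjoin_inf_def vm)
  have "v 0 = Infty" using v unfolding valuation_def by blast
  then have z: "0 \<le> v 0" by (simp add: zero_adjoin_inf_def)
  have inv: "\<exists>y. 0 \<le> v y \<and> x + y = 0" if "0 \<le> v x" for x
    using that val_uminus[OF v] by (intro exI[of _ "- x"]) simp
  show ?thesis unfolding val_ring_def ring_on_def
    by (rule cringI; (rule abelian_groupI | rule comm_monoidI)?)
       (auto simp: algebra_simps val_one[OF v] intro: add mul z inv)
qed

lemma ideal_val_ideal:
  fixes v :: "'k::field \<Rightarrow> 'g::linordered_ab_group_add adjoin_inf"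
  assumes v: "valuation v"
  shows "ideal (val_ideal v) (val_ring v)"
proof -
  interpret R: cring "val_ring v" by (rule cring_val_ring[OF v])
  have vm: "v (x * y) = v x + v y" for x y using v unfolding valuation_def by blast
  have add: "0 < v x \<Longrightarrow> 0 < v y \<Longrightarrow> 0 < v (x + y)" for x y
    using v unfolding valuation_def by (metis min_less_iff_conj order_less_le_trans)
  have mul: "0 < v x \<Longrightarrow> 0 \<le> v y \<Longrightarrow> 0 < v (x * y)" for x y
    by (cases "v x"; cases "v y") (auto simp: vm zero_adjoin_inf_def Fin_less intro: add_pos_nonneg)
  have v0: "v 0 = Infty" using v unfolding valuation_def by blast
  have inv: "\<ominus>\<^bsub>val_ring v\<^esub> x = - x" if "0 \<le> v x" for x
    by (rule R.minus_equality) (use that val_uminus[OF v] in \<open>auto simp: val_ring_def ring_on_def\<close>)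
  show ?thesis
  proof (rule idealI)
    show "subgroup (val_ideal v) (add_monoid (val_ring v))"
    proof (rule group.subgroupI)
      show "group (add_monoid (val_ring v))" by (rule R.add.group_axioms)
      show "val_ideal v \<noteq> {}" using v0 
        by (auto simp: val_ideal_def less_adjoin_inf_def zero_adjoin_inf_def intro!: exI[of _ 0])
      show "inv\<^bsub>add_monoid (val_ring v)\<^esub> a \<in> val_ideal v" if "a \<in> val_ideal v" for a
        using inv[of a] that val_uminus[OF v] by (simp add: a_inv_def val_ideal_def)
    qed (auto simp: val_ideal_def val_ring_def ring_on_def add)
  qed (use mul R.ring_axioms in \<open>auto simp: val_ideal_def val_ring_def ring_on_def mult.commute\<close>)
qed

lemma res_class_eq_zero_iff:
  assumes v: "valuation v" and x: "0 \<le> v x"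
  shows "res_class v x = \<zero>\<^bsub>residue_field v\<^esub> \<longleftrightarrow> 0 < v x"
proof -
  interpret I: ideal "val_ideal v" "val_ring v" by (rule ideal_val_ideal[OF v])
  have c: "x \<in> carrier (val_ring v)" using x by (simp add: val_ring_def ring_on_def)
  show ?thesis
    using I.a_rcos_self[OF c] I.a_rcos_const[of x]
    by (auto simp: res_class_def residue_field_def FactRing_def val_ideal_def)
qed

lemma angular_component_natural_ac:
  fixes v :: "'k::field \<Rightarrow> 'd::{finite,linorder} lex_int adjoin_inf"
  assumes v: "valuation v" and \<tau>: "\<And>i. v (\<tau> i) = Fin (unit_vec i)"
  shows "angular_component v (natural_ac v \<tau>)"
proof -
  interpret I: ideal "val_ideal v" "val_ring v" by (rule ideal_val_ideal[OF v])
  have mul: "v (x * y) = v x + v y" and v0: "v x = Infty \<longleftrightarrow> x = 0" for x y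
    using v unfolding valuation_def by blast+
  have \<tau>0: "\<tau> i \<noteq> 0" for i using \<tau>[of i] v0[of "\<tau> i"] by auto
  have inv: "v (inverse x) = - v x" if "x \<noteq> 0" for x
  proof -
    have "v x + v (inverse x) = 0" using that mul[of x "inverse x"] val_one[OF v] by simp
    then show ?thesis 
      by (cases "v x"; cases "v (inverse x)") (auto simp: zero_adjoin_inf_def minus_unique)
  qed
  define e :: "int \<Rightarrow> 'd \<Rightarrow> 'd lex_int" where "e m i = Lex (\<lambda>j. if j = i then m else 0)" for m i
  have e: "e m i + e l i = e (m + l) i" "- e m i = e (- m) i" "e 0 i = 0" "unit_vec i = e 1 i" for m l i
    by (auto simp: e_def unit_vec_def coord_inject[symmetric] plus_lex_int.rep_eq uminus_lex_int.rep_eq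
        zero_lex_int.rep_eq Lex_inverse fun_eq_iff)
  have pw: "v (\<tau> i ^ m) = Fin (e (int m) i)" for i m
    by (induction m) (auto simp: mul \<tau> e val_one[OF v] zero_adjoin_inf_def)
  have pi: "v (\<tau> i powi m) = Fin (e m i)" for i m
    using pw[of i "nat m"] pw[of i "nat (- m)"] \<tau>0[of i]
    by (auto simp: power_int_def inv e power_inverse)
  have pr: "v (\<Prod>i\<in>A. \<tau> i powi m i) = Fin (\<Sum>i\<in>A. e (m i) i)" if "finite A" for A m
    using that by (induction A) (auto simp: mul pi val_one[OF v] zero_adjoin_inf_def)
  have cs: "coord (\<Sum>i\<in>A. f i) j = (\<Sum>i\<in>A. coord (f i) j)" for A :: "'d set" and f j
    by (induction A rule: infinite_finite_induct) (auto simp: zero_lex_int.rep_eq plus_lex_int.rep_eq)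
  have se: "(\<Sum>i\<in>UNIV. e (m i) i) = Lex m" for m
    by (simp add: coord_inject[symmetric] cs fun_eq_iff Lex_inverse e_def)
  define u where "u r = (\<Prod>i\<in>UNIV. \<tau> i powi (- coord r i))" for r
  have vu: "v (u r) = Fin (- r)" for r
    unfolding u_def by (subst pr) (simp_all add: se coord_inject[symmetric] uminus_lex_int.rep_eq Lex_inverse)
  have u_add: "u (r + s) = u r * u s" for r s
    unfolding u_def using \<tau>0
    by (simp add: plus_lex_int.rep_eq power_int_add prod.distrib[symmetric] power_int_diff power_int_minus field_simps)
  have ac: "natural_ac v \<tau> x = res_class v (x * u r)" "v (x * u r) = 0" if "v x = Fin r" for x r
    using that by (auto simp: natural_ac_def u_def[symmetric] mul vu zero_adjoin_inf_def)
  have res_mult: "res_class v (x * y) = res_class v x \<otimes>\<^bsub>residue_field v\<^esub> res_class v y"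
    if "v x = 0" "v y = 0" for x y
    using I.rcoset_mult_add[of x y] that
    by (simp add: res_class_def residue_field_def FactRing_def val_ring_def ring_on_def)
  have res_carr: "res_class v x \<in> carrier (mult_of (residue_field v))" if "v x = 0" for x
  proof -
    have "x \<in> carrier (val_ring v)" using that by (simp add: val_ring_def ring_on_def)
    then have "res_class v x \<in> carrier (residue_field v)"
      using I.a_rcosetsI[OF I.a_subset] by (simp add: res_class_def residue_field_def FactRing_def)
    then show ?thesis using that res_class_eq_zero_iff[OF v, of x] by simp
  qed
  show ?thesis unfolding angular_component_def
  proof (intro conjI allI impI)
    have fin: "\<exists>r. v x = Fin r" if "x \<noteq> 0" for x using that v0[of x] by (cases "v x") auto
    show "natural_ac v \<tau> \<in> hom (mult_of (ring_on UNIV)) (mult_of (residue_field v))"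
    proof (rule homI)
      fix x assume "x \<in> carrier (mult_of (ring_on (UNIV :: 'k set)))"
      then obtain r where "v x = Fin r" using fin by (auto simp: ring_on_def)
      then show "natural_ac v \<tau> x \<in> carrier (mult_of (residue_field v))"
        using ac res_carr by metis
    next
      fix x y assume "x \<in> carrier (mult_of (ring_on (UNIV :: 'k set)))" "y \<in> carrier (mult_of (ring_on (UNIV :: 'k set)))"
      then obtain r s where rs: "v x = Fin r" "v y = Fin s"
        using fin[of x] fin[of y] by (auto simp: ring_on_def)
      then have "v (x * y) = Fin (r + s)" by (simp add: mul)
      then have "natural_ac v \<tau> (x * y) = res_class v ((x * u r) * (y * u s))"
        using ac(1) by (simp add: u_add mult_ac)
      then show "natural_ac v \<tau> (x \<otimes>\<^bsub>mult_of (ring_on UNIV)\<^esub> y) =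
          natural_ac v \<tau> x \<otimes>\<^bsub>mult_of (residue_field v)\<^esub> natural_ac v \<tau> y"
        using rs ac res_mult by (simp add: ring_on_def)
    qed
    show "natural_ac v \<tau> 0 = \<zero>\<^bsub>residue_field v\<^esub>" using v0[of 0] by (simp add: natural_ac_def)
    show "natural_ac v \<tau> x = res_class v x" if "v x = 0" for x
      using that ac(1)[of x 0] by (simp add: zero_adjoin_inf_def u_def zero_lex_int.rep_eq)
  qed
qed


section \<open>Languages of Denef--Pas\<close>

text \<open>The symbols by which a sort with universe of type \<open>'u\<close> is expanded beyond its basic
  language, together with their interpretation.  The sets of symbols may be empty.\<close>

record ('f, 'p, 'u) expansion =
  fun_syms :: "'f set"
  fun_arity :: "'f \<Rightarrow> nat"
  fun_interp :: "'f \<Rightarrow> 'u list \<Rightarrow> 'u"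
  rel_syms :: "'p set"
  rel_arity :: "'p \<Rightarrow> nat"
  rel_interp :: "'p \<Rightarrow> 'u list \<Rightarrow> bool"

definition expansion_on :: "'u set \<Rightarrow> ('f, 'p, 'u) expansion \<Rightarrow> bool" where
  "expansion_on A L \<longleftrightarrow>
     (\<forall>f \<in> fun_syms L. \<forall>us. length us = fun_arity L f \<and> set us \<subseteq> A \<longrightarrow> fun_interp L f us \<in> A)"

text \<open>Since no symbol leads into the valued field sort from another sort, the terms of that
  sort are those of the language of rings.  \<open>Ac\<close> and \<open>Val\<close> are the symbols for the angular
  component map and the valuation.\<close>

datatype 'f res_term = RVar nat | RZero | ROne | RNeg "'f res_term"
  | RAdd "'f res_term" "'f res_term" | RMul "'f res_term" "'f res_term"
  | RFun 'f "'f res_term list" | Ac ring_term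

datatype 'h grp_term = GVar nat | GZero | GInf | GNeg "'h grp_term"
  | GAdd "'h grp_term" "'h grp_term"
  | GFun 'h "'h grp_term list" | Val ring_term

datatype ('f, 'p, 'h, 'q) pas_formula =
    EqK ring_term ring_term
  | EqR "'f res_term" "'f res_term" | RelR 'p "'f res_term list"
  | EqG "'h grp_term" "'h grp_term" | LeG "'h grp_term" "'h grp_term" | RelG 'q "'h grp_term list"
  | PNot "('f, 'p, 'h, 'q) pas_formula"
  | PAnd "('f, 'p, 'h, 'q) pas_formula" "('f, 'p, 'h, 'q) pas_formula"
  | ExK nat "('f, 'p, 'h, 'q) pas_formula"
  | ExR nat "('f, 'p, 'h, 'q) pas_formula"
  | ExG nat "('f, 'p, 'h, 'q) pas_formula"

primrec res_wf :: "('f, 'p, 'u) expansion \<Rightarrow> 'f res_term \<Rightarrow> bool" where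
  "res_wf L (RVar i) \<longleftrightarrow> True"
| "res_wf L RZero \<longleftrightarrow> True"
| "res_wf L ROne \<longleftrightarrow> True"
| "res_wf L (RNeg s) \<longleftrightarrow> res_wf L s"
| "res_wf L (RAdd s t) \<longleftrightarrow> res_wf L s \<and> res_wf L t"
| "res_wf L (RMul s t) \<longleftrightarrow> res_wf L s \<and> res_wf L t"
| "res_wf L (RFun f ts) \<longleftrightarrow>
     f \<in> fun_syms L \<and> length ts = fun_arity L f \<and> list_all id (map (res_wf L) ts)"
| "res_wf L (Ac t) \<longleftrightarrow> True"

primrec grp_wf :: "('h, 'q, 'u) expansion \<Rightarrow> 'h grp_term \<Rightarrow> bool" where
  "grp_wf L (GVar i) \<longleftrightarrow> True"
| "grp_wf L GZero \<longleftrightarrow> True"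
| "grp_wf L GInf \<longleftrightarrow> True"
| "grp_wf L (GNeg s) \<longleftrightarrow> grp_wf L s"
| "grp_wf L (GAdd s t) \<longleftrightarrow> grp_wf L s \<and> grp_wf L t"
| "grp_wf L (GFun f ts) \<longleftrightarrow>
     f \<in> fun_syms L \<and> length ts = fun_arity L f \<and> list_all id (map (grp_wf L) ts)"
| "grp_wf L (Val t) \<longleftrightarrow> True"

primrec pas_wf ::
  "('f, 'p, 'r) expansion \<Rightarrow> ('h, 'q, 'g) expansion \<Rightarrow> ('f, 'p, 'h, 'q) pas_formula \<Rightarrow> bool" where
  "pas_wf Lk LG (EqK s t) \<longleftrightarrow> True"
| "pas_wf Lk LG (EqR s t) \<longleftrightarrow> res_wf Lk s \<and> res_wf Lk t"
| "pas_wf Lk LG (RelR p ts) \<longleftrightarrow>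
     p \<in> rel_syms Lk \<and> length ts = rel_arity Lk p \<and> list_all (res_wf Lk) ts"
| "pas_wf Lk LG (EqG s t) \<longleftrightarrow> grp_wf LG s \<and> grp_wf LG t"
| "pas_wf Lk LG (LeG s t) \<longleftrightarrow> grp_wf LG s \<and> grp_wf LG t"
| "pas_wf Lk LG (RelG p ts) \<longleftrightarrow>
     p \<in> rel_syms LG \<and> length ts = rel_arity LG p \<and> list_all (grp_wf LG) ts"
| "pas_wf Lk LG (PNot \<phi>) \<longleftrightarrow> pas_wf Lk LG \<phi>"
| "pas_wf Lk LG (PAnd \<phi> \<psi>) \<longleftrightarrow> pas_wf Lk LG \<phi> \<and> pas_wf Lk LG \<psi>"
| "pas_wf Lk LG (ExK i \<phi>) \<longleftrightarrow> pas_wf Lk LG \<phi>"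
| "pas_wf Lk LG (ExR i \<phi>) \<longleftrightarrow> pas_wf Lk LG \<phi>"
| "pas_wf Lk LG (ExG i \<phi>) \<longleftrightarrow> pas_wf Lk LG \<phi>"

primrec res_eval ::
  "'r ring \<Rightarrow> ('k::field \<Rightarrow> 'r) \<Rightarrow> ('f, 'p, 'r) expansion \<Rightarrow>
    (nat \<Rightarrow> 'k) \<Rightarrow> (nat \<Rightarrow> 'r) \<Rightarrow> 'f res_term \<Rightarrow> 'r" where
  "res_eval R ac L e d (RVar i) = d i"
| "res_eval R ac L e d RZero = \<zero>\<^bsub>R\<^esub>"
| "res_eval R ac L e d ROne = \<one>\<^bsub>R\<^esub>"
| "res_eval R ac L e d (RNeg s) = \<ominus>\<^bsub>R\<^esub> res_eval R ac L e d s"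
| "res_eval R ac L e d (RAdd s t) = res_eval R ac L e d s \<oplus>\<^bsub>R\<^esub> res_eval R ac L e d t"
| "res_eval R ac L e d (RMul s t) = res_eval R ac L e d s \<otimes>\<^bsub>R\<^esub> res_eval R ac L e d t"
| "res_eval R ac L e d (RFun f ts) = fun_interp L f (map (res_eval R ac L e d) ts)"
| "res_eval R ac L e d (Ac t) = ac (ring_eval e t)"

primrec grp_eval ::
  "('k::field \<Rightarrow> 'g::linordered_ab_group_add adjoin_inf) \<Rightarrow> ('h, 'q, 'g adjoin_inf) expansion \<Rightarrow>
    (nat \<Rightarrow> 'k) \<Rightarrow> (nat \<Rightarrow> 'g adjoin_inf) \<Rightarrow> 'h grp_term \<Rightarrow> 'g adjoin_inf" where
  "grp_eval v L e c (GVar i) = c i"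
| "grp_eval v L e c GZero = 0"
| "grp_eval v L e c GInf = Infty"
| "grp_eval v L e c (GNeg s) = - grp_eval v L e c s"
| "grp_eval v L e c (GAdd s t) = grp_eval v L e c s + grp_eval v L e c t"
| "grp_eval v L e c (GFun f ts) = fun_interp L f (map (grp_eval v L e c) ts)"
| "grp_eval v L e c (Val t) = v (ring_eval e t)"

text \<open>The three environments interpret the variables of the valued field, the residue field and
  the value group sort.\<close>

primrec pas_sat ::
  "('k::field \<Rightarrow> 'g::linordered_ab_group_add adjoin_inf) \<Rightarrow> ('k \<Rightarrow> 'k set) \<Rightarrow>
    ('f, 'p, 'k set) expansion \<Rightarrow> ('h, 'q, 'g adjoin_inf) expansion \<Rightarrow>
    (nat \<Rightarrow> 'k) \<Rightarrow> (nat \<Rightarrow> 'k set) \<Rightarrow> (nat \<Rightarrow> 'g adjoin_inf) \<Rightarrow>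
    ('f, 'p, 'h, 'q) pas_formula \<Rightarrow> bool" where
  "pas_sat v ac Lk LG e d c (EqK s t) \<longleftrightarrow> ring_eval e s = ring_eval e t"
| "pas_sat v ac Lk LG e d c (EqR s t) \<longleftrightarrow>
     res_eval (residue_field v) ac Lk e d s = res_eval (residue_field v) ac Lk e d t"
| "pas_sat v ac Lk LG e d c (RelR p ts) \<longleftrightarrow>
     rel_interp Lk p (map (res_eval (residue_field v) ac Lk e d) ts)"
| "pas_sat v ac Lk LG e d c (EqG s t) \<longleftrightarrow> grp_eval v LG e c s = grp_eval v LG e c t"
| "pas_sat v ac Lk LG e d c (LeG s t) \<longleftrightarrow> grp_eval v LG e c s \<le> grp_eval v LG e c t"
| "pas_sat v ac Lk LG e d c (RelG p ts) \<longleftrightarrow> rel_interp LG p (map (grp_eval v LG e c) ts)"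
| "pas_sat v ac Lk LG e d c (PNot \<phi>) \<longleftrightarrow> \<not> pas_sat v ac Lk LG e d c \<phi>"
| "pas_sat v ac Lk LG e d c (PAnd \<phi> \<psi>) \<longleftrightarrow>
     pas_sat v ac Lk LG e d c \<phi> \<and> pas_sat v ac Lk LG e d c \<psi>"
| "pas_sat v ac Lk LG e d c (ExK i \<phi>) \<longleftrightarrow> (\<exists>a. pas_sat v ac Lk LG (e(i := a)) d c \<phi>)"
| "pas_sat v ac Lk LG e d c (ExR i \<phi>) \<longleftrightarrow>
     (\<exists>a \<in> carrier (residue_field v). pas_sat v ac Lk LG e (d(i := a)) c \<phi>)"
| "pas_sat v ac Lk LG e d c (ExG i \<phi>) \<longleftrightarrow> (\<exists>a. pas_sat v ac Lk LG e d (c(i := a)) \<phi>)"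

text \<open>Parameters from all three sorts are allowed.\<close>

definition pas_definable ::
  "('k::field \<Rightarrow> 'g::linordered_ab_group_add adjoin_inf) \<Rightarrow> ('k \<Rightarrow> 'k set) \<Rightarrow>
    ('f, 'p, 'k set) expansion \<Rightarrow> ('h, 'q, 'g adjoin_inf) expansion \<Rightarrow>
    nat \<Rightarrow> 'k list set \<Rightarrow> bool" where
  "pas_definable v ac Lk LG m X \<longleftrightarrow>
     (\<exists>\<phi> e d c. pas_wf Lk LG \<phi> \<and> range d \<subseteq> carrier (residue_field v) \<and>
        X = {x. length x = m \<and> pas_sat v ac Lk LG (assign x e) d c \<phi>})"

end

theory Submission
  imports Defs "HOL-Library.Disjoint_Sets"
begin


text \<open>Only three facts about the field $K = R((t_1)) \cdots ((t_n))$ enter the argument.  It has the positive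
  cone \<open>P\<close> of an ordering, the group of $m$-th powers has finite index in $K^\times$ for every
  \<open>m > 0\<close>, and there is a homomorphism of $K^\times$ onto the integers.  The first two are carried
  through the iteration (\<open>iterated_laurent_tame\<close>), the point being that a series with constant
  coefficient 1 has an \<open>m\<close>-th root; the homomorphism is the order of vanishing in the last variable.

  The engine is the following observation (\<open>power_class_representatives\<close>).  Let \<open>U\<close> be a subgroup of
  \<open>P\<close> that contains every element of \<open>P\<close> having a non-trivial power in it, and let \<open>\<omega>\<close> be a
  homomorphism from \<open>U\<close> onto the integers.  Then \<open>U\<close> has representatives modulo \<open>m\<close>-th powers with
  \<open>0 \<le> \<omega> < m\<close>, and their number is finite and a multiple of \<open>m\<close>.

  For the group \<open>H\<close> take \<open>U = P\<close>.  Every element of \<open>P\<close> has at most one \<open>m\<close>-th root in \<open>P\<close>, and \<open>P\<close>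
  is definable as a finite union of square classes, so square roots and odd roots are definable.
  Hence \<open>lam D 2\<close> is the index of the squares in \<open>P\<close>, which is even.  So \<open>N = lam D 2 - 1\<close> is an odd
  element of \<open>H\<close>.  If \<open>N > 1\<close>, then \<open>lam D N\<close> is a multiple of \<open>N\<close>, and \<open>lam D N - 1\<close> is an element
  of \<open>H\<close> that is coprime to \<open>N\<close>.

  For the definable bijection from \<open>K\<close> to $K^\times$ let \<open>T\<close> be the set of those \<open>x\<close> in \<open>U\<close> with
  \<open>\<omega> x \<ge> 0\<close>.  The representatives cut \<open>T\<close> into copies \<open>r T^m\<close> of itself, their number being a
  multiple \<open>a m\<close> of \<open>m\<close>, for every \<open>m\<close>.  As for \<open>H\<close>, this forces \<open>[T] = 0\<close> in the Grothendieck group,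
  and it can be expressed without cancellation: two disjoint copies of \<open>T\<close> are in definable
  bijection with \<open>T\<close> (\<open>copies_two_absorb\<close>).  If \<open>v\<close> is a valuation onto $Z^k$, then the non-zero elements
  of the maximal ideal \<open>M\<close> are cut into \<open>k\<close> slices, according to the leading coordinate of the value, and
  each slice is two copies of such a set \<open>T\<close>.  So the complement of the valuation ring, which
  inversion identifies with \<open>M - {0}\<close>, absorbs the set of all \<open>1 + x\<close> with \<open>x\<close> in \<open>M - {0}\<close>.
  On the other hand let \<open>A\<close> be the set of all \<open>x\<close> with \<open>v x \<ge> 0\<close> and \<open>ac x = 1\<close>, and let \<open>t\<close> have least
  positive value and \<open>ac t = 1\<close>; then \<open>A\<close> is the disjoint union of \<open>t A\<close> and \<open>1 + M\<close>.  Of the two parts of \<open>1 + M\<close>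
  the second is absorbed as described, and the first, the point 1, is left over.  So the union of \<open>A\<close>
  and the complement of the valuation ring is in definable bijection with itself together with the point 0
  (\<open>line_def_equiv_punctured_line\<close>).

  Finally, for any definable \<open>X\<close> the product of \<open>X\<close> with \<open>K\<close> has the same class as the product with
  $K^\times$, so the class of \<open>X\<close> itself is zero (\<open>K0_trivial\<close>).\<close>

section \<open>Ordered fields with finitely many power classes\<close>

text \<open>The fields of the iteration are subsets of types of class \<open>field\<close>, so notions about fields are
  stated for such subsets.\<close>

definition subfield_set :: "'a::field set \<Rightarrow> bool" where
  "subfield_set A \<longleftrightarrow> subring_set A \<and> (\<forall>x\<in>A. - x \<in> A \<and> inverse x \<in> A)"

text \<open>\<open>P\<close> is the set of positive elements of an ordering of the field \<open>A\<close>.\<close>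

definition pos_cone :: "'a::field set \<Rightarrow> 'a set \<Rightarrow> bool" where
  "pos_cone A P \<longleftrightarrow> P \<subseteq> A \<and> 0 \<notin> P \<and> (\<forall>x\<in>A. x = 0 \<or> x \<in> P \<or> - x \<in> P) \<and>
     (\<forall>x\<in>P. \<forall>y\<in>P. x + y \<in> P \<and> x * y \<in> P)"

text \<open>The non-zero \<open>m\<close>-th powers have finite index in the multiplicative group of \<open>A\<close>, for every \<open>m > 0\<close>:
  finitely many of their cosets, given by representatives, cover the group.\<close>

definition finite_power_classes :: "'a::field set \<Rightarrow> bool" where
  "finite_power_classes A \<longleftrightarrow> (\<forall>m>0. \<exists>Q. finite Q \<and> Q \<subseteq> A - {0} \<and>
     (\<forall>x \<in> A - {0}. \<exists>q\<in>Q. \<exists>y \<in> A - {0}. x = q * y ^ m))"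

text \<open>The properties that pass from a coefficient field to its field of Laurent series.\<close>

definition tame_field :: "'a::field set \<Rightarrow> bool" where
  "tame_field A \<longleftrightarrow> subfield_set A \<and> (\<exists>P. pos_cone A P) \<and> finite_power_classes A"

lemma subfield_setD:
  assumes "subfield_set A"
  shows "0 \<in> A" "1 \<in> A" "x \<in> A \<Longrightarrow> y \<in> A \<Longrightarrow> x + y \<in> A" "x \<in> A \<Longrightarrow> y \<in> A \<Longrightarrow> x * y \<in> A"
    "x \<in> A \<Longrightarrow> - x \<in> A" "x \<in> A \<Longrightarrow> inverse x \<in> A"
    "x \<in> A \<Longrightarrow> y \<in> A \<Longrightarrow> x - y \<in> A" "x \<in> A \<Longrightarrow> y \<in> A \<Longrightarrow> x / y \<in> A"
  using assms unfolding subfield_set_def subring_set_def diff_conv_add_uminus divide_inverse by blast+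

lemma subfield_set_power: "subfield_set A \<Longrightarrow> x \<in> A \<Longrightarrow> x ^ m \<in> A"
  by (induction m) (auto intro: subfield_setD)

lemma subfield_set_of_nat: "subfield_set A \<Longrightarrow> of_nat m \<in> A"
  by (induction m) (auto intro: subfield_setD)

lemma pos_cone_one:
  assumes "subfield_set A" "pos_cone A P"
  shows "1 \<in> P"
proof -
  have "(1::'a) \<noteq> 0 \<and> 1 \<in> A" using assms(1) by (auto simp: subfield_set_def subring_set_def)
  then have "1 \<in> P \<or> - 1 \<in> P" using assms(2) unfolding pos_cone_def by blast
  then show ?thesis
    using assms(2) unfolding pos_cone_def by (metis minus_mult_minus mult_1)
qed

lemma pos_cone_of_nat:
  assumes "subfield_set A" "pos_cone A P" "m > 0"
  shows "of_nat m \<in> P"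
  using assms(3)
proof (induction m rule: nat_induct_non_zero)
  case (Suc n)
  then show ?case using pos_cone_one[OF assms(1,2)] assms(2) by (auto simp: pos_cone_def)
qed (use pos_cone_one[OF assms(1,2)] in simp)

lemma tame_field_real: "tame_field (UNIV :: real set)"
  unfolding tame_field_def
proof (intro conjI exI)
  show "subfield_set (UNIV :: real set)" by (simp add: subfield_set_def subring_set_def)
  show "pos_cone (UNIV :: real set) {0<..}" by (auto simp: pos_cone_def)
  show "finite_power_classes (UNIV :: real set)"
    unfolding finite_power_classes_def
  proof (intro allI impI exI[of _ "{1, - 1}"] conjI ballI)
    fix m :: nat and x :: real assume "m > 0" and x: "x \<in> UNIV - {0}"
    then have r: "root m \<bar>x\<bar> ^ m = \<bar>x\<bar>" "root m \<bar>x\<bar> \<noteq> 0" by auto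
    show "\<exists>q\<in>{1, - 1}. \<exists>y\<in>UNIV - {0}. x = q * y ^ m"
    proof (cases "x > 0")
      case True
      then show ?thesis using r by (intro bexI[of _ 1] bexI[of _ "root m \<bar>x\<bar>"]) auto
    next
      case False
      then show ?thesis using r by (intro bexI[of _ "-1"] bexI[of _ "root m \<bar>x\<bar>"]) auto
    qed
  qed auto
qed

lemma tame_field_iso:
  fixes h :: "'a::field \<Rightarrow> 'b::field"
  assumes h: "h \<in> ring_iso (ring_on A) (ring_on B)" and A: "tame_field A"
  shows "tame_field B"
proof -
  from A obtain P where sf: "subfield_set A" and P: "pos_cone A P" and fin: "finite_power_classes A"
    by (auto simp: tame_field_def)
  note sfD = subfield_setD[OF sf]
  have sr: "subring_set A" using sf by (simp add: subfield_set_def)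
  have h0: "h 0 = 0" by (rule iso_zero[OF h sr])
  have B: "B = h ` A" and inj: "inj_on h A" and h1: "h 1 = 1"
    and hom: "\<And>x y. x \<in> A \<Longrightarrow> y \<in> A \<Longrightarrow> h (x + y) = h x + h y \<and> h (x * y) = h x * h y"
    using h by (auto simp: ring_iso_ring_on_iff bij_betw_def)
  have hm: "h (- x) = - h x" if "x \<in> A" for x
    using hom[of x "- x"] that sfD(5)[OF that] h0 by (simp add: eq_neg_iff_add_eq_0 add.commute)
  have hi: "h (inverse x) = inverse (h x)" if "x \<in> A" for x
  proof (cases "x = 0")
    case False
    then have "h x * h (inverse x) = 1" using hom[of x "inverse x"] that sfD(6)[OF that] h1 by simp
    then show ?thesis by (metis inverse_unique)
  qed (simp add: h0)
  have hp: "h (x ^ m) = h x ^ m" if "x \<in> A" for x m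
    by (induction m) (use that h1 hom subfield_set_power[OF sf that] in auto)
  have nz: "h x = 0 \<longleftrightarrow> x = 0" if "x \<in> A" for x
    using inj that sfD(1) h0 by (metis inj_onD)
  have "subfield_set B"
    using subring_set_iso[OF h sr] hm[symmetric] hi[symmetric] sfD(5,6)
    unfolding subfield_set_def B by auto
  moreover have "pos_cone B (h ` P)"
    unfolding pos_cone_def
  proof (intro conjI ballI)
    have PA: "P \<subseteq> A" using P by (simp add: pos_cone_def)
    show "h ` P \<subseteq> B" using PA B by blast
    show "0 \<notin> h ` P" using P PA nz unfolding pos_cone_def by force
    show "x = 0 \<or> x \<in> h ` P \<or> - x \<in> h ` P" if "x \<in> B" for x
    proof -
      obtain a where a: "x = h a" "a \<in> A" using \<open>x \<in> B\<close> B by blast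
      then have "a = 0 \<or> a \<in> P \<or> - a \<in> P" using P by (simp add: pos_cone_def)
      then show ?thesis using a h0 hm[OF a(2), symmetric] by auto
    qed
    fix x y assume "x \<in> h ` P" "y \<in> h ` P"
    then obtain a b where ab: "x = h a" "y = h b" "a \<in> P" "b \<in> P" by blast
    then have "a \<in> A" "b \<in> A" using PA by auto
    then have "x + y = h (a + b)" "x * y = h (a * b)" using hom[of a b] ab by simp_all
    then show "x + y \<in> h ` P" "x * y \<in> h ` P" using P ab unfolding pos_cone_def by blast+
  qed
  moreover have "finite_power_classes B"
    unfolding finite_power_classes_def
  proof (intro allI impI)
    fix m :: nat assume "m > 0"
    then obtain Q where Q: "finite Q" "Q \<subseteq> A - {0}"
      "\<And>x. x \<in> A - {0} \<Longrightarrow> \<exists>q\<in>Q. \<exists>y \<in> A - {0}. x = q * y ^ m"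
      using fin unfolding finite_power_classes_def by meson
    have "\<exists>q\<in>h ` Q. \<exists>y \<in> B - {0}. x = q * y ^ m" if x: "x \<in> B - {0}" for x
    proof -
      obtain a where a: "x = h a" "a \<in> A - {0}" using x h0 unfolding B by blast
      then obtain q y where qy: "q \<in> Q" "y \<in> A - {0}" "a = q * y ^ m" using Q(3) by blast
      then have "x = h q * h y ^ m"
        using a(1) hom[of q "y ^ m"] hp[of y m] Q(2) subfield_set_power[OF sf, of y m] by auto
      moreover have "h y \<in> B - {0}" using qy nz B by auto
      ultimately show ?thesis using qy by blast
    qed
    moreover have "h ` Q \<subseteq> B - {0}" using Q(2) nz B by auto
    ultimately show "\<exists>Q. finite Q \<and> Q \<subseteq> B - {0} \<and>
        (\<forall>x \<in> B - {0}. \<exists>q\<in>Q. \<exists>y \<in> B - {0}. x = q * y ^ m)"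
      using Q(1) by blast
  qed
  ultimately show ?thesis unfolding tame_field_def by blast
qed

text \<open>The first two terms of the binomial expansion.  They show how the coefficients of a power of a
  series react to a change of a single coefficient of the series.\<close>

lemma power_add_mod_square:
  fixes h z :: "'a::comm_ring_1"
  shows "\<exists>w. (h + z) ^ m = h ^ m + of_nat m * z * h ^ (m - 1) + z ^ 2 * w"
proof (induction m)
  case (Suc m)
  then obtain w where w: "(h + z) ^ m = h ^ m + of_nat m * z * h ^ (m - 1) + z ^ 2 * w" by blast
  have 1: "of_nat m * z * h ^ (m - 1) * h = of_nat m * z * h ^ m" by (cases m) (auto simp: mult_ac)
  have "(h + z) ^ Suc m = (h + z) * (h ^ m + of_nat m * z * h ^ (m - 1) + z ^ 2 * w)"
    by (simp add: w)
  also have "\<dots> = h ^ Suc m + of_nat (Suc m) * z * h ^ m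
      + z ^ 2 * (of_nat m * h ^ (m - 1) + h * w + z * w)"
    using 1 by (simp add: algebra_simps power2_eq_square)
  finally show ?case by auto
qed (auto intro: exI[of _ 0])

lemma fps_power_nth_cong:
  assumes "\<And>j. j \<le> i \<Longrightarrow> fps_nth p j = fps_nth q j"
  shows "fps_nth (p ^ m) i = fps_nth ((q :: 'a::comm_ring_1 fps) ^ m) i"
  using assms
proof (induction m arbitrary: i)
  case (Suc m)
  then show ?case by (auto simp: fps_mult_nth intro!: sum.cong)
qed simp

lemma fps_power_in:
  assumes "subring_set A" "\<And>i. fps_nth (p :: 'a::field fps) i \<in> A"
  shows "fps_nth (p ^ m) i \<in> A"
proof (induction m arbitrary: i)
  case 0
  then show ?case using assms(1) by (auto simp: subring_set_def)
next
  case (Suc m)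
  then show ?case using assms
    by (auto simp: fps_mult_nth subring_set_def intro!: subring_set_sum[OF assms(1)])
qed

text \<open>A series with constant coefficient 1 has an \<open>m\<close>-th root, with coefficients in the same field \<open>A\<close>.
  The type need not have characteristic zero a priori, hence the assumption on \<open>of_nat m\<close>.\<close>

lemma fps_root_exists:
  fixes u :: "'a::field fps"
  assumes A: "subfield_set A" and m: "of_nat m \<noteq> (0 :: 'a)"
    and u: "fps_nth u 0 = 1" "\<And>i. fps_nth u i \<in> A"
  obtains h where "h ^ m = u" "fps_nth h 0 = 1" "\<And>i. fps_nth h i \<in> A"
proof -
  \<comment> \<open>\<open>H n\<close> is a root up to degree \<open>n\<close>; the next coefficient solves a linear equation with
    leading coefficient \<open>m\<close>.\<close>
  define c where "c n p = (fps_nth u (Suc n) - fps_nth (p ^ m) (Suc n)) / of_nat m" for n p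
  define H where "H = rec_nat (1 :: 'a fps) (\<lambda>n p. p + fps_const (c n p) * fps_X ^ Suc n)"
  have H0: "H 0 = 1" and HS: "H (Suc n) = H n + fps_const (c n (H n)) * fps_X ^ Suc n" for n
    by (simp_all add: H_def)
  have sr: "subring_set A" using A by (simp add: subfield_set_def)
  have HA: "fps_nth (H n) i \<in> A" for n i
  proof (induction n arbitrary: i)
    case 0
    then show ?case using subfield_setD[OF A] by (simp add: H0)
  next
    case (Suc n)
    have "c n (H n) \<in> A"
      unfolding c_def using u(2) fps_power_in[OF sr Suc] subfield_set_of_nat[OF A]
      by (intro subfield_setD(7,8)[OF A]) auto
    then show ?case using Suc subfield_setD[OF A] by (simp add: HS fps_X_power_nth)
  qed
  have H_nth0: "fps_nth (H n) 0 = 1" for n by (induction n) (simp_all add: H0 HS)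
  have stable: "fps_nth (H (i + k)) i = fps_nth (H i) i" for i k
    by (induction k) (auto simp: HS fps_X_power_nth)
  have root: "fps_nth (H n ^ m) i = fps_nth u i" if "i \<le> n" for n i
    using that
  proof (induction n arbitrary: i)
    case 0
    then show ?case by (simp add: H0 u)
  next
    case (Suc n)
    define z where "z = fps_const (c n (H n)) * fps_X ^ Suc n"
    obtain w where w: "(H n + z) ^ m = H n ^ m + of_nat m * z * H n ^ (m - 1) + z ^ 2 * w"
      using power_add_mod_square by blast
    have "(fps_X ^ Suc n) ^ 2 = (fps_X ^ (2 * Suc n) :: 'a fps)"
      by (metis mult.commute power_mult)
    then have z2: "z ^ 2 * w = fps_X ^ (2 * Suc n) * (fps_const (c n (H n)) ^ 2 * w)"
      by (simp only: z_def power_mult_distrib mult_ac)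
    have z1: "of_nat m * z * H n ^ (m - 1) = 
        fps_X ^ Suc n * (fps_const (of_nat m * c n (H n)) * H n ^ (m - 1))"
      by (simp add: z_def mult_ac fps_of_nat[symmetric] fps_const_mult[symmetric] del: fps_const_mult)
    have lead: "fps_nth (H n ^ k) 0 = 1" for k by (induction k) (simp_all add: H_nth0)
    have "fps_nth (H (Suc n) ^ m) i = fps_nth (H n ^ m) i
        + (if i < Suc n then 0 else of_nat m * c n (H n))"
      unfolding HS z_def[symmetric] w z1 z2 using Suc.prems lead
      by (auto simp: fps_X_power_mult_nth less_Suc_eq_le simp del: power_Suc)
    then show ?case
      using Suc m by (cases "i = Suc n") (auto simp: c_def)
  qed
  define h where "h = Abs_fps (\<lambda>n. fps_nth (H n) n)"
  have "h ^ m = u"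
  proof (rule fps_ext)
    fix i
    have "fps_nth (h ^ m) i = fps_nth (H i ^ m) i"
      by (rule fps_power_nth_cong) (use stable in \<open>auto simp: h_def le_iff_add\<close>)
    then show "fps_nth (h ^ m) i = fps_nth u i" using root by simp
  qed
  moreover have "fps_nth h 0 = 1" by (simp add: h_def H0)
  moreover have "\<And>i. fps_nth h i \<in> A" using HA by (simp add: h_def)
  ultimately show ?thesis using that by blast
qed

text \<open>The field of Laurent series over the field \<open>A\<close>.\<close>

definition fls_over :: "'a::field set \<Rightarrow> 'a fls set" where
  "fls_over A = {f. \<forall>i. fls_nth f i \<in> A}"

lemma fls_inverse_over:
  assumes A: "subfield_set A" and f: "f \<in> fls_over A"
  shows "inverse f \<in> fls_over A"
proof (cases "f = 0")
  case True
  then show ?thesis using f by simp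
next
  case False
  define d where "d = fls_subdegree f"
  define g where "g = inverse f"
  have sr: "subring_set A" using A by (simp add: subfield_set_def)
  have sg: "fls_subdegree g = - d" by (simp add: g_def d_def fls_inverse_subdegree)
  have fd: "fls_nth f d \<noteq> 0" using False by (simp add: d_def)
  have step: "fls_nth g (int n - d) \<in> A" for n
  proof (induction n rule: less_induct)
    case (less n)
    \<comment> \<open>Comparing coefficients in \<open>f * g = 1\<close> expresses a coefficient of \<open>g\<close> by earlier ones.\<close>
    have "fls_nth (f * g) (int n) = (\<Sum>i=d..int n + d. fls_nth f i * fls_nth g (int n - i))"
      by (simp add: fls_times_nth(2) sg d_def)
    also have "{d..int n + d} = insert d {d+1..int n + d}" by auto
    also have "(\<Sum>i\<in>\<dots>. fls_nth f i * fls_nth g (int n - i)) =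
        fls_nth f d * fls_nth g (int n - d) + (\<Sum>i=d+1..int n + d. fls_nth f i * fls_nth g (int n - i))"
      by (subst sum.insert) auto
    finally have eq: "fls_nth g (int n - d) = (fls_nth 1 (int n) -
        (\<Sum>i=d+1..int n + d. fls_nth f i * fls_nth g (int n - i))) / fls_nth f d"
      using False fd by (simp add: g_def field_simps)
    have "fls_nth f i * fls_nth g (int n - i) \<in> A" if "i \<in> {d+1..int n + d}" for i
    proof -
      have "int n - i = int (nat (int n + d - i)) - d" "nat (int n + d - i) < n" using that by auto
      then have "fls_nth g (int n - i) \<in> A" using less by metis
      then show ?thesis using f subfield_setD(4)[OF A] by (simp add: fls_over_def)
    qed
    then have "(\<Sum>i=d+1..int n + d. fls_nth f i * fls_nth g (int n - i)) \<in> A"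
      by (rule subring_set_sum[OF sr])
    moreover have "fls_nth f d \<in> A" "fls_nth (1 :: 'a fls) (int n) \<in> A"
      using f subfield_setD[OF A] by (auto simp: fls_over_def)
    ultimately show ?case unfolding eq by (intro subfield_setD(7,8)[OF A])
  qed
  have "fls_nth g i \<in> A" for i
  proof (cases "i < - d")
    case True
    then show ?thesis using subfield_setD(1)[OF A] by (simp add: sg)
  next
    case False
    then have "i = int (nat (i + d)) - d" by simp
    then show ?thesis using step[of "nat (i + d)"] by simp
  qed
  then show ?thesis by (simp add: g_def fls_over_def)
qed

text \<open>A series is positive if its leading coefficient is.  Up to \<open>m\<close>-th powers every non-zero series is a
  monomial \<open>q t^j\<close> with \<open>j < m\<close>, where \<open>q\<close> is one of the representatives for the coefficient field.\<close>

lemma tame_field_fls: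
  assumes A: "tame_field (A :: 'a::field set)"
  shows "tame_field (fls_over A)"
proof -
  from A obtain P where sf: "subfield_set A" and P: "pos_cone A P" and fin: "finite_power_classes A"
    by (auto simp: tame_field_def)
  note sfD = subfield_setD[OF sf]
  have sr: "subring_set A" using sf by (simp add: subfield_set_def)
  let ?S = "fls_over A"
  have S: "subfield_set ?S"
    using subring_set_fls[OF sr] fls_inverse_over[OF sf] sfD(5)
    unfolding subfield_set_def fls_over_def by auto
  let ?lc = "\<lambda>f :: 'a fls. fls_nth f (fls_subdegree f)"
  let ?P = "{f \<in> ?S. ?lc f \<in> P}"
  have P0: "0 \<notin> P" and Padd: "\<And>x y. x \<in> P \<Longrightarrow> y \<in> P \<Longrightarrow> x + y \<in> P"
    and Pmul: "\<And>x y. x \<in> P \<Longrightarrow> y \<in> P \<Longrightarrow> x * y \<in> P"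
    using P by (auto simp: pos_cone_def)
  have add_less: "?lc (f + g) = ?lc f" if "fls_subdegree f < fls_subdegree g" "?lc f \<in> P" for f g
  proof -
    have "fls_subdegree (f + g) = fls_subdegree f"
      by (rule fls_subdegree_eqI) (use that P0 in auto)
    then show ?thesis using that by simp
  qed
  have "pos_cone ?S ?P"
    unfolding pos_cone_def
  proof (intro conjI ballI)
    show "0 \<notin> ?P" using P0 by simp
    show "f = 0 \<or> f \<in> ?P \<or> - f \<in> ?P" if "f \<in> ?S" for f
    proof -
      have "?lc f \<in> A" using that by (simp add: fls_over_def)
      then have "?lc f = 0 \<or> ?lc f \<in> P \<or> - ?lc f \<in> P" using P by (simp add: pos_cone_def)
      then show ?thesis using that subfield_setD(5)[OF S] by auto
    qed
    fix f g assume fg: "f \<in> ?P" "g \<in> ?P"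
    have "?lc (f + g) \<in> P"
    proof (cases "fls_subdegree f" "fls_subdegree g" rule: linorder_cases)
      case less
      then show ?thesis using fg add_less by auto
    next
      case greater
      then show ?thesis using fg add_less[of g f] by (auto simp: add.commute)
    next
      case equal
      then have "?lc f + ?lc g \<in> P" using fg Padd by simp
      moreover from this have "fls_subdegree (f + g) = fls_subdegree f"
        using P0 equal by (intro fls_subdegree_eqI) auto
      ultimately show ?thesis using equal by simp
    qed
    then show "f + g \<in> ?P" using fg subfield_setD(3)[OF S] by simp
    have "f \<noteq> 0" "g \<noteq> 0" using fg P0 by auto
    then have "?lc (f * g) = ?lc f * ?lc g" by (simp add: fls_times_base)
    then show "f * g \<in> ?P" using fg Pmul subfield_setD(4)[OF S] by simp
  qed auto
  moreover have "finite_power_classes ?S"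
    unfolding finite_power_classes_def
  proof (intro allI impI)
    fix m :: nat assume m: "m > 0"
    then obtain Q where Q: "finite Q" "Q \<subseteq> A - {0}"
      "\<And>x. x \<in> A - {0} \<Longrightarrow> \<exists>q\<in>Q. \<exists>y \<in> A - {0}. x = q * y ^ m"
      using fin unfolding finite_power_classes_def by meson
    have m0: "of_nat m \<noteq> (0 :: 'a)" using pos_cone_of_nat[OF sf P m] P0 by metis
    let ?Q = "(\<lambda>(q, j). fls_const q * fls_X_intpow (int j)) ` (Q \<times> {..<m})"
    have cS: "fls_const a \<in> ?S" if "a \<in> A" for a using that sfD(1) by (simp add: fls_over_def)
    have XS: "fls_X_intpow i \<in> ?S" for i using sfD(1,2) by (simp add: fls_over_def)
    have QS: "?Q \<subseteq> ?S - {0}"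
      using Q(2) cS XS subfield_setD(4)[OF S] by auto
    have "\<exists>q\<in>?Q. \<exists>y\<in>?S - {0}. f = q * y ^ m" if f: "f \<in> ?S - {0}" for f
    proof -
      define d where "d = fls_subdegree f"
      define c where "c = ?lc f"
      have c: "c \<in> A - {0}" using f by (simp add: c_def fls_over_def)
      obtain q y where qy: "q \<in> Q" "y \<in> A - {0}" "c = q * y ^ m" using Q(3)[OF c] by blast
      \<comment> \<open>\<open>f\<close> is the product of \<open>c t^d\<close> with a power series \<open>u\<close> with constant coefficient 1.\<close>
      define u where "u = Abs_fps (\<lambda>n. fls_nth f (int n + d) / c)"
      have "fps_nth u 0 = 1" "fps_nth u i \<in> A" for i
        using c f sfD(8) by (auto simp: u_def c_def d_def fls_over_def)
      then obtain h where h: "h ^ m = u" "fps_nth h 0 = 1" "\<And>i. fps_nth h i \<in> A"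
        using fps_root_exists[OF sf m0] by metis
      have fu: "f = fls_const c * fls_X_intpow d * fps_to_fls u"
      proof (rule fls_eqI)
        fix i
        show "fls_nth f i = fls_nth (fls_const c * fls_X_intpow d * fps_to_fls u) i"
          unfolding mult.assoc fls_X_intpow_times_conv_shift(1)
          using c by (auto simp: u_def d_def simp del: fls_shift_const)
      qed
      define j b where "j = nat (d mod int m)" and "b = d div int m"
      have d: "d = int j + b * int m" and j: "j < m" using m by (simp_all add: j_def b_def nat_less_iff)
      define Y where "Y = fls_const y * fls_X_intpow b * fps_to_fls h"
      have Xp: "fls_X_intpow b ^ m = (fls_X_intpow (b * int m) :: 'a fls)"
        by (simp add: fls_X_intpow_power mult.commute)
      have Xd: "fls_X_intpow d = fls_X_intpow (int j) * (fls_X_intpow (b * int m) :: 'a fls)"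
        by (subst d) (simp only: fls_X_intpow_times_fls_X_intpow)
      have Yc: "fls_const c = fls_const q * fls_const y ^ m"
        by (simp add: qy(3) fls_const_power[symmetric])
      have "f = fls_const q * fls_X_intpow (int j) * Y ^ m"
        unfolding fu Y_def power_mult_distrib Xp Xd Yc h(1)[symmetric] fps_to_fls_power
        by (simp only: mult_ac)
      moreover have "fps_to_fls h \<in> ?S" using h(3) sfD(1) by (simp add: fls_over_def)
      then have "Y \<in> ?S" using cS XS qy(2) subfield_setD(4)[OF S] by (simp add: Y_def)
      moreover have "Y \<noteq> 0" using qy(2) h(2) by (auto simp: Y_def)
      moreover have "fls_const q * fls_X_intpow (int j) \<in> ?Q"
        using qy(1) j by (intro image_eqI[of _ _ "(q, j)"]) auto
      ultimately show ?thesis by blast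
    qed
    then show "\<exists>Q. finite Q \<and> Q \<subseteq> ?S - {0} \<and> (\<forall>x\<in>?S - {0}. \<exists>q\<in>Q. \<exists>y\<in>?S - {0}. x = q * y ^ m)"
      using Q(1) QS by (intro exI[of _ ?Q]) blast
  qed
  ultimately show ?thesis using S unfolding tame_field_def by blast
qed

lemma iterated_laurent_tame: "iterated_laurent n F \<Longrightarrow> tame_field F"
proof (induction rule: iterated_laurent.induct)
  case (base F)
  then show ?case using tame_field_iso tame_field_real by (auto simp: is_ring_iso_def)
next
  case (step n L F)
  then show ?case using tame_field_iso[OF _ tame_field_fls[OF step.IH]]
    by (auto simp: is_ring_iso_def fls_over_def)
qed

text \<open>The order of vanishing in the last variable is a homomorphism onto the integers.\<close>

lemma iterated_laurent_order:
  assumes "iterated_laurent n (UNIV :: 'k::field set)" "n \<ge> 1"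
  shows "\<exists>(\<omega> :: 'k \<Rightarrow> int) t. t \<noteq> 0 \<and> \<omega> t = 1 \<and>
    (\<forall>x y. x \<noteq> 0 \<longrightarrow> y \<noteq> 0 \<longrightarrow> \<omega> (x * y) = \<omega> x + \<omega> y)"
  using assms(1)
proof cases
  case (step n' L)
  then obtain h where h: "h \<in> ring_iso (ring_on (fls_over L)) (ring_on (UNIV :: 'k set))"
    by (auto simp: is_ring_iso_def fls_over_def)
  have sf: "subfield_set L" using iterated_laurent_tame[OF step(2)] by (simp add: tame_field_def)
  have sr: "subring_set (fls_over L)"
    using subring_set_fls sf unfolding fls_over_def subfield_set_def by blast
  have inj: "inj_on h (fls_over L)" and surj: "h ` fls_over L = UNIV"
    and hom: "\<And>x y. x \<in> fls_over L \<Longrightarrow> y \<in> fls_over L \<Longrightarrow> h (x * y) = h x * h y"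
    using h by (auto simp: ring_iso_ring_on_iff bij_betw_def)
  define k where "k = inv_into (fls_over L) h"
  have hk: "h (k x) = x" "k x \<in> fls_over L" for x
    using surj by (auto simp: k_def f_inv_into_f inv_into_into)
  have kh: "k (h f) = f" if "f \<in> fls_over L" for f using that inj by (simp add: k_def)
  have k_mult: "k (x * y) = k x * k y" for x y
    using kh[of "k x * k y"] hom[of "k x" "k y"] hk sr unfolding subring_set_def by metis
  have h0: "h 0 = 0" by (rule iso_zero[OF h sr])
  have k0: "k x \<noteq> 0" if "x \<noteq> 0" for x using that hk h0 by metis
  have X: "fls_X \<in> fls_over L" using subfield_setD(1,2)[OF sf] by (simp add: fls_over_def)
  have "h fls_X \<noteq> 0" using kh[OF X] kh[of 0] h0 sr unfolding subring_set_def by (metis fls_X_nonzero)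
  then show ?thesis
    using kh[OF X] k0
    by (intro exI[of _ "\<lambda>x. fls_subdegree (k x)"] exI[of _ "h fls_X"]) (simp add: k_mult)
qed (use assms in simp)


section \<open>Representatives of power classes\<close>

text \<open>A field with the positive cone \<open>P\<close> of an ordering and with finitely many classes of powers.\<close>

locale tame_ordered_field =
  fixes P :: "'k::field set"
  assumes cone: "pos_cone UNIV P" and finite_classes: "finite_power_classes (UNIV :: 'k set)"
begin

lemma zero_notin: "0 \<notin> P" and P_cases: "x = 0 \<or> x \<in> P \<or> - x \<in> P"
  and P_add: "x \<in> P \<Longrightarrow> y \<in> P \<Longrightarrow> x + y \<in> P" and P_mult: "x \<in> P \<Longrightarrow> y \<in> P \<Longrightarrow> x * y \<in> P"
  using cone by (auto simp: pos_cone_def)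

lemma P_nonzero: "x \<in> P \<Longrightarrow> x \<noteq> 0"
  using zero_notin by metis

lemma P_one: "1 \<in> P"
  by (rule pos_cone_one[OF _ cone]) (simp add: subfield_set_def subring_set_def)

lemma P_uminus: "x \<in> P \<Longrightarrow> - x \<notin> P"
  using P_add[of x "- x"] zero_notin by auto

lemma P_square: "x \<noteq> 0 \<Longrightarrow> x * x \<in> P"
  using P_cases[of x] P_mult[of x x] P_mult[of "- x" "- x"] by auto

lemma P_inverse: "x \<in> P \<Longrightarrow> inverse x \<in> P"
  using P_mult[of x "inverse x * inverse x"] P_square[of "inverse x"] P_nonzero[of x]
  by (simp add: mult.assoc[symmetric])

lemma P_power: "x \<in> P \<Longrightarrow> x ^ m \<in> P"
  by (induction m) (auto simp: P_one P_mult)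

lemma P_power_inject:
  assumes xy: "x \<in> P" "y \<in> P" and m: "m > 0" and eq: "x ^ m = y ^ m"
  shows "x = y"
proof -
  obtain n where n: "m = Suc n" using m by (cases m) auto
  have "(\<Sum>p\<in>I. x ^ p * y ^ (n - p)) \<in> P" if "finite I" "I \<noteq> {}" for I
    using that by (induction rule: finite_ne_induct) (auto intro!: P_add P_mult P_power xy)
  then have "(\<Sum>p<Suc n. x ^ p * y ^ (n - p)) \<noteq> 0"
    using P_nonzero by (metis finite_lessThan lessThan_empty_iff nat.distinct(1))
  then show ?thesis using eq diff_power_eq_sum[of x n y] by (simp add: n)
qed

text \<open>An element of \<open>P\<close> that is an \<open>m\<close>-th power in the field is one in \<open>P\<close>.\<close>

lemma root_in_P:
  assumes "z ^ m \<in> P" "z \<noteq> 0" "m > 0"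
  obtains y where "y \<in> P" "y ^ m = z ^ m" "y = z \<or> y = - z"
proof (cases "z \<in> P")
  case False
  then have z: "- z \<in> P" using P_cases[of z] assms by auto
  then have "(- z) ^ m \<in> P" by (rule P_power)
  then have "even m" using assms(1) P_uminus[of "z ^ m"] by (metis power_minus_odd)
  then show ?thesis using that z by simp
qed (use that in auto)

text \<open>\<open>R\<close> is a set of representatives of \<open>U\<close> modulo \<open>m\<close>-th powers, with values of \<open>\<omega>\<close> between \<open>0\<close> and
  \<open>m - 1\<close>, whose number is a multiple of \<open>m\<close>.  Distinct elements of \<open>R\<close> represent distinct classes
  even modulo the \<open>m\<close>-th powers of the whole field.\<close>

definition power_reps :: "'k set \<Rightarrow> ('k \<Rightarrow> int) \<Rightarrow> nat \<Rightarrow> 'k set \<Rightarrow> bool" where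
  "power_reps U \<omega> m R \<longleftrightarrow> finite R \<and> R \<noteq> {} \<and> R \<subseteq> U \<and> m dvd card R \<and>
     (\<forall>r\<in>R. 0 \<le> \<omega> r \<and> \<omega> r < int m) \<and> (\<forall>x\<in>U. \<exists>r\<in>R. \<exists>y\<in>U. x = r * y ^ m) \<and>
     (\<forall>r\<in>R. \<forall>s\<in>R. \<forall>y z. y \<noteq> 0 \<longrightarrow> z \<noteq> 0 \<longrightarrow> r * y ^ m = s * z ^ m \<longrightarrow> r = s)"

lemma power_repsD:
  assumes "power_reps U \<omega> m R"
  shows "finite R" "R \<noteq> {}" "R \<subseteq> U" "m dvd card R" "\<And>r. r \<in> R \<Longrightarrow> 0 \<le> \<omega> r \<and> \<omega> r < int m"
    "\<And>x. x \<in> U \<Longrightarrow> \<exists>r\<in>R. \<exists>y\<in>U. x = r * y ^ m"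
    "\<And>r s y z. r \<in> R \<Longrightarrow> s \<in> R \<Longrightarrow> y \<noteq> 0 \<Longrightarrow> z \<noteq> 0 \<Longrightarrow> r * y ^ m = s * z ^ m \<Longrightarrow> r = s"
  using assms unfolding power_reps_def by simp_all

text \<open>Let \<open>U\<close> be a subgroup of \<open>P\<close> that is closed under \<open>m\<close>-th roots in \<open>P\<close>, with a homomorphism \<open>\<omega>\<close> from \<open>U\<close> onto the integers.
  Representatives of \<open>U\<close> modulo \<open>m\<close>-th powers can be chosen with \<open>0 \<le> \<omega> < m\<close>,
  as the products of representatives in the kernel of \<open>\<omega>\<close> with \<open>\<tau> ^ j\<close> for \<open>j < m\<close>.
  Hence their number is a multiple of \<open>m\<close>.\<close>

lemma power_class_representatives:
  fixes \<omega> :: "'k \<Rightarrow> int"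
  assumes U: "U \<subseteq> P" "1 \<in> U" "\<And>x y. x \<in> U \<Longrightarrow> y \<in> U \<Longrightarrow> x * y \<in> U" "\<And>x. x \<in> U \<Longrightarrow> inverse x \<in> U"
    and pure: "\<And>y. y \<in> P \<Longrightarrow> y ^ m \<in> U \<Longrightarrow> y \<in> U"
    and \<omega>: "\<And>x y. x \<in> U \<Longrightarrow> y \<in> U \<Longrightarrow> \<omega> (x * y) = \<omega> x + \<omega> y"
    and \<tau>: "\<tau> \<in> U" "\<omega> \<tau> = 1" and m: "m > 0"
  shows "\<exists>R. power_reps U \<omega> m R"
proof -
  have nz: "x \<noteq> 0" if "x \<in> U" for x using that U(1) P_nonzero by blast
  have pow: "x ^ n \<in> U" "\<omega> (x ^ n) = int n * \<omega> x" if "x \<in> U" for x n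
  proof -
    have "\<omega> 1 = 0" using \<omega>[OF U(2) U(2)] by simp
    then have "x ^ n \<in> U \<and> \<omega> (x ^ n) = int n * \<omega> x"
      by (induction n) (use that U \<omega> in \<open>auto simp: algebra_simps\<close>)
    then show "x ^ n \<in> U" "\<omega> (x ^ n) = int n * \<omega> x" by blast+
  qed
  have inv: "\<omega> (inverse x) = - \<omega> x" if "x \<in> U" for x
    using \<omega>[OF that U(4)[OF that]] pow(2)[OF U(2), of 0] nz[OF that] by simp
  have powi: "x powi i \<in> U" "\<omega> (x powi i) = i * \<omega> x" if "x \<in> U" for x i
    using that by (auto simp: power_int_def pow inv U(4))
  define U0 where "U0 = {x \<in> U. \<omega> x = 0}"
  \<comment> \<open>The trace on the kernel \<open>U0\<close> of \<open>\<omega>\<close> of the class of \<open>x\<close> modulo \<open>m\<close>-th powers of the field.\<close>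
  define cl where "cl x = {z \<in> U0. \<exists>y. y \<noteq> 0 \<and> z = x * y ^ m}" for x
  have cl_self: "x \<in> cl x" if "x \<in> U0" for x
    using that by (auto simp: cl_def intro!: exI[of _ 1])
  have cl_eq: "cl x = cl x'" if "y \<noteq> 0" "y' \<noteq> 0" "x * y ^ m = x' * y' ^ m" for x x' y y'
  proof -
    have sub: "cl x \<subseteq> cl x'" if h: "y \<noteq> 0" "y' \<noteq> 0" "x * y ^ m = x' * y' ^ m" for x x' y y'
    proof
      fix z assume "z \<in> cl x"
      then obtain w where w: "z \<in> U0" "w \<noteq> 0" "z = x * w ^ m" by (auto simp: cl_def)
      then have "z = x' * (w * y' / y) ^ m" using h by (simp add: field_simps power_mult_distrib power_divide)
      then show "z \<in> cl x'" using w h unfolding cl_def by (auto intro!: exI[of _ "w * y' / y"])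
    qed
    show ?thesis using sub[OF that] sub[OF that(2,1) that(3)[symmetric]] by blast
  qed
  obtain Q :: "'k set" where Q: "finite Q" "Q \<subseteq> UNIV - {0}"
      "\<And>x. x \<in> UNIV - {0} \<Longrightarrow> \<exists>q\<in>Q. \<exists>y\<in>UNIV - {0}. x = q * y ^ m"
    using finite_classes m unfolding finite_power_classes_def by meson
  have "cl ` U0 \<subseteq> cl ` Q"
  proof
    fix C assume "C \<in> cl ` U0"
    then obtain x where x: "x \<in> U0" "C = cl x" by blast
    then obtain q y where "q \<in> Q" "y \<noteq> 0" "x = q * y ^ m" using Q(3)[of x] nz[of x] by (auto simp: U0_def)
    then show "C \<in> cl ` Q" using x cl_eq[of 1 y x q] by auto
  qed
  then have fin: "finite (cl ` U0)" using Q(1) finite_subset by blast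
  define rep where "rep C = (SOME z. z \<in> C)" for C :: "'k set"
  define R0 where "R0 = rep ` cl ` U0"
  have rep_in: "rep (cl x) \<in> cl x" if "x \<in> U0" for x
    unfolding rep_def using cl_self[OF that] by (rule someI)
  have R0_U0: "R0 \<subseteq> U0" unfolding R0_def using rep_in by (auto simp: cl_def)
  have R0_inj: "c = c'" if c: "c \<in> R0" "c' \<in> R0" and y: "y \<noteq> 0" "y' \<noteq> 0" "c * y ^ m = c' * y' ^ m" for c c' y y'
  proof -
    have "rep (cl c) = c" if "c \<in> R0" for c
    proof -
      obtain x where x: "x \<in> U0" "c = rep (cl x)" using \<open>c \<in> R0\<close> by (auto simp: R0_def)
      then obtain w where "w \<noteq> 0" "c = x * w ^ m" using rep_in[OF x(1)] by (auto simp: cl_def)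
      then have "cl c = cl x" using cl_eq[of 1 w c x] by simp
      then show ?thesis using x by simp
    qed
    then show ?thesis using c cl_eq[OF y] by metis
  qed
  \<comment> \<open>The representatives of \<open>U0\<close> are spread over the residues of \<open>\<omega>\<close> modulo \<open>m\<close>.\<close>
  define g where "g = (\<lambda>(c, j). c * \<tau> ^ j)"
  have g: "g (c, j) \<in> U" "\<omega> (g (c, j)) = int j" if "c \<in> R0" for c j
    using that R0_U0 pow[OF \<tau>(1)] U(3) \<omega> \<tau>(2) unfolding g_def U0_def by auto
  have g_inj: "c = c' \<and> j = j'"
    if c: "c \<in> R0" "c' \<in> R0" "j < m" "j' < m" and y: "y \<noteq> 0" "y' \<noteq> 0" "g (c, j) * y ^ m = g (c', j') * y' ^ m"
    for c c' j j' y y'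
  proof -
    define w where "w = y' / y"
    have w: "g (c, j) = g (c', j') * w ^ m" "w \<noteq> 0" using y by (auto simp: w_def field_simps power_divide)
    have ww: "w ^ m = g (c, j) * inverse (g (c', j'))" using w(1) nz[OF g(1)[OF c(2)]] by simp
    then have "w ^ m \<in> U" using g(1) c U(3,4) by simp
    moreover from this obtain w' where w': "w' \<in> P" "w' ^ m = w ^ m"
      using root_in_P[of w m] w(2) m U(1) by blast
    ultimately have "w' \<in> U" using pure by simp
    then have "int m * \<omega> w' = int j - int j'"
      using pow(2)[of w' m] ww w'(2) \<omega> g c U(4) inv by simp
    then have "int m dvd int j - int j'" by (metis dvd_triv_left)
    then have j: "j = j'" using c(3,4) by (simp add: mod_eq_dvd_iff[symmetric] flip: of_nat_mod)
    then have "c * y ^ m = c' * y' ^ m" using y(3) nz[OF \<tau>(1)] by (simp add: g_def)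
    then show ?thesis using R0_inj c y j by blast
  qed
  define R where "R = g ` (R0 \<times> {..<m})"
  have "inj_on g (R0 \<times> {..<m})"
    by (rule inj_onI) (use g_inj[of _ _ _ _ 1 1] in auto)
  then have cardR: "card R = card R0 * m" by (simp add: R_def card_image card_cartesian_product)
  have finR0: "finite R0" using fin by (simp add: R0_def)
  have "1 \<in> U0" using U(2) \<omega>[OF U(2) U(2)] by (simp add: U0_def)
  then have "R0 \<noteq> {}" by (auto simp: R0_def)
  then have cardR0: "card R0 > 0" using finR0 by (simp add: card_gt_0_iff)
  have cover: "\<exists>r\<in>R. \<exists>y\<in>U. x = r * y ^ m" if x: "x \<in> U" for x
  proof -
    define j b where "j = nat (\<omega> x mod int m)" and "b = \<omega> x div int m"
    have \<omega>x: "\<omega> x = int j + b * int m" and j: "j < m" using m by (simp_all add: j_def b_def nat_less_iff)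
    define d where "d = \<tau> ^ j * (\<tau> powi b) ^ m"
    define x0 where "x0 = x * inverse d"
    have t: "d \<in> U" "\<omega> d = \<omega> x"
      using \<omega> U(3) pow powi \<tau> by (simp_all add: \<omega>x d_def)
    have "x0 \<in> U0" using t x U(3,4) \<omega> inv by (simp add: U0_def x0_def)
    moreover from this obtain w where w: "w \<noteq> 0" "rep (cl x0) = x0 * w ^ m"
      using rep_in by (auto simp: cl_def)
    moreover from calculation have r: "rep (cl x0) \<in> R0" unfolding R0_def by blast
    ultimately have "w ^ m = rep (cl x0) * inverse x0" "rep (cl x0) \<in> U" "x0 \<in> U" using nz[of x0] R0_U0 by (auto simp: U0_def)
    then have wU: "w ^ m \<in> U" using U(3,4) by simp
    then obtain w' where w': "w' \<in> P" "w' ^ m = w ^ m" using root_in_P[of w m] w(1) m U(1) by blast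
    then have w'U: "w' \<in> U" using pure wU by simp
    have "x = x0 * d" using nz[OF t(1)] by (simp add: x0_def)
    also have "x0 = rep (cl x0) * inverse w' ^ m" using w w'(2) by (simp add: power_inverse)
    finally have "x = g (rep (cl x0), j) * (inverse w' * \<tau> powi b) ^ m"
      by (simp add: g_def d_def power_mult_distrib mult_ac)
    moreover have "inverse w' * \<tau> powi b \<in> U" using w'U U(3,4) powi \<tau> by simp
    moreover have "g (rep (cl x0), j) \<in> R" using r j by (auto simp: R_def)
    ultimately show ?thesis by blast
  qed
  have distinct: "r = s" if rs: "r \<in> R" "s \<in> R" "y \<noteq> 0" "z \<noteq> 0" "r * y ^ m = s * z ^ m" for r s y z
  proof -
    obtain c j c' j' where "c \<in> R0" "c' \<in> R0" "j < m" "j' < m" "r = g (c, j)" "s = g (c', j')"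
      using rs(1,2) by (auto simp: R_def)
    then show ?thesis using g_inj[of c c' j j' y z] rs(3-5) by simp
  qed
  have R: "R \<subseteq> U" "\<And>r. r \<in> R \<Longrightarrow> 0 \<le> \<omega> r \<and> \<omega> r < int m" using g by (auto simp: R_def)
  have "finite R" using finR0 by (simp add: R_def)
  moreover have "m dvd card R" "R \<noteq> {}" using cardR cardR0 m by auto
  ultimately have "power_reps U \<omega> m R"
    unfolding power_reps_def using R cover distinct by blast
  then show ?thesis by blast
qed

end


section \<open>Definability\<close>

text \<open>The functions of the variables \<open>x 0, x 1, ...\<close> that are polynomials with coefficients in the field,
  the coefficients being parameters of definitions.\<close>

inductive polyfn :: "((nat \<Rightarrow> 'k::field) \<Rightarrow> 'k) \<Rightarrow> bool" where
  polyfn_var: "polyfn (\<lambda>x. x i)"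
| polyfn_const: "polyfn (\<lambda>x. c)"
| polyfn_add: "polyfn f \<Longrightarrow> polyfn g \<Longrightarrow> polyfn (\<lambda>x. f x + g x)"
| polyfn_mult: "polyfn f \<Longrightarrow> polyfn g \<Longrightarrow> polyfn (\<lambda>x. f x * g x)"

lemma polyfn_uminus: "polyfn f \<Longrightarrow> polyfn (\<lambda>x. - f x)"
  using polyfn_mult[OF polyfn_const[of "-1"]] by fastforce

lemma polyfn_power: "polyfn f \<Longrightarrow> polyfn (\<lambda>x. f x ^ m)"
  by (induction m) (auto intro: polyfn_const polyfn_mult)

lemma polyfn_shift: "polyfn f \<Longrightarrow> polyfn (\<lambda>x. f (\<lambda>i. x (Suc i)))"
  by (induction rule: polyfn.induct) (auto intro: polyfn.intros)

lemmas polyfn_intros = polyfn.intros polyfn_uminus polyfn_power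

text \<open>The closure properties of definable sets that are common to the two languages.  \<open>Def\<close> is
  definability of predicates on assignments \<open>x\<close> of infinitely many variables, and \<open>D_iff\<close> links it to the
  definable sets of tuples.  A quantifier binds the variable 0 and shifts the others, as in the de Bruijn
  notation; so in \<open>Def_ex\<close> no variable can be captured.\<close>

locale definability =
  fixes D :: "nat \<Rightarrow> 'k::field list set \<Rightarrow> bool" and Def :: "((nat \<Rightarrow> 'k) \<Rightarrow> bool) \<Rightarrow> bool"
  assumes D_iff: "D m X \<longleftrightarrow> X \<subseteq> {x. length x = m} \<and> Def (\<lambda>x. map x [0..<m] \<in> X)"
    and Def_not: "Def \<Phi> \<Longrightarrow> Def (\<lambda>x. \<not> \<Phi> x)"
    and Def_conj: "Def \<Phi> \<Longrightarrow> Def \<Psi> \<Longrightarrow> Def (\<lambda>x. \<Phi> x \<and> \<Psi> x)"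
    and Def_ex: "Def (\<lambda>x. \<Theta> (x 0) (\<lambda>i. x (Suc i))) \<Longrightarrow> Def (\<lambda>x. \<exists>a. \<Theta> a x)"
    and Def_eq: "polyfn f \<Longrightarrow> polyfn g \<Longrightarrow> Def (\<lambda>x. f x = g x)"
begin

lemma Def_disj: "Def \<Phi> \<Longrightarrow> Def \<Psi> \<Longrightarrow> Def (\<lambda>x. \<Phi> x \<or> \<Psi> x)"
  using Def_not[OF Def_conj[OF Def_not Def_not]] by simp

lemma Def_const: "Def (\<lambda>x. b)"
proof (cases b)
  case True
  then show ?thesis using Def_eq[OF polyfn_const polyfn_const, of 0 0] by simp
next
  case False
  then show ?thesis using Def_eq[OF polyfn_const polyfn_const, of 0 1] by simp
qed

lemma Def_finite_ball: "finite I \<Longrightarrow> (\<And>i. i \<in> I \<Longrightarrow> Def (\<Phi> i)) \<Longrightarrow> Def (\<lambda>x. \<forall>i\<in>I. \<Phi> i x)"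
  by (induction I rule: finite_induct) (auto intro: Def_const Def_conj)

lemma Def_finite_bex: "finite I \<Longrightarrow> (\<And>i. i \<in> I \<Longrightarrow> Def (\<Phi> i)) \<Longrightarrow> Def (\<lambda>x. \<exists>i\<in>I. \<Phi> i x)"
  by (induction I rule: finite_induct) (auto intro: Def_const Def_disj)

text \<open>Definable sets and binary relations on the line.\<close>

definition dset :: "'k set \<Rightarrow> bool" where
  "dset A \<longleftrightarrow> Def (\<lambda>x. x 0 \<in> A)"

definition drel :: "('k \<Rightarrow> 'k \<Rightarrow> bool) \<Rightarrow> bool" where
  "drel G \<longleftrightarrow> Def (\<lambda>x. G (x 0) (x 1))"

lemma Def_mem:
  assumes "dset A" "polyfn f"
  shows "Def (\<lambda>x. f x \<in> A)"
proof -
  have "Def (\<lambda>x. \<exists>a. a \<in> A \<and> a = f x)"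
    using assms unfolding dset_def by (intro Def_ex Def_conj Def_eq polyfn_intros polyfn_shift)
  then show ?thesis by simp
qed

lemma Def_rel:
  assumes "drel G" "polyfn f" "polyfn g"
  shows "Def (\<lambda>x. G (f x) (g x))"
proof -
  have "Def (\<lambda>x. \<exists>b. b = g x \<and> (\<exists>a. G a b \<and> a = f x))"
    using assms unfolding drel_def One_nat_def
    by (intro Def_ex Def_conj Def_eq polyfn_intros polyfn_shift)
  then show ?thesis by simp
qed

lemmas Def_intros = Def_conj Def_disj Def_not Def_ex Def_eq Def_const Def_mem Def_rel polyfn_intros

lemma dset_Un: "dset A \<Longrightarrow> dset B \<Longrightarrow> dset (A \<union> B)"
  by (simp add: dset_def Def_disj)

lemma dset_Diff: "dset A \<Longrightarrow> dset B \<Longrightarrow> dset (A - B)"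
  by (simp add: dset_def Def_conj Def_not)

lemma dset_UNIV: "dset UNIV" and dset_empty: "dset {}"
  by (simp_all add: dset_def Def_const)

lemma dset_singleton: "dset {a}"
  by (simp add: dset_def Def_eq polyfn_intros)


subsection \<open>Definable bijections between subsets of the field\<close>

text \<open>There is a definable bijection between \<open>A\<close> and \<open>B\<close>.  It is given by its graph \<open>G\<close>, from which the sets
  \<open>A\<close> and \<open>B\<close> are recovered; hence they are definable.\<close>

definition def_equiv :: "'k set \<Rightarrow> 'k set \<Rightarrow> bool"  (infix "\<sim>" 50) where
  "A \<sim> B \<longleftrightarrow> (\<exists>G. drel G \<and> (\<forall>a. a \<in> A \<longleftrightarrow> (\<exists>b. G a b)) \<and> (\<forall>b. b \<in> B \<longleftrightarrow> (\<exists>a. G a b)) \<and>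
     (\<forall>a b b'. G a b \<longrightarrow> G a b' \<longrightarrow> b = b') \<and> (\<forall>a a' b. G a b \<longrightarrow> G a' b \<longrightarrow> a = a'))"

lemma def_equivI:
  assumes "drel G" "\<And>a b. G a b \<Longrightarrow> a \<in> A \<and> b \<in> B" "\<And>a. a \<in> A \<Longrightarrow> \<exists>b. G a b" "\<And>b. b \<in> B \<Longrightarrow> \<exists>a. G a b"
    "\<And>a b b'. G a b \<Longrightarrow> G a b' \<Longrightarrow> b = b'" "\<And>a a' b. G a b \<Longrightarrow> G a' b \<Longrightarrow> a = a'"
  shows "A \<sim> B"
  unfolding def_equiv_def using assms by (intro exI[of _ G]) blast

lemma def_equivE:
  assumes "A \<sim> B"
  obtains G where "drel G" "\<And>a b. G a b \<Longrightarrow> a \<in> A \<and> b \<in> B" "\<And>a. a \<in> A \<Longrightarrow> \<exists>b. G a b"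
    "\<And>b. b \<in> B \<Longrightarrow> \<exists>a. G a b"
    "\<And>a b b'. G a b \<Longrightarrow> G a b' \<Longrightarrow> b = b'" "\<And>a a' b. G a b \<Longrightarrow> G a' b \<Longrightarrow> a = a'"
proof -
  obtain G where G: "drel G" "\<forall>a. a \<in> A \<longleftrightarrow> (\<exists>b. G a b)" "\<forall>b. b \<in> B \<longleftrightarrow> (\<exists>a. G a b)"
    "\<forall>a b b'. G a b \<longrightarrow> G a b' \<longrightarrow> b = b'" "\<forall>a a' b. G a b \<longrightarrow> G a' b \<longrightarrow> a = a'"
    using assms unfolding def_equiv_def by blast
  show ?thesis by (rule that[of G]) (use G in blast)+
qed

lemma def_equiv_image:
  assumes "dset A" "drel (\<lambda>a b. b = f a)" "inj_on f A"
  shows "A \<sim> f ` A"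
proof (rule def_equivI[where G = "\<lambda>a b. a \<in> A \<and> b = f a"])
  show "drel (\<lambda>a b. a \<in> A \<and> b = f a)"
    using assms unfolding drel_def dset_def by (intro Def_conj)
qed (use assms(3) in \<open>auto dest: inj_onD\<close>)

lemma def_equiv_refl: "dset A \<Longrightarrow> A \<sim> A"
  using def_equiv_image[of A "\<lambda>x. x"] by (simp add: drel_def Def_eq polyfn_intros)

lemma def_equiv_sym:
  assumes "A \<sim> B"
  shows "B \<sim> A"
proof -
  from assms obtain G where G: "drel G" "\<And>a b. G a b \<Longrightarrow> a \<in> A \<and> b \<in> B" "\<And>a. a \<in> A \<Longrightarrow> \<exists>b. G a b"
    "\<And>b. b \<in> B \<Longrightarrow> \<exists>a. G a b"
    "\<And>a b b'. G a b \<Longrightarrow> G a b' \<Longrightarrow> b = b'" "\<And>a a' b. G a b \<Longrightarrow> G a' b \<Longrightarrow> a = a'"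
    by (rule def_equivE) blast
  have "drel (\<lambda>b a. G a b)" using G(1) Def_rel unfolding drel_def by (intro Def_rel polyfn_intros) (simp add: drel_def)
  then show ?thesis by (rule def_equivI) (use G in blast)+
qed

lemma def_equiv_trans [trans]:
  assumes "A \<sim> B" "B \<sim> C"
  shows "A \<sim> C"
proof -
  from assms(1) obtain G where G: "drel G" "\<And>a b. G a b \<Longrightarrow> a \<in> A \<and> b \<in> B" "\<And>a. a \<in> A \<Longrightarrow> \<exists>b. G a b"
    "\<And>b. b \<in> B \<Longrightarrow> \<exists>a. G a b"
    "\<And>a b b'. G a b \<Longrightarrow> G a b' \<Longrightarrow> b = b'" "\<And>a a' b. G a b \<Longrightarrow> G a' b \<Longrightarrow> a = a'"
    by (rule def_equivE) blast
  from assms(2) obtain H where H: "drel H" "\<And>a b. H a b \<Longrightarrow> a \<in> B \<and> b \<in> C" "\<And>a. a \<in> B \<Longrightarrow> \<exists>b. H a b"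
    "\<And>b. b \<in> C \<Longrightarrow> \<exists>a. H a b"
    "\<And>a b b'. H a b \<Longrightarrow> H a b' \<Longrightarrow> b = b'" "\<And>a a' b. H a b \<Longrightarrow> H a' b \<Longrightarrow> a = a'"
    by (rule def_equivE) blast
  have "drel (\<lambda>a c. \<exists>b. G a b \<and> H b c)"
    unfolding drel_def by (intro Def_intros G(1) H(1))
  then show ?thesis
  proof (rule def_equivI)
    show "a \<in> A \<and> c \<in> C" if "\<exists>b. G a b \<and> H b c" for a c using that G(2) H(2) by blast
    show "\<exists>c b. G a b \<and> H b c" if "a \<in> A" for a using G(3)[OF that] G(2) H(3) by blast
    show "\<exists>a b. G a b \<and> H b c" if "c \<in> C" for c using H(4)[OF that] H(2) G(4) by blast
    show "c = c'" if "\<exists>b. G a b \<and> H b c" "\<exists>b. G a b \<and> H b c'" for a c c'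
      using that G(5) H(5) by blast
    show "a = a'" if "\<exists>b. G a b \<and> H b c" "\<exists>b. G a' b \<and> H b c" for a a' c
      using that G(6) H(6) by blast
  qed
qed

lemma def_equiv_Un:
  assumes "A \<sim> B" "A' \<sim> B'" "A \<inter> A' = {}" "B \<inter> B' = {}"
  shows "A \<union> A' \<sim> B \<union> B'"
proof -
  from assms(1) obtain G where G: "drel G" "\<And>a b. G a b \<Longrightarrow> a \<in> A \<and> b \<in> B" "\<And>a. a \<in> A \<Longrightarrow> \<exists>b. G a b"
    "\<And>b. b \<in> B \<Longrightarrow> \<exists>a. G a b"
    "\<And>a b b'. G a b \<Longrightarrow> G a b' \<Longrightarrow> b = b'" "\<And>a a' b. G a b \<Longrightarrow> G a' b \<Longrightarrow> a = a'"
    by (rule def_equivE) blast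
  from assms(2) obtain H where H: "drel H" "\<And>a b. H a b \<Longrightarrow> a \<in> A' \<and> b \<in> B'" "\<And>a. a \<in> A' \<Longrightarrow> \<exists>b. H a b"
    "\<And>b. b \<in> B' \<Longrightarrow> \<exists>a. H a b"
    "\<And>a b b'. H a b \<Longrightarrow> H a b' \<Longrightarrow> b = b'" "\<And>a a' b. H a b \<Longrightarrow> H a' b \<Longrightarrow> a = a'"
    by (rule def_equivE) blast
  have "drel (\<lambda>a b. G a b \<or> H a b)"
    unfolding drel_def by (intro Def_intros G(1) H(1))
  then show ?thesis
  proof (rule def_equivI)
    fix a b b' assume "G a b \<or> H a b" "G a b' \<or> H a b'"
    then show "b = b'" using G(2,5) H(2,5) assms(3) by (meson disjoint_iff)
  next
    fix a a' b assume "G a b \<or> H a b" "G a' b \<or> H a' b"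
    then show "a = a'" using G(2,6) H(2,6) assms(4) by (meson disjoint_iff)
  qed (use G(2-4) H(2-4) in blast)+
qed

text \<open>A definable bijection restricts to a definable subset and to its complement.\<close>

lemma def_equiv_split:
  assumes "A \<sim> B" "dset A'" "A' \<subseteq> A"
  obtains B' where "A' \<sim> B'" "A - A' \<sim> B - B'" "B' \<subseteq> B"
proof -
  from assms(1) obtain G where G: "drel G" "\<And>a b. G a b \<Longrightarrow> a \<in> A \<and> b \<in> B" "\<And>a. a \<in> A \<Longrightarrow> \<exists>b. G a b"
    "\<And>b. b \<in> B \<Longrightarrow> \<exists>a. G a b"
    "\<And>a b b'. G a b \<Longrightarrow> G a b' \<Longrightarrow> b = b'" "\<And>a a' b. G a b \<Longrightarrow> G a' b \<Longrightarrow> a = a'"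
    by (rule def_equivE) blast
  have 1: "drel (\<lambda>a b. a \<in> A' \<and> G a b)" and 2: "drel (\<lambda>a b. a \<notin> A' \<and> G a b)"
    unfolding drel_def by (intro Def_intros G(1) assms(2))+
  let ?B = "{b. \<exists>a\<in>A'. G a b}"
  have "A' \<sim> ?B"
    using 1
  proof (rule def_equivI)
    show "\<exists>b. a \<in> A' \<and> G a b" if "a \<in> A'" for a using that assms(3) G(3) by blast
  qed (use G(5,6) in blast)+
  moreover have "A - A' \<sim> B - ?B"
    using 2
  proof (rule def_equivI)
    show "a \<in> A - A' \<and> b \<in> B - ?B" if "a \<notin> A' \<and> G a b" for a b
      using that G(2)[of a b] G(6)[of a b] by blast
    show "\<exists>b. a \<notin> A' \<and> G a b" if "a \<in> A - A'" for a using that G(3) by blast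
    show "\<exists>a. a \<notin> A' \<and> G a b" if "b \<in> B - ?B" for b using that G(4)[of b] by blast
  qed (use G(5,6) in blast)+
  moreover have "?B \<subseteq> B" using G(2) by blast
  ultimately show ?thesis by (rule that)
qed

lemma def_equiv_dset:
  assumes "A \<sim> B"
  shows "dset A"
proof -
  from assms obtain G where G: "drel G" "\<And>a. a \<in> A \<longleftrightarrow> (\<exists>b. G a b)"
    unfolding def_equiv_def by blast
  show ?thesis unfolding dset_def G(2) by (intro Def_intros G(1))
qed

lemma def_equiv_UN:
  assumes "finite I" "\<And>i. i \<in> I \<Longrightarrow> A i \<sim> B i" "disjoint_family_on A I" "disjoint_family_on B I"
  shows "(\<Union>i\<in>I. A i) \<sim> (\<Union>i\<in>I. B i)"
  using assms
proof (induction I rule: finite_induct)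
  case empty
  then show ?case by (simp add: def_equiv_refl dset_empty)
next
  case (insert i I)
  have "disjoint_family_on A I" "A i \<inter> (\<Union>i\<in>I. A i) = {}"
    "disjoint_family_on B I" "B i \<inter> (\<Union>i\<in>I. B i) = {}"
    using insert.prems(2,3) insert.hyps(2) by (auto simp: disjoint_family_on_def)
  then have "A i \<union> (\<Union>i\<in>I. A i) \<sim> B i \<union> (\<Union>i\<in>I. B i)"
    by (intro def_equiv_Un insert.IH insert.prems(1)) simp_all
  then show ?case by simp
qed

text \<open>\<open>copies B n A\<close> says that \<open>A\<close> is a disjoint union of \<open>n\<close> definable bijective images of \<open>B\<close>.\<close>

inductive copies :: "'k set \<Rightarrow> nat \<Rightarrow> 'k set \<Rightarrow> bool" for B where
  copies_0: "copies B 0 {}"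
| copies_Suc: "copies B n A \<Longrightarrow> C \<sim> B \<Longrightarrow> A \<inter> C = {} \<Longrightarrow> copies B (Suc n) (A \<union> C)"

lemma copies_dset: "copies B n A \<Longrightarrow> dset A"
  by (induction rule: copies.induct) (auto intro: dset_empty dset_Un def_equiv_dset)

lemma copies_SucE:
  assumes "copies B (Suc n) A"
  obtains A' C where "copies B n A'" "C \<sim> B" "A' \<inter> C = {}" "A = A' \<union> C"
  using assms by cases blast

lemma copies_1: "A \<sim> B \<Longrightarrow> copies B 1 A"
  using copies_Suc[OF copies_0] by force

lemma copies_add:
  assumes "copies B n A" "copies B m A'" "A \<inter> A' = {}"
  shows "copies B (n + m) (A \<union> A')"
  using assms(2,1,3)
proof (induction rule: copies.induct)
  case (copies_Suc m A' C)
  have "copies B (Suc (n + m)) ((A \<union> A') \<union> C)"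
    by (rule copies.copies_Suc) (use copies_Suc in auto)
  then show ?case by (simp add: Un_assoc)
qed simp

lemma copies_transport:
  assumes "copies B n A" "A \<sim> A'"
  shows "copies B n A'"
  using assms
proof (induction arbitrary: A' rule: copies.induct)
  case copies_0
  then have "A' = {}" unfolding def_equiv_def by blast
  then show ?case by (simp add: copies.copies_0)
next
  case (copies_Suc n A C)
  have "dset A" using copies_dset copies_Suc.hyps by blast
  then obtain B' where B': "A \<sim> B'" "A \<union> C - A \<sim> A' - B'" "B' \<subseteq> A'"
    using def_equiv_split[OF copies_Suc.prems] by blast
  have "A \<union> C - A = C" using copies_Suc.hyps by blast
  then have "A' - B' \<sim> B" using B'(2) copies_Suc.hyps(2) def_equiv_sym def_equiv_trans by metis
  then have "copies B (Suc n) (B' \<union> (A' - B'))"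
    by (intro copies.copies_Suc copies_Suc.IH B') auto
  then show ?case using B'(3) by (simp add: Un_absorb1)
qed

lemma copies_unique: "copies B n A \<Longrightarrow> copies B n A' \<Longrightarrow> A \<sim> A'"
proof (induction arbitrary: A' rule: copies.induct)
  case copies_0
  then have "A' = {}" by (auto elim: copies.cases)
  then show ?case by (simp add: def_equiv_refl dset_empty)
next
  case (copies_Suc n A C)
  from copies_Suc.prems obtain A1 C1 where A1: "copies B n A1" "C1 \<sim> B" "A1 \<inter> C1 = {}" "A' = A1 \<union> C1"
    by (rule copies_SucE)
  have "C \<sim> C1" using copies_Suc.hyps(2) A1(2) def_equiv_sym def_equiv_trans by blast
  then show ?case unfolding A1(4) by (intro def_equiv_Un copies_Suc.IH A1 copies_Suc.hyps)
qed

lemma copies_UN: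
  assumes "finite I" "\<And>i. i \<in> I \<Longrightarrow> A i \<sim> B" "disjoint_family_on A I"
  shows "copies B (card I) (\<Union>i\<in>I. A i)"
  using assms
proof (induction I rule: finite_induct)
  case empty
  then show ?case by (simp add: copies_0)
next
  case (insert i I)
  have "disjoint_family_on A I" "(\<Union>i\<in>I. A i) \<inter> A i = {}"
    using insert.prems(2) insert.hyps(2) by (auto simp: disjoint_family_on_def)
  then have "copies B (Suc (card I)) ((\<Union>i\<in>I. A i) \<union> A i)"
    by (intro copies_Suc insert.IH insert.prems) simp_all
  moreover have "(\<Union>i\<in>I. A i) \<union> A i = (\<Union>i\<in>insert i I. A i)" by blast
  ultimately show ?case using insert.hyps by simp
qed

text \<open>In the Grothendieck group the hypothesis gives \<open>[T] = a m [T]\<close> for suitable \<open>a\<close>, for every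
  \<open>m\<close>.  Taking \<open>m = 2\<close> one obtains \<open>N [T] = 0\<close> for some odd \<open>N\<close>, and then \<open>m = N\<close> gives
  \<open>[T] = 0\<close>.  The argument is carried out without cancellation: \<open>T\<close> absorbs \<open>N\<close> copies of itself,
  and it is the union of \<open>a N\<close> copies of itself, so it absorbs one copy of itself.\<close>

lemma copies_two_absorb:
  assumes T: "dset T" and mult: "\<And>m. m > 0 \<Longrightarrow> \<exists>a>0. copies T (a * m) T" and A: "copies T 2 A"
  shows "A \<sim> T"
proof -
  \<comment> \<open>\<open>T\<close> is \<open>N + 1\<close> copies of itself with \<open>N\<close> odd, and also \<open>a * N\<close> copies.\<close>
  obtain b where b: "b > 0" "copies T (b * 2) T" using mult[of 2] by auto
  define N where "N = b * 2 - 1"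
  have N: "N > 0" "copies T (N + 1) T" using b by (simp_all add: N_def)
  obtain a where a: "copies T (a * N) T" using mult[OF N(1)] by blast
  \<comment> \<open>Replacing one of the copies by \<open>N + 1\<close> copies again and again, one gets any \<open>1 + j * N\<close> copies.\<close>
  have "copies T (Suc (j * N)) T" for j
  proof (induction j)
    case 0
    then show ?case using copies_1[OF def_equiv_refl[OF T]] by simp
  next
    case (Suc j)
    then obtain A' C where AC: "copies T (j * N) A'" "C \<sim> T" "A' \<inter> C = {}" "T = A' \<union> C"
      by (rule copies_SucE)
    have "copies T (N + 1) C" using copies_transport[OF N(2)] def_equiv_sym[OF AC(2)] by blast
    then have "copies T (j * N + (N + 1)) (A' \<union> C)" using AC by (intro copies_add)
    then show ?case using AC(4) by (simp add: add.commute add.left_commute)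
  qed
  then have 1: "copies T (Suc (a * N)) T" .
  \<comment> \<open>Of the two copies in \<open>A\<close> one is kept and the other is cut into \<open>a * N\<close> copies.\<close>
  obtain A' C where AC: "copies T 1 A'" "C \<sim> T" "A' \<inter> C = {}" "A = A' \<union> C"
    using A copies_SucE[of T 1 A] by (auto simp: numeral_2_eq_2)
  have "copies T (a * N) C" using copies_transport[OF a] def_equiv_sym[OF AC(2)] by blast
  then have "copies T (1 + a * N) (A' \<union> C)" using AC by (intro copies_add)
  then show ?thesis using copies_unique[OF _ 1] AC(4) by simp
qed


subsection \<open>Tuples\<close>

lemma D_singles: "D 1 (singles A) \<longleftrightarrow> dset A"
proof -
  have "[x 0] \<in> (\<lambda>a. [a]) ` A \<longleftrightarrow> x 0 \<in> A" for x :: "nat \<Rightarrow> 'k" by auto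
  then show ?thesis by (auto simp: D_iff singles_def dset_def)
qed

lemma map_upt_append: "map x [0..<m + n] = map x [0..<m] @ map (\<lambda>i. x (m + i)) [0..<n]"
  by (rule nth_equalityI) (auto simp: nth_append)

text \<open>The graph of the map that applies \<open>f\<close> to the last entry of a tuple is definable.\<close>

lemma D_graph:
  assumes "D m X" "drel G" "\<And>a. a \<in> A \<Longrightarrow> G a (f a)" "\<And>a b. G a b \<Longrightarrow> a \<in> A \<and> b = f a"
  shows "D (Suc m + Suc m) {x @ [a] @ x @ [f a] | x a. x \<in> X \<and> a \<in> A}"
proof -
  have X: "X \<subseteq> {x. length x = m}" "Def (\<lambda>x. map x [0..<m] \<in> X)" using assms(1) by (auto simp: D_iff)
  have len: "length w = m" if "w \<in> X" for w using X(1) that by blast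
  have eq: "map x [0..<Suc m + Suc m] \<in> {x @ [a] @ x @ [f a] | x a. x \<in> X \<and> a \<in> A} \<longleftrightarrow>
     map x [0..<m] \<in> X \<and> (\<forall>i\<in>{..<m}. x (Suc m + i) = x i) \<and> G (x m) (x (Suc m + m))" for x
  proof -
    let ?y = "map x [0..<m]" and ?z = "map (\<lambda>i. x (Suc m + i)) [0..<m]"
    have "map x [0..<Suc m + Suc m] = ?y @ [x m] @ ?z @ [x (Suc m + m)]"
      unfolding map_upt_append by simp
    moreover have "?z = ?y \<longleftrightarrow> (\<forall>i\<in>{..<m}. x (Suc m + i) = x i)"
      by (auto simp: list_eq_iff_nth_eq)
    moreover have "?y @ [x m] @ ?z @ [x (Suc m + m)] \<in> {x @ [a] @ x @ [f a] | x a. x \<in> X \<and> a \<in> A} \<longleftrightarrow>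
      ?y \<in> X \<and> ?z = ?y \<and> G (x m) (x (Suc m + m))"
    proof
      assume "?y @ [x m] @ ?z @ [x (Suc m + m)] \<in> {x @ [a] @ x @ [f a] | x a. x \<in> X \<and> a \<in> A}"
      then obtain w a where w: "?y @ [x m] @ ?z @ [x (Suc m + m)] = w @ [a] @ w @ [f a]" "w \<in> X" "a \<in> A"
        by blast
      have "length w = m" by (rule len[OF w(2)])
      then show "?y \<in> X \<and> ?z = ?y \<and> G (x m) (x (Suc m + m))" using w assms(3) by simp
    next
      assume "?y \<in> X \<and> ?z = ?y \<and> G (x m) (x (Suc m + m))"
      then have "?y \<in> X" "?z = ?y" "x m \<in> A" "x (Suc m + m) = f (x m)" using assms(4) by auto
      then show "?y @ [x m] @ ?z @ [x (Suc m + m)] \<in> {x @ [a] @ x @ [f a] | x a. x \<in> X \<and> a \<in> A}"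
        by (intro CollectI exI[of _ ?y] exI[of _ "x m"]) simp
    qed
    ultimately show ?thesis by simp
  qed
  have "Def (\<lambda>x. map x [0..<m] \<in> X \<and> (\<forall>i\<in>{..<m}. x (Suc m + i) = x i) \<and> G (x m) (x (Suc m + m)))"
    by (intro Def_conj X Def_finite_ball Def_eq Def_rel polyfn_intros assms finite_lessThan)
  moreover have "{x @ [a] @ x @ [f a] | x a. x \<in> X \<and> a \<in> A} \<subseteq> {x. length x = Suc m + Suc m}"
    using len by auto
  ultimately show ?thesis unfolding D_iff eq by blast
qed

lemma D_tuple_prod:
  assumes "D m X" "dset A"
  shows "D (Suc m) (tuple_prod X (singles A))"
proof -
  have X: "X \<subseteq> {x. length x = m}" "Def (\<lambda>x. map x [0..<m] \<in> X)" using assms(1) by (auto simp: D_iff)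
  have eq: "map x [0..<Suc m] \<in> tuple_prod X (singles A) \<longleftrightarrow> map x [0..<m] \<in> X \<and> x m \<in> A" for x
    by (auto simp: tuple_prod_def singles_def)
  show ?thesis unfolding D_iff eq
  proof
    show "tuple_prod X (singles A) \<subseteq> {x. length x = Suc m}"
      using X(1) by (auto simp: tuple_prod_def singles_def)
    show "Def (\<lambda>x. map x [0..<m] \<in> X \<and> x m \<in> A)" by (intro Def_conj Def_mem X assms polyfn_intros)
  qed
qed

lemma def_equiv_definable_bij:
  assumes "A \<sim> B" "D m X"
  shows "\<exists>f. definable_bij D (Suc m) (tuple_prod X (singles A)) (Suc m) (tuple_prod X (singles B)) f"
proof -
  from assms(1) obtain G where G: "drel G" "\<And>a b. G a b \<Longrightarrow> a \<in> A \<and> b \<in> B" "\<And>a. a \<in> A \<Longrightarrow> \<exists>b. G a b"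
    "\<And>b. b \<in> B \<Longrightarrow> \<exists>a. G a b"
    "\<And>a b b'. G a b \<Longrightarrow> G a b' \<Longrightarrow> b = b'" "\<And>a a' b. G a b \<Longrightarrow> G a' b \<Longrightarrow> a = a'"
    by (rule def_equivE) blast
  define g where "g a = (THE b. G a b)" for a
  have g: "G a b \<longleftrightarrow> a \<in> A \<and> b = g a" for a b
    unfolding g_def using G(2,3,5) by (metis the_equality)
  define f where "f x = butlast x @ [g (last x)]" for x
  have gA: "inj_on g A" "g ` A = B"
  proof -
    show "inj_on g A" using g G(6) by (metis inj_onI)
    show "g ` A = B"
    proof
      show "g ` A \<subseteq> B" using g G(2) by blast
      show "B \<subseteq> g ` A" using g G(4) by blast
    qed
  qed
  have tp: "tuple_prod X (singles C) = (\<lambda>(x, a). x @ [a]) ` (X \<times> C)" for C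
    by (auto simp: tuple_prod_def singles_def)
  have "inj_on f (tuple_prod X (singles A))"
    unfolding tp by (rule inj_onI) (use gA(1) in \<open>auto simp: f_def dest: inj_onD\<close>)
  moreover have "f ` tuple_prod X (singles A) = (\<lambda>(x, a). x @ [a]) ` (\<lambda>(x, a). (x, g a)) ` (X \<times> A)"
    by (simp add: tp image_image f_def case_prod_beta)
  moreover have "(\<lambda>(x, a). (x, g a)) ` (X \<times> A) = X \<times> B"
    unfolding gA(2)[symmetric] by auto
  ultimately have "bij_betw f (tuple_prod X (singles A)) (tuple_prod X (singles B))"
    by (simp add: bij_betw_def tp)
  moreover have "(\<lambda>x. x @ f x) ` tuple_prod X (singles A) = (\<lambda>(x, a). x @ [a] @ x @ [g a]) ` (X \<times> A)"
    by (simp add: tp image_image f_def case_prod_beta)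
  moreover have "D (Suc m + Suc m) {x @ [a] @ x @ [g a] | x a. x \<in> X \<and> a \<in> A}"
    by (rule D_graph[OF assms(2) G(1)]) (simp_all add: g)
  moreover have "{x @ [a] @ x @ [g a] | x a. x \<in> X \<and> a \<in> A} = (\<lambda>(x, a). x @ [a] @ x @ [g a]) ` (X \<times> A)"
    by auto
  moreover have "dset A" "dset B" using def_equiv_dset assms(1) def_equiv_sym by blast+
  ultimately show ?thesis
    unfolding definable_bij_def using D_tuple_prod[OF assms(2)] by (intro exI[of _ f]) simp
qed

lemma D_unit: "D 0 {[]}"
  by (simp add: D_iff Def_const)

lemma def_equiv_definable_bij_singles:
  assumes "A \<sim> B"
  shows "\<exists>f. definable_bij D 1 (singles A) 1 (singles B) f"
  using def_equiv_definable_bij[OF assms D_unit] by (simp add: tuple_prod_def)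

lemma project_definable_bij:
  assumes X: "D m X"
  shows "definable_bij D m X (Suc m) (tuple_prod X (singles {a})) (\<lambda>x. x @ [a])"
  unfolding definable_bij_def
proof (intro conjI)
  show "D m X" by fact
  show "D (Suc m) (tuple_prod X (singles {a}))" by (rule D_tuple_prod[OF X dset_singleton])
  show "bij_betw (\<lambda>x. x @ [a]) X (tuple_prod X (singles {a}))"
    by (auto simp: bij_betw_def inj_on_def tuple_prod_def singles_def)
  have X': "X \<subseteq> {x. length x = m}" "Def (\<lambda>x. map x [0..<m] \<in> X)" using X by (auto simp: D_iff)
  have eq: "map x [0..<m + Suc m] \<in> (\<lambda>x. x @ x @ [a]) ` X \<longleftrightarrow>
     map x [0..<m] \<in> X \<and> (\<forall>i\<in>{..<m}. x (m + i) = x i) \<and> x (m + m) = a" for x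
  proof -
    let ?y = "map x [0..<m]" and ?z = "map (\<lambda>i. x (m + i)) [0..<m]"
    have "map x [0..<m + Suc m] = ?y @ ?z @ [x (m + m)]"
      unfolding map_upt_append by simp
    moreover have "?z = ?y \<longleftrightarrow> (\<forall>i\<in>{..<m}. x (m + i) = x i)"
      by (auto simp: list_eq_iff_nth_eq)
    moreover have "?y @ ?z @ [x (m + m)] \<in> (\<lambda>x. x @ x @ [a]) ` X \<longleftrightarrow> ?y \<in> X \<and> ?z = ?y \<and> x (m + m) = a"
    proof
      assume "?y @ ?z @ [x (m + m)] \<in> (\<lambda>x. x @ x @ [a]) ` X"
      then obtain w where w: "?y @ ?z @ [x (m + m)] = w @ w @ [a]" "w \<in> X" by blast
      moreover have "length w = m" using X'(1) w(2) by blast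
      ultimately show "?y \<in> X \<and> ?z = ?y \<and> x (m + m) = a" by simp
    next
      assume "?y \<in> X \<and> ?z = ?y \<and> x (m + m) = a"
      then show "?y @ ?z @ [x (m + m)] \<in> (\<lambda>x. x @ x @ [a]) ` X" by (intro image_eqI[of _ _ ?y]) simp_all
    qed
    ultimately show ?thesis by simp
  qed
  have "Def (\<lambda>x. map x [0..<m] \<in> X \<and> (\<forall>i\<in>{..<m}. x (m + i) = x i) \<and> x (m + m) = a)"
    by (intro Def_conj X' Def_finite_ball Def_eq polyfn_intros finite_lessThan)
  moreover have "(\<lambda>x. x @ x @ [a]) ` X \<subseteq> {x. length x = m + Suc m}" using X'(1) by (intro image_subsetI CollectI) (auto dest: subsetD)
  ultimately show "D (m + Suc m) ((\<lambda>x. x @ x @ [a]) ` X)" unfolding D_iff eq by blast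
qed


subsection \<open>Triviality of the Grothendieck ring\<close>

text \<open>For definable \<open>X\<close> and \<open>B = UNIV - {0}\<close>, by the hypothesis the class of \<open>X\<close> times \<open>UNIV\<close> is both the class of \<open>X\<close> times \<open>B\<close>
  and its sum with the class of \<open>X\<close> times \<open>{0}\<close>, which is the class of \<open>X\<close>.\<close>

lemma K0_trivial:
  assumes "UNIV \<sim> UNIV - {0}"
  shows "carrier (K0 D) = {\<zero>\<^bsub>K0 D\<^esub>}"
proof -
  define F where "F = free_Abelian_group (definable_sets D)"
  define N where "N = generate F (K0_relations D)"
  interpret F: comm_group F unfolding F_def by (rule abelian_free_Abelian_group)
  have carF: "carrier F = {c. Poly_Mapping.keys c \<subseteq> definable_sets D}" 
    by (simp add: F_def free_Abelian_group_def)
  have gens: "frag_of X \<in> carrier F" if "m > 0" "D m X" for m X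
    using that by (auto simp: carF definable_sets_def)
  have diff: "a - b \<in> carrier F" if "a \<in> carrier F" "b \<in> carrier F" for a b
    using that keys_diff[of a b] by (auto simp: carF)
  have add: "a + b \<in> carrier F" if "a \<in> carrier F" "b \<in> carrier F" for a b
    using that keys_add[of a b] by (auto simp: carF)
  have rel: "K0_relations D \<subseteq> carrier F"
  proof
    fix c assume "c \<in> K0_relations D"
    then show "c \<in> carrier F"
      unfolding K0_relations_def definable_bij_def by (auto intro!: diff add intro: gens)
  qed
  interpret N: subgroup N F unfolding N_def by (rule F.generate_is_subgroup[OF rel])
  have N_add: "a + b \<in> N" if "a \<in> N" "b \<in> N" for a b
    using N.m_closed[OF that] by (simp add: F_def)
  have N_minus: "- a \<in> N" if "a \<in> N" for a
  proof -
    have "Poly_Mapping.keys a \<subseteq> definable_sets D" using that N.subset carF by blast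
    then have "inv\<^bsub>F\<^esub> a = - a" unfolding F_def by (rule inv_free_Abelian_group)
    then show ?thesis using N.m_inv_closed[OF that] by simp
  qed
  have N_zero: "0 \<in> N" using N.one_closed by (simp add: F_def)
  have N_rel: "c \<in> N" if "c \<in> K0_relations D" for c
    unfolding N_def using that by (rule generate.incl)
  have of_in_N: "frag_of X \<in> N" if "m > 0" "D m X" for m X
  proof -
    let ?A = "tuple_prod X (singles UNIV)" and ?B = "tuple_prod X (singles (UNIV - {0}))"
      and ?C = "tuple_prod X (singles {0})"
    have dA: "D (Suc m) ?A" "D (Suc m) ?B" "D (Suc m) ?C"
      by (intro D_tuple_prod that dset_UNIV dset_Diff dset_singleton)+
    have 1: "frag_of ?A - frag_of ?B \<in> N"
      using def_equiv_definable_bij[OF assms that(2)]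
      by (intro N_rel) (unfold K0_relations_def, blast)
    have 2: "frag_of X - frag_of ?C \<in> N"
      using project_definable_bij[OF that(2), of 0] that(1)
      by (intro N_rel) (unfold K0_relations_def, blast)
    have U: "?A = ?B \<union> ?C" "?B \<inter> ?C = {}"
      by (auto simp: tuple_prod_def singles_def)
    have "D (Suc m) (?B \<union> ?C)" using dA(1) unfolding U(1) .
    then have "frag_of (?B \<union> ?C) - (frag_of ?B + frag_of ?C) \<in> K0_relations D"
      unfolding K0_relations_def using dA U(2)
      by - (rule UnI2, rule CollectI, rule exI[of _ ?B], rule exI[of _ ?C], simp add: exI[of _ "Suc m"])
    then have 3: "frag_of ?A - (frag_of ?B + frag_of ?C) \<in> N"
      unfolding U(1) by (rule N_rel)
    have eq: "(frag_of X - frag_of ?C) + (frag_of ?A - frag_of ?B)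
        + - (frag_of ?A - (frag_of ?B + frag_of ?C)) = frag_of X"
      by simp
    show ?thesis using N_add[OF N_add[OF 2 1] N_minus[OF 3]] unfolding eq .
  qed
  have "carrier F \<subseteq> N"
  proof
    fix c assume "c \<in> carrier F"
    then have "Poly_Mapping.keys c \<subseteq> definable_sets D" by (simp add: carF)
    then show "c \<in> N"
    proof (induction c rule: frag_induction)
      case (one x)
      then show ?case using of_in_N by (auto simp: definable_sets_def)
    next
      case (diff a b)
      then show ?case using N_add[OF _ N_minus] by fastforce
    qed (rule N_zero)
  qed
  then have N: "N = carrier F" using N.subset by blast
  have "carrier (F Mod N) = {N}"
  proof -
    have "N #>\<^bsub>F\<^esub> x = N" if "x \<in> carrier F" for x
      using F.coset_join2[OF that N.subgroup_axioms] that by (simp add: N)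
    then show ?thesis using F.one_closed by (auto simp: FactGroup_def RCOSETS_def)
  qed
  then show ?thesis
    by (simp add: K0_def Let_def F_def[symmetric] N_def[symmetric])
qed

end


section \<open>First-order definability in the two languages\<close>

text \<open>A predicate on assignments \<open>x\<close> is represented by a formula in which the variables with even index are
  those of \<open>x\<close> and the variables with odd index are the parameters \<open>e\<close>.  Renaming the latter makes room
  for the parameters of several formulas.\<close>

definition mix :: "(nat \<Rightarrow> 'a) \<Rightarrow> (nat \<Rightarrow> 'a) \<Rightarrow> nat \<Rightarrow> 'a" where
  "mix x e i = (if even i then x (i div 2) else e (i div 2))"

text \<open>\<open>ren1\<close> and \<open>ren2\<close> move the parameters of two formulas to disjoint sets of parameters.\<close>

definition ren1 :: "nat \<Rightarrow> nat" where
  "ren1 i = (if even i then i else 2 * i - 1)"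

definition ren2 :: "nat \<Rightarrow> nat" where
  "ren2 i = (if even i then i else 2 * i + 1)"

text \<open>\<open>ren_ex\<close> moves the variable \<open>x 0\<close> to the first parameter, where it can be quantified, and shifts the other
  variables down and the parameters up.\<close>

definition ren_ex :: "nat \<Rightarrow> nat" where
  "ren_ex i = (if i = 0 then 1 else if even i then i - 2 else i + 2)"

text \<open>\<open>ren_tuple m\<close> moves the variables \<open>x i\<close> with \<open>i < m\<close> to the positions \<open>0, ..., m - 1\<close> of a tuple, and
  everything else to later positions; \<open>ren_untuple m\<close> goes in the opposite direction.\<close>

definition ren_tuple :: "nat \<Rightarrow> nat \<Rightarrow> nat" where
  "ren_tuple m i = (if even i \<and> i div 2 < m then i div 2 else m + i)"

definition ren_untuple :: "nat \<Rightarrow> nat \<Rightarrow> nat" where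
  "ren_untuple m i = (if i < m then 2 * i else 2 * i + 1)"

lemma inj_ren1: "inj ren1"
  by (rule inj_on_inverseI[where g = "\<lambda>j. if even j then j else (j + 1) div 2"])
     (auto simp: ren1_def elim!: oddE)

lemma inj_ren2: "inj ren2"
  by (rule inj_on_inverseI[where g = "\<lambda>j. if even j then j else (j - 1) div 2"])
     (auto simp: ren2_def elim!: oddE)

lemma inj_ren_ex: "inj ren_ex"
  by (rule inj_on_inverseI[where g = "\<lambda>j. if j = 1 then 0 else if even j then j + 2 else j - 2"])
     (auto simp: ren_ex_def elim!: oddE evenE, presburger)

lemma inj_ren_tuple: "inj (ren_tuple m)"
  by (rule inj_on_inverseI[where g = "\<lambda>j. if j < m then 2 * j else j - m"])
     (auto simp: ren_tuple_def)

lemma inj_ren_untuple: "inj (ren_untuple m)"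
  by (rule inj_on_inverseI[where g = "\<lambda>j. j div 2"])
     (auto simp: ren_untuple_def)

lemma mix_ren1: "mix x (mix e e') \<circ> ren1 = mix x e"
  and mix_ren2: "mix x (mix e e') \<circ> ren2 = mix x e'"
proof -
  have "(mix x (mix e e') \<circ> ren1) i = mix x e i \<and> (mix x (mix e e') \<circ> ren2) i = mix x e' i" for i
  proof (cases "even i")
    case False
    then obtain k where i: "i = 2 * k + 1" by (rule oddE)
    have "ren1 i = 2 * (2 * k) + 1" "ren2 i = 2 * (2 * k + 1) + 1" by (simp_all add: i ren1_def ren2_def)
    moreover have "mix y d (2 * j + 1) = d j" "mix y d (2 * j) = y j"
      for y d :: "nat \<Rightarrow> 'a" and j by (simp_all add: mix_def)
    ultimately show ?thesis by (simp only: comp_def i)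
  qed (simp add: mix_def ren1_def ren2_def)
  then show "mix x (mix e e') \<circ> ren1 = mix x e" "mix x (mix e e') \<circ> ren2 = mix x e'" by blast+
qed

lemma mix_double: "mix d d' \<circ> (\<lambda>i. 2 * i) = d" "mix d d' \<circ> (\<lambda>i. Suc (2 * i)) = d'"
  by (auto simp: mix_def)

lemma mix_ren_ex: "(mix x (case_nat c e))(1 := a) \<circ> ren_ex = mix (case_nat a x) e"
proof
  fix i
  show "((mix x (case_nat c e))(1 := a) \<circ> ren_ex) i = mix (case_nat a x) e i"
  proof (cases "even i")
    case True
    then obtain k where "i = 2 * k" by blast
    then show ?thesis by (cases k) (auto simp: mix_def ren_ex_def)
  next
    case False
    then obtain k where "i = 2 * k + 1" by (rule oddE)
    then show ?thesis by (auto simp: mix_def ren_ex_def)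
  qed
qed

lemma mix_ren_untuple: "mix x e \<circ> ren_untuple m = assign (map x [0..<m]) e"
  by (rule ext) (auto simp: mix_def ren_untuple_def assign_def)

lemma fun_upd_comp_inj: "inj g \<Longrightarrow> e(g i := a) \<circ> g = (e \<circ> g)(i := a)"
  by (auto simp: fun_eq_iff dest: injD)

subsection \<open>The language of rings\<close>

primrec ren_term :: "(nat \<Rightarrow> nat) \<Rightarrow> ring_term \<Rightarrow> ring_term" where
  "ren_term g (TVar i) = TVar (g i)"
| "ren_term g TZero = TZero"
| "ren_term g TOne = TOne"
| "ren_term g (TNeg s) = TNeg (ren_term g s)"
| "ren_term g (TAdd s t) = TAdd (ren_term g s) (ren_term g t)"
| "ren_term g (TMul s t) = TMul (ren_term g s) (ren_term g t)"

primrec ren_ring :: "(nat \<Rightarrow> nat) \<Rightarrow> ring_formula \<Rightarrow> ring_formula" where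
  "ren_ring g (FEq s t) = FEq (ren_term g s) (ren_term g t)"
| "ren_ring g (FNot \<phi>) = FNot (ren_ring g \<phi>)"
| "ren_ring g (FAnd \<phi> \<psi>) = FAnd (ren_ring g \<phi>) (ren_ring g \<psi>)"
| "ren_ring g (FEx i \<phi>) = FEx (g i) (ren_ring g \<phi>)"

lemma ring_eval_ren: "ring_eval e (ren_term g t) = ring_eval (e \<circ> g) t"
  by (induction t) auto

lemma ring_sat_ren: "inj g \<Longrightarrow> ring_sat e (ren_ring g \<phi>) = ring_sat (e \<circ> g) \<phi>"
  by (induction \<phi> arbitrary: e) (auto simp: ring_eval_ren fun_upd_comp_inj)

lemma polyfn_ring_eval:
  assumes "polyfn f"
  shows "\<exists>t e. \<forall>x. f x = ring_eval (mix x e) t"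
  using assms
proof induction
  case (polyfn_var i)
  then show ?case by (intro exI[of _ "TVar (2 * i)"]) (simp add: mix_def)
next
  case (polyfn_const c)
  then show ?case by (intro exI[of _ "TVar 1"] exI[of _ "\<lambda>_. c"]) (simp add: mix_def)
next
  case (polyfn_add f g)
  then obtain s d t e where "\<forall>x. f x = ring_eval (mix x d) s" "\<forall>x. g x = ring_eval (mix x e) t" by blast
  then show ?case
    by (intro exI[of _ "TAdd (ren_term ren1 s) (ren_term ren2 t)"] exI[of _ "mix d e"])
       (simp add: ring_eval_ren mix_ren1 mix_ren2)
next
  case (polyfn_mult f g)
  then obtain s d t e where "\<forall>x. f x = ring_eval (mix x d) s" "\<forall>x. g x = ring_eval (mix x e) t" by blast
  then show ?case
    by (intro exI[of _ "TMul (ren_term ren1 s) (ren_term ren2 t)"] exI[of _ "mix d e"])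
       (simp add: ring_eval_ren mix_ren1 mix_ren2)
qed

lemma polyfn_ring_eval2:
  assumes "polyfn f" "polyfn g"
  obtains e s t where "\<And>x. f x = ring_eval (mix x e) s" "\<And>x. g x = ring_eval (mix x e) t"
proof -
  obtain s d t e where "\<forall>x. f x = ring_eval (mix x d) s" "\<forall>x. g x = ring_eval (mix x e) t"
    using assms polyfn_ring_eval by metis
  then show ?thesis
    using that[of "mix d e" "ren_term ren1 s" "ren_term ren2 t"]
    by (simp add: ring_eval_ren mix_ren1 mix_ren2)
qed

text \<open>Definability of predicates in the language of rings, with parameters.\<close>

definition ring_Def :: "((nat \<Rightarrow> 'k::field) \<Rightarrow> bool) \<Rightarrow> bool" where
  "ring_Def \<Phi> \<longleftrightarrow> (\<exists>\<phi> e. \<forall>x. \<Phi> x \<longleftrightarrow> ring_sat (mix x e) \<phi>)"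

lemma ring_definability: "definability ring_definable (ring_Def :: ((nat \<Rightarrow> 'k::field) \<Rightarrow> bool) \<Rightarrow> bool)"
proof
  fix m and X :: "'k list set"
  show "ring_definable m X \<longleftrightarrow> X \<subseteq> {x. length x = m} \<and> ring_Def (\<lambda>x. map x [0..<m] \<in> X)"
  proof
    assume "ring_definable m X"
    then obtain \<phi> e where X: "X = {x. length x = m \<and> ring_sat (assign x e) \<phi>}"
      by (auto simp: ring_definable_def)
    have "map x [0..<m] \<in> X \<longleftrightarrow> ring_sat (mix x e) (ren_ring (ren_untuple m) \<phi>)" for x
      by (simp add: X ring_sat_ren inj_ren_untuple mix_ren_untuple)
    then show "X \<subseteq> {x. length x = m} \<and> ring_Def (\<lambda>x. map x [0..<m] \<in> X)"
      using X unfolding ring_Def_def by blast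
  next
    assume X: "X \<subseteq> {x. length x = m} \<and> ring_Def (\<lambda>x. map x [0..<m] \<in> X)"
    then obtain \<phi> e where \<phi>: "\<And>x. map x [0..<m] \<in> X \<longleftrightarrow> ring_sat (mix x e) \<phi>"
      by (auto simp: ring_Def_def)
    define e' where "e' i = mix (\<lambda>_. 0) e (i - m)" for i
    have "x \<in> X \<longleftrightarrow> ring_sat (assign x e') (ren_ring (ren_tuple m) \<phi>)" if "length x = m" for x
    proof -
      define y where "y = assign x (\<lambda>_. 0 :: 'k)"
      have x: "x = map y [0..<m]" using that by (auto simp: y_def assign_def intro: nth_equalityI)
      have "assign x e' \<circ> ren_tuple m = mix y e"
        using that by (auto simp: fun_eq_iff assign_def ren_tuple_def mix_def e'_def y_def)
      then show ?thesis using \<phi>[of y] by (simp add: x[symmetric] ring_sat_ren inj_ren_tuple)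
    qed
    then have "X = {x. length x = m \<and> ring_sat (assign x e') (ren_ring (ren_tuple m) \<phi>)}"
      using X by blast
    then show "ring_definable m X" unfolding ring_definable_def by blast
  qed
next
  fix \<Phi> :: "(nat \<Rightarrow> 'k) \<Rightarrow> bool" assume "ring_Def \<Phi>"
  then obtain \<phi> e where "\<forall>x. \<Phi> x \<longleftrightarrow> ring_sat (mix x e) \<phi>" by (auto simp: ring_Def_def)
  then show "ring_Def (\<lambda>x. \<not> \<Phi> x)"
    unfolding ring_Def_def by (intro exI[of _ "FNot \<phi>"] exI[of _ e]) simp
next
  fix \<Phi> \<Psi> :: "(nat \<Rightarrow> 'k) \<Rightarrow> bool" assume "ring_Def \<Phi>" "ring_Def \<Psi>"
  then obtain \<phi> e \<psi> e' where "\<forall>x. \<Phi> x \<longleftrightarrow> ring_sat (mix x e) \<phi>" "\<forall>x. \<Psi> x \<longleftrightarrow> ring_sat (mix x e') \<psi>"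
    unfolding ring_Def_def by blast
  then show "ring_Def (\<lambda>x. \<Phi> x \<and> \<Psi> x)"
    unfolding ring_Def_def
    by (intro exI[of _ "FAnd (ren_ring ren1 \<phi>) (ren_ring ren2 \<psi>)"] exI[of _ "mix e e'"])
       (simp add: ring_sat_ren inj_ren1 inj_ren2 mix_ren1 mix_ren2)
next
  fix \<Theta> :: "'k \<Rightarrow> (nat \<Rightarrow> 'k) \<Rightarrow> bool" assume "ring_Def (\<lambda>x. \<Theta> (x 0) (\<lambda>i. x (Suc i)))"
  then obtain \<phi> e where \<phi>: "\<And>x. \<Theta> (x 0) (\<lambda>i. x (Suc i)) \<longleftrightarrow> ring_sat (mix x e) \<phi>"
    by (auto simp: ring_Def_def)
  have "\<Theta> a x \<longleftrightarrow> ring_sat (mix (case_nat a x) e) \<phi>" for a x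
    using \<phi>[of "case_nat a x"] by simp
  then show "ring_Def (\<lambda>x. \<exists>a. \<Theta> a x)"
    unfolding ring_Def_def
    by (intro exI[of _ "FEx 1 (ren_ring ren_ex \<phi>)"] exI[of _ "case_nat 0 e"])
       (simp add: ring_sat_ren inj_ren_ex mix_ren_ex del: One_nat_def)
next
  fix f g :: "(nat \<Rightarrow> 'k) \<Rightarrow> 'k" assume "polyfn f" "polyfn g"
  then obtain s t e where "\<And>x. f x = ring_eval (mix x e) s" "\<And>x. g x = ring_eval (mix x e) t"
    by (rule polyfn_ring_eval2) blast
  then show "ring_Def (\<lambda>x. f x = g x)"
    unfolding ring_Def_def by (intro exI[of _ "FEq s t"] exI[of _ e]) simp
qed

subsection \<open>The language of Denef--Pas\<close>

text \<open>\<open>g\<close> renames the variables of the valued field sort, and \<open>h\<close> those of the other two sorts.\<close>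

primrec ren_res :: "(nat \<Rightarrow> nat) \<Rightarrow> (nat \<Rightarrow> nat) \<Rightarrow> 'f res_term \<Rightarrow> 'f res_term" where
  "ren_res g h (RVar i) = RVar (h i)"
| "ren_res g h RZero = RZero"
| "ren_res g h ROne = ROne"
| "ren_res g h (RNeg s) = RNeg (ren_res g h s)"
| "ren_res g h (RAdd s t) = RAdd (ren_res g h s) (ren_res g h t)"
| "ren_res g h (RMul s t) = RMul (ren_res g h s) (ren_res g h t)"
| "ren_res g h (RFun f ts) = RFun f (map (ren_res g h) ts)"
| "ren_res g h (Ac t) = Ac (ren_term g t)"

primrec ren_grp :: "(nat \<Rightarrow> nat) \<Rightarrow> (nat \<Rightarrow> nat) \<Rightarrow> 'h grp_term \<Rightarrow> 'h grp_term" where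
  "ren_grp g h (GVar i) = GVar (h i)"
| "ren_grp g h GZero = GZero"
| "ren_grp g h GInf = GInf"
| "ren_grp g h (GNeg s) = GNeg (ren_grp g h s)"
| "ren_grp g h (GAdd s t) = GAdd (ren_grp g h s) (ren_grp g h t)"
| "ren_grp g h (GFun f ts) = GFun f (map (ren_grp g h) ts)"
| "ren_grp g h (Val t) = Val (ren_term g t)"

primrec ren_pas ::
  "(nat \<Rightarrow> nat) \<Rightarrow> (nat \<Rightarrow> nat) \<Rightarrow> ('f, 'p, 'h, 'q) pas_formula \<Rightarrow> ('f, 'p, 'h, 'q) pas_formula" where
  "ren_pas g h (EqK s t) = EqK (ren_term g s) (ren_term g t)"
| "ren_pas g h (EqR s t) = EqR (ren_res g h s) (ren_res g h t)"
| "ren_pas g h (RelR p ts) = RelR p (map (ren_res g h) ts)"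
| "ren_pas g h (EqG s t) = EqG (ren_grp g h s) (ren_grp g h t)"
| "ren_pas g h (LeG s t) = LeG (ren_grp g h s) (ren_grp g h t)"
| "ren_pas g h (RelG p ts) = RelG p (map (ren_grp g h) ts)"
| "ren_pas g h (PNot \<phi>) = PNot (ren_pas g h \<phi>)"
| "ren_pas g h (PAnd \<phi> \<psi>) = PAnd (ren_pas g h \<phi>) (ren_pas g h \<psi>)"
| "ren_pas g h (ExK i \<phi>) = ExK (g i) (ren_pas g h \<phi>)"
| "ren_pas g h (ExR i \<phi>) = ExR (h i) (ren_pas g h \<phi>)"
| "ren_pas g h (ExG i \<phi>) = ExG (h i) (ren_pas g h \<phi>)"

lemma res_wf_ren: "res_wf L (ren_res g h t) = res_wf L t"
  by (induction t) (auto simp: list_all_iff)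

lemma grp_wf_ren: "grp_wf L (ren_grp g h t) = grp_wf L t"
  by (induction t) (auto simp: list_all_iff)

lemma pas_wf_ren: "pas_wf Lk LG (ren_pas g h \<phi>) = pas_wf Lk LG \<phi>"
  by (induction \<phi>) (auto simp: res_wf_ren grp_wf_ren list_all_iff)

lemma res_eval_ren: "res_eval R ac L e d (ren_res g h t) = res_eval R ac L (e \<circ> g) (d \<circ> h) t"
  by (induction t) (auto simp: ring_eval_ren comp_def cong: map_cong)

lemma grp_eval_ren: "grp_eval v L e c (ren_grp g h t) = grp_eval v L (e \<circ> g) (c \<circ> h) t"
  by (induction t) (auto simp: ring_eval_ren comp_def cong: map_cong)

lemma map_res_eval_ren:
  "map (res_eval R ac L e d) (map (ren_res g h) ts) = map (res_eval R ac L (e \<circ> g) (d \<circ> h)) ts"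
  by (simp add: res_eval_ren)

lemma map_grp_eval_ren:
  "map (grp_eval v L e c) (map (ren_grp g h) ts) = map (grp_eval v L (e \<circ> g) (c \<circ> h)) ts"
  by (simp add: grp_eval_ren)

lemma pas_sat_ren:
  "inj g \<Longrightarrow> inj h \<Longrightarrow>
    pas_sat v ac Lk LG e d c (ren_pas g h \<phi>) = pas_sat v ac Lk LG (e \<circ> g) (d \<circ> h) (c \<circ> h) \<phi>"
  by (induction \<phi> arbitrary: e d c)
     (auto simp: ring_eval_ren res_eval_ren grp_eval_ren map_res_eval_ren map_grp_eval_ren
       fun_upd_comp_inj simp del: map_map)

text \<open>Definability in the language of Denef--Pas of predicates on the valued field sort.\<close>

definition pas_Def ::
  "('k::field \<Rightarrow> 'g::linordered_ab_group_add adjoin_inf) \<Rightarrow> ('k \<Rightarrow> 'k set) \<Rightarrow>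
    ('f, 'p, 'k set) expansion \<Rightarrow> ('h, 'q, 'g adjoin_inf) expansion \<Rightarrow> ((nat \<Rightarrow> 'k) \<Rightarrow> bool) \<Rightarrow> bool" where
  "pas_Def v ac Lk LG \<Phi> \<longleftrightarrow> (\<exists>\<phi> e d c. pas_wf Lk LG \<phi> \<and> range d \<subseteq> carrier (residue_field v) \<and>
     (\<forall>x. \<Phi> x \<longleftrightarrow> pas_sat v ac Lk LG (mix x e) d c \<phi>))"

lemma pas_DefI:
  assumes "pas_wf Lk LG \<phi>" "range d \<subseteq> carrier (residue_field v)"
    "\<And>x. \<Phi> x \<longleftrightarrow> pas_sat v ac Lk LG (mix x e) d c \<phi>"
  shows "pas_Def v ac Lk LG \<Phi>"
  using assms unfolding pas_Def_def by blast

lemma pas_DefE: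
  assumes "pas_Def v ac Lk LG \<Phi>"
  obtains \<phi> d e c where "pas_wf Lk LG \<phi>" "range d \<subseteq> carrier (residue_field v)"
    "\<And>x. \<Phi> x \<longleftrightarrow> pas_sat v ac Lk LG (mix x e) d c \<phi>"
proof -
  obtain \<phi> e d c where *: "pas_wf Lk LG \<phi>" "range d \<subseteq> carrier (residue_field v)"
    "\<forall>x. \<Phi> x \<longleftrightarrow> pas_sat v ac Lk LG (mix x e) d c \<phi>"
    using assms unfolding pas_Def_def by blast
  show ?thesis by (rule that[OF *(1,2)]) (simp add: *(3))
qed

lemma residue_field_inhabited:
  assumes "valuation v"
  obtains r where "r \<in> carrier (residue_field v)"
proof -
  interpret I: ideal "val_ideal v" "val_ring v" by (rule ideal_val_ideal[OF assms])
  show ?thesis using that ring.ring_simprules(2)[OF I.quotient_is_ring] by (simp add: residue_field_def)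
qed

lemma pas_Def_atomic:
  fixes v :: "'k::field \<Rightarrow> 'g::linordered_ab_group_add adjoin_inf"
  assumes v: "valuation v" and fg: "polyfn f" "polyfn g"
  shows "pas_Def v ac Lk LG (\<lambda>x. f x = g x)" "pas_Def v ac Lk LG (\<lambda>x. v (f x) \<le> v (g x))"
    "pas_Def v ac Lk LG (\<lambda>x. ac (f x) = ac (g x))"
proof -
  obtain s t e where st: "\<And>x. f x = ring_eval (mix x e) s" "\<And>x. g x = ring_eval (mix x e) t"
    using fg by (rule polyfn_ring_eval2) blast
  obtain r where r: "r \<in> carrier (residue_field v)" using residue_field_inhabited[OF v] .
  show "pas_Def v ac Lk LG (\<lambda>x. f x = g x)"
    by (rule pas_DefI[where \<phi> = "EqK s t" and d = "\<lambda>_. r" and e = e]) (use r st in auto)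
  show "pas_Def v ac Lk LG (\<lambda>x. v (f x) \<le> v (g x))"
    by (rule pas_DefI[where \<phi> = "LeG (Val s) (Val t)" and d = "\<lambda>_. r" and e = e]) (use r st in auto)
  show "pas_Def v ac Lk LG (\<lambda>x. ac (f x) = ac (g x))"
    by (rule pas_DefI[where \<phi> = "EqR (Ac s) (Ac t)" and d = "\<lambda>_. r" and e = e]) (use r st in auto)
qed

lemma pas_definability:
  fixes v :: "'k::field \<Rightarrow> 'g::linordered_ab_group_add adjoin_inf"
  assumes v: "valuation v"
  shows "definability (pas_definable v ac Lk LG) (pas_Def v ac Lk LG)"
proof
  fix m and X :: "'k list set"
  show "pas_definable v ac Lk LG m X \<longleftrightarrow>
    X \<subseteq> {x. length x = m} \<and> pas_Def v ac Lk LG (\<lambda>x. map x [0..<m] \<in> X)"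
  proof
    assume "pas_definable v ac Lk LG m X"
    then obtain \<phi> e d c where \<phi>: "pas_wf Lk LG \<phi>" "range d \<subseteq> carrier (residue_field v)"
      and X: "X = {x. length x = m \<and> pas_sat v ac Lk LG (assign x e) d c \<phi>}"
      unfolding pas_definable_def by blast
    have "map x [0..<m] \<in> X \<longleftrightarrow> pas_sat v ac Lk LG (mix x e) d c (ren_pas (ren_untuple m) (\<lambda>i. i) \<phi>)" for x
      by (simp add: X pas_sat_ren inj_ren_untuple mix_ren_untuple comp_def[of _ "\<lambda>i. i"])
    then have "pas_Def v ac Lk LG (\<lambda>x. map x [0..<m] \<in> X)"
      using \<phi> by (intro pas_DefI[where \<phi> = "ren_pas (ren_untuple m) (\<lambda>i. i) \<phi>"]) (auto simp: pas_wf_ren)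
    then show "X \<subseteq> {x. length x = m} \<and> pas_Def v ac Lk LG (\<lambda>x. map x [0..<m] \<in> X)"
      using X by blast
  next
    assume X: "X \<subseteq> {x. length x = m} \<and> pas_Def v ac Lk LG (\<lambda>x. map x [0..<m] \<in> X)"
    from conjunct2[OF X] obtain \<phi> e d c where wf: "pas_wf Lk LG \<phi>" and d: "range d \<subseteq> carrier (residue_field v)"
      and \<phi>: "\<And>x. map x [0..<m] \<in> X \<longleftrightarrow> pas_sat v ac Lk LG (mix x e) d c \<phi>"
      by (rule pas_DefE) blast
    define e' where "e' i = mix (\<lambda>_. 0) e (i - m)" for i
    have "x \<in> X \<longleftrightarrow> pas_sat v ac Lk LG (assign x e') d c (ren_pas (ren_tuple m) (\<lambda>i. i) \<phi>)"
      if "length x = m" for x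
    proof -
      define y where "y = assign x (\<lambda>_. 0 :: 'k)"
      have x: "x = map y [0..<m]" using that by (auto simp: y_def assign_def intro: nth_equalityI)
      have "assign x e' \<circ> ren_tuple m = mix y e"
        using that by (auto simp: fun_eq_iff assign_def ren_tuple_def mix_def e'_def y_def)
      then show ?thesis using \<phi>[of y]
        by (simp add: x[symmetric] pas_sat_ren inj_ren_tuple comp_def[of _ "\<lambda>i. i"])
    qed
    then have "X = {x. length x = m \<and>
        pas_sat v ac Lk LG (assign x e') d c (ren_pas (ren_tuple m) (\<lambda>i. i) \<phi>)}"
      using X by blast
    moreover have "pas_wf Lk LG (ren_pas (ren_tuple m) (\<lambda>i. i) \<phi>)" using wf by (simp add: pas_wf_ren)
    ultimately show "pas_definable v ac Lk LG m X" using d unfolding pas_definable_def by blast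
  qed
next
  fix \<Phi> :: "(nat \<Rightarrow> 'k) \<Rightarrow> bool" assume "pas_Def v ac Lk LG \<Phi>"
  then show "pas_Def v ac Lk LG (\<lambda>x. \<not> \<Phi> x)"
  proof (rule pas_DefE)
    fix \<phi> e d c
    assume "pas_wf Lk LG \<phi>" "range d \<subseteq> carrier (residue_field v)"
      "\<And>x. \<Phi> x \<longleftrightarrow> pas_sat v ac Lk LG (mix x e) d c \<phi>"
    then show ?thesis by (intro pas_DefI[where \<phi> = "PNot \<phi>" and d = d and e = e and c = c]) auto
  qed
next
  fix \<Phi> \<Psi> :: "(nat \<Rightarrow> 'k) \<Rightarrow> bool" assume "pas_Def v ac Lk LG \<Phi>" "pas_Def v ac Lk LG \<Psi>"
  obtain \<phi> e d c where wf1: "pas_wf Lk LG \<phi>" and d1: "range d \<subseteq> carrier (residue_field v)"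
    and \<phi>: "\<And>x. \<Phi> x \<longleftrightarrow> pas_sat v ac Lk LG (mix x e) d c \<phi>"
    using \<open>pas_Def v ac Lk LG \<Phi>\<close> by (rule pas_DefE) blast
  obtain \<psi> e' d' c' where wf2: "pas_wf Lk LG \<psi>" and d2: "range d' \<subseteq> carrier (residue_field v)"
    and \<psi>: "\<And>x. \<Psi> x \<longleftrightarrow> pas_sat v ac Lk LG (mix x e') d' c' \<psi>"
    using \<open>pas_Def v ac Lk LG \<Psi>\<close> by (rule pas_DefE) blast
  have inj: "inj (\<lambda>i :: nat. 2 * i)" "inj (\<lambda>i :: nat. Suc (2 * i))" by (auto simp: inj_def)
  have "range (mix d d') \<subseteq> carrier (residue_field v)" using d1 d2 by (auto simp: mix_def)
  then show "pas_Def v ac Lk LG (\<lambda>x. \<Phi> x \<and> \<Psi> x)"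
    using wf1 wf2
    by (intro pas_DefI[where \<phi> = "PAnd (ren_pas ren1 (\<lambda>i. 2 * i) \<phi>) (ren_pas ren2 (\<lambda>i. Suc (2 * i)) \<psi>)"
          and e = "mix e e'" and d = "mix d d'" and c = "mix c c'"])
       (simp_all add: pas_wf_ren pas_sat_ren inj inj_ren1 inj_ren2 mix_ren1 mix_ren2 mix_double \<phi> \<psi>
          del: Suc_eq_plus1 add_Suc_right)
next
  fix \<Theta> :: "'k \<Rightarrow> (nat \<Rightarrow> 'k) \<Rightarrow> bool" assume "pas_Def v ac Lk LG (\<lambda>x. \<Theta> (x 0) (\<lambda>i. x (Suc i)))"
  then obtain \<phi> e d c where wf: "pas_wf Lk LG \<phi>" and d: "range d \<subseteq> carrier (residue_field v)"
    and \<phi>: "\<And>x. \<Theta> (x 0) (\<lambda>i. x (Suc i)) \<longleftrightarrow> pas_sat v ac Lk LG (mix x e) d c \<phi>"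
    by (rule pas_DefE) blast
  have "\<Theta> a x \<longleftrightarrow> pas_sat v ac Lk LG (mix (case_nat a x) e) d c \<phi>" for a x
    using \<phi>[of "case_nat a x"] by simp
  then show "pas_Def v ac Lk LG (\<lambda>x. \<exists>a. \<Theta> a x)"
    using wf d
    by (intro pas_DefI[where \<phi> = "ExK 1 (ren_pas ren_ex (\<lambda>i. i) \<phi>)" and e = "case_nat 0 e" and d = d and c = c])
       (simp_all add: pas_wf_ren pas_sat_ren inj_ren_ex mix_ren_ex comp_def[of _ "\<lambda>i. i"] del: One_nat_def)
qed (rule pas_Def_atomic[OF v])


section \<open>Partition into power classes\<close>

locale definable_tame = definability D Def + tame_ordered_field P
  for D :: "nat \<Rightarrow> 'k::field list set \<Rightarrow> bool" and Def and P :: "'k set"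
begin

text \<open>\<open>P\<close> is the union of finitely many square classes, given by representatives as parameters.\<close>

lemma dset_P: "dset P"
proof -
  obtain Q :: "'k set" where Q: "finite Q" "Q \<subseteq> UNIV - {0}"
      "\<And>x. x \<in> UNIV - {0} \<Longrightarrow> \<exists>q\<in>Q. \<exists>y\<in>UNIV - {0}. x = q * y ^ 2"
    using finite_classes unfolding finite_power_classes_def by (meson zero_less_numeral)
  have eq: "x \<in> P \<longleftrightarrow> (\<exists>q\<in>Q \<inter> P. \<exists>y. y \<noteq> 0 \<and> x = q * y ^ 2)" for x
  proof
    assume x: "x \<in> P"
    then obtain q y where qy: "q \<in> Q" "y \<noteq> 0" "x = q * y ^ 2" using Q(3)[of x] P_nonzero by auto
    then have "q = x * inverse (y * y)" by (simp add: power2_eq_square field_simps)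
    then have "q \<in> P" using x P_mult P_inverse P_square[OF qy(2)] by blast
    then show "\<exists>q\<in>Q \<inter> P. \<exists>y. y \<noteq> 0 \<and> x = q * y ^ 2" using qy by blast
  next
    assume "\<exists>q\<in>Q \<inter> P. \<exists>y. y \<noteq> 0 \<and> x = q * y ^ 2"
    then show "x \<in> P" using P_mult P_square by (auto simp: power2_eq_square)
  qed
  have "finite (Q \<inter> P)" using Q(1) by blast
  then show ?thesis
    unfolding dset_def eq
    by (intro Def_finite_bex Def_ex Def_conj Def_not Def_eq polyfn_intros)
qed

lemma def_equiv_power:
  assumes "dset T" "T \<subseteq> P" "c \<noteq> 0" "m > 0"
  shows "T \<sim> (\<lambda>x. c * x ^ m) ` T"
proof (rule def_equiv_image)
  show "drel (\<lambda>a b. b = c * a ^ m)" unfolding drel_def by (intro Def_eq polyfn_intros)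
  show "inj_on (\<lambda>x. c * x ^ m) T"
    using assms P_power_inject by (intro inj_onI) (simp, blast)
qed fact

lemma def_equiv_scale:
  assumes "dset T" "c \<noteq> 0"
  shows "T \<sim> (\<lambda>x. c * x) ` T"
proof (rule def_equiv_image)
  show "drel (\<lambda>a b. b = c * a)" unfolding drel_def by (intro Def_eq polyfn_intros)
  show "inj_on (\<lambda>x. c * x) T" using assms(2) by (simp add: inj_on_def)
qed fact

lemma def_equiv_translate:
  assumes "dset T"
  shows "T \<sim> (\<lambda>x. c + x) ` T"
proof (rule def_equiv_image)
  show "drel (\<lambda>a b. b = c + a)" unfolding drel_def by (intro Def_eq polyfn_intros)
qed (use assms in simp_all)

lemma def_equiv_inverse:
  assumes "dset T"
  shows "T \<sim> inverse ` T"
proof (rule def_equiv_image)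
  have eq: "b = inverse a \<longleftrightarrow> a * b = 1 \<or> a = 0 \<and> b = 0" for a b :: 'k
    by (cases "a = 0") (auto simp: inverse_unique)
  show "drel (\<lambda>a b. b = inverse a)"
    unfolding drel_def eq by (intro Def_disj Def_conj Def_eq polyfn_intros)
qed (use assms in \<open>simp_all add: inj_on_def\<close>)

text \<open>The half \<open>\<omega> \<ge> 0\<close> of \<open>U\<close> is the disjoint union of its images under \<open>y \<mapsto> r * y ^ m\<close>, for the
  representatives \<open>r\<close>.  Since \<open>0 \<le> \<omega> r < m\<close>, the values of \<open>\<omega>\<close> at \<open>y\<close> and at \<open>r * y ^ m\<close> have
  the same sign.\<close>

lemma copies_power:
  fixes \<omega> :: "'k \<Rightarrow> int"
  assumes U: "U \<subseteq> P" "1 \<in> U" "\<And>x y. x \<in> U \<Longrightarrow> y \<in> U \<Longrightarrow> x * y \<in> U" "\<And>x. x \<in> U \<Longrightarrow> inverse x \<in> U"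
    and pure: "\<And>y m. m > 0 \<Longrightarrow> y \<in> P \<Longrightarrow> y ^ m \<in> U \<Longrightarrow> y \<in> U"
    and \<omega>: "\<And>x y. x \<in> U \<Longrightarrow> y \<in> U \<Longrightarrow> \<omega> (x * y) = \<omega> x + \<omega> y"
    and \<tau>: "\<tau> \<in> U" "\<omega> \<tau> = 1"
    and T: "dset {x \<in> U. 0 \<le> \<omega> x}" and m: "m > 0"
  shows "\<exists>a>0. copies {x \<in> U. 0 \<le> \<omega> x} (a * m) {x \<in> U. 0 \<le> \<omega> x}"
proof -
  let ?T = "{x \<in> U. 0 \<le> \<omega> x}"
  have "\<exists>R. power_reps U \<omega> m R"
    by (rule power_class_representatives[where \<tau> = \<tau>]) (fact U pure[OF m] \<omega> \<tau> m)+
  then obtain R where "power_reps U \<omega> m R" by blast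
  note R = power_repsD[OF this]
  obtain a where a: "card R = a * m" using R(4) by (metis dvd_def mult.commute)
  have "a \<noteq> 0" using a R(1,2) by (metis card_eq_0_iff mult_0)
  have pow: "x ^ n \<in> U \<and> \<omega> (x ^ n) = int n * \<omega> x" if "x \<in> U" for x n
  proof -
    have "\<omega> 1 = 0" using \<omega>[OF U(2) U(2)] by simp
    then show ?thesis by (induction n) (use that U \<omega> in \<open>auto simp: algebra_simps\<close>)
  qed
  have val: "r * y ^ m \<in> U" "\<omega> (r * y ^ m) = \<omega> r + int m * \<omega> y" if "r \<in> R" "y \<in> U" for r y
    using that R(3) U(3) \<omega> pow by auto
  have "?T = (\<Union>r\<in>R. (\<lambda>y. r * y ^ m) ` ?T)"
  proof
    show "?T \<subseteq> (\<Union>r\<in>R. (\<lambda>y. r * y ^ m) ` ?T)"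
    proof
      fix x assume x: "x \<in> ?T"
      then obtain r y where ry: "r \<in> R" "y \<in> U" "x = r * y ^ m" using R(6) by blast
      have "0 < int m * (\<omega> y + 1)" using x ry val R(5)[OF ry(1)] by (simp add: algebra_simps)
      then have "0 \<le> \<omega> y" using m by (simp add: zero_less_mult_iff)
      then show "x \<in> (\<Union>r\<in>R. (\<lambda>y. r * y ^ m) ` ?T)" using ry by blast
    qed
    show "(\<Union>r\<in>R. (\<lambda>y. r * y ^ m) ` ?T) \<subseteq> ?T" using val R(5) by auto
  qed
  moreover have "copies ?T (card R) (\<Union>r\<in>R. (\<lambda>y. r * y ^ m) ` ?T)"
  proof (rule copies_UN[OF R(1)])
    fix r assume "r \<in> R"
    then have "r \<noteq> 0" using R(3) U(1) P_nonzero by blast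
    then show "(\<lambda>y. r * y ^ m) ` ?T \<sim> ?T"
      using U(1) by (intro def_equiv_sym[OF def_equiv_power] T m) auto
  next
    have "r = s" if "r \<in> R" "s \<in> R" "y \<in> U" "z \<in> U" "r * y ^ m = s * z ^ m" for r s y z
      using R(7)[OF that(1,2) _ _ that(5)] that(3,4) U(1) P_nonzero by blast
    then show "disjoint_family_on (\<lambda>r. (\<lambda>y. r * y ^ m) ` ?T) R"
      unfolding disjoint_family_on_def by blast
  qed
  ultimately show ?thesis using a \<open>a \<noteq> 0\<close> by auto
qed

end


section \<open>Valued fields\<close>

lemma lex_int_less_iff: "r < s \<longleftrightarrow> (\<exists>i. coord r i < coord s i \<and> (\<forall>j<i. coord r j = coord s j))"
  by transfer (simp add: less_fun_def)

lemma coord_simps: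
  "coord (r + s) i = coord r i + coord s i" "coord (- r) i = - coord r i"
  "coord (r - s) i = coord r i - coord s i" "coord 0 i = 0" "coord (unit_vec k) i = (if i = k then 1 else 0)"
  by (simp_all add: plus_lex_int.rep_eq uminus_lex_int.rep_eq minus_lex_int.rep_eq zero_lex_int.rep_eq
      unit_vec_def Lex_inverse)

lemma lex_int_nonneg_iff:
  assumes "\<And>j. j < i \<Longrightarrow> coord r j = 0" "coord r i \<noteq> 0"
  shows "0 \<le> r \<longleftrightarrow> 0 < coord r i"
proof (cases "0 < coord r i")
  case True
  then have "0 < r" unfolding lex_int_less_iff using assms(1) by (auto simp: coord_simps)
  then show ?thesis using True by simp
next
  case False
  then have "r < 0" unfolding lex_int_less_iff using assms by (auto simp: coord_simps intro!: exI[of _ i])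
  then show ?thesis using False by auto
qed

text \<open>The coordinates are not part of the language, but the sign of the first one that may be non-zero can be
  expressed by the order: the coordinate \<open>i\<close> of \<open>unit_vec i + (r + r)\<close> is odd, hence non-zero, so it alone
  decides.\<close>

lemma lex_int_double:
  assumes "\<And>j. j < i \<Longrightarrow> coord r j = 0"
  shows "0 \<le> unit_vec i + (r + r) \<longleftrightarrow> 0 \<le> coord r i"
  by (subst lex_int_nonneg_iff[of i]) (use assms in \<open>auto simp: coord_simps\<close>, presburger)

lemma unit_vec_last_least:
  assumes "0 < r"
  shows "unit_vec (Max UNIV) \<le> (r :: 'd::{finite,linorder} lex_int)"
proof -
  obtain i where i: "0 < coord r i" "\<And>j. j < i \<Longrightarrow> coord r j = 0"
    using assms unfolding lex_int_less_iff by (auto simp: coord_simps)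
  have "i \<le> Max UNIV" by simp
  show ?thesis
  proof (cases "i = Max UNIV")
    case True
    show ?thesis
    proof (cases "coord r i = 1")
      case True
      have "coord r j = coord (unit_vec i) j" for j
      proof -
        have "j \<le> i" using \<open>i = Max UNIV\<close> by simp
        then have "j < i \<or> j = i" by (simp only: order_le_less)
        then show ?thesis using i(2) True by (auto simp: coord_simps)
      qed
      then have "r = unit_vec i" by (simp add: coord_inject[symmetric] fun_eq_iff)
      then show ?thesis using \<open>i = Max UNIV\<close> by simp
    next
      case False
      then have "unit_vec i < r" unfolding lex_int_less_iff using i by (auto simp: coord_simps intro!: exI[of _ i])
      then show ?thesis using \<open>i = Max UNIV\<close> by simp
    qed
  next
    case False
    then have "i < Max UNIV" using \<open>i \<le> Max UNIV\<close> by (metis order_le_less)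
    then have "unit_vec (Max UNIV) < r"
      unfolding lex_int_less_iff using i by (auto simp: coord_simps intro!: exI[of _ i])
    then show ?thesis by simp
  qed
qed

text \<open>The setting of a valuation onto integer vectors, with its natural angular component map.\<close>

locale valued_tame = definable_tame D Def P
  for D :: "nat \<Rightarrow> 'k::field list set \<Rightarrow> bool" and Def and P :: "'k set" +
  fixes v :: "'k \<Rightarrow> 'd::{finite,linorder} lex_int adjoin_inf" and \<tau> :: "'d \<Rightarrow> 'k"
  assumes v: "valuation v" and v_\<tau>: "\<And>i. v (\<tau> i) = Fin (unit_vec i)"
    and Def_le: "\<And>f g. polyfn f \<Longrightarrow> polyfn g \<Longrightarrow> Def (\<lambda>x. v (f x) \<le> v (g x))"
    and Def_ac: "\<And>f g. polyfn f \<Longrightarrow> polyfn g \<Longrightarrow> Def (\<lambda>x. natural_ac v \<tau> (f x) = natural_ac v \<tau> (g x))"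
begin

abbreviation "ac \<equiv> natural_ac v \<tau>"

text \<open>The value of a non-zero element, as an element of the value group; at 0 it is unspecified.\<close>

definition val :: "'k \<Rightarrow> 'd lex_int" where
  "val x = (THE r. v x = Fin r)"

lemma v_val: "x \<noteq> 0 \<Longrightarrow> v x = Fin (val x)"
  using v unfolding valuation_def val_def by (cases "v x") auto

lemma v_mult: "v (x * y) = v x + v y" and v_0: "v 0 = Infty"
  using v unfolding valuation_def by blast+

lemma v_1: "v 1 = Fin 0"
  using val_one[OF v] by (simp add: zero_adjoin_inf_def)

lemma val_mult: "x \<noteq> 0 \<Longrightarrow> y \<noteq> 0 \<Longrightarrow> val (x * y) = val x + val y"
  using v_mult[of x y] by (simp add: v_val)

lemma val_1: "val 1 = 0"
  using v_1 v_val[of 1] by simp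

lemma val_inverse: "x \<noteq> 0 \<Longrightarrow> val (inverse x) = - val x"
  using val_mult[of x "inverse x"] by (simp add: val_1 minus_unique)

lemma val_neg: "x \<noteq> 0 \<Longrightarrow> val (- x) = val x"
  using val_uminus[OF v, of x] v_val[of x] v_val[of "- x"] by simp

lemma \<tau>_nonzero: "\<tau> i \<noteq> 0"
  using v_\<tau>[of i] v_0 by auto

lemma val_\<tau>: "val (\<tau> i) = unit_vec i"
  using v_val[OF \<tau>_nonzero] v_\<tau> by simp

lemma val_add_less:
  assumes "x \<noteq> 0" "y \<noteq> 0" "val x < val y"
  shows "x + y \<noteq> 0 \<and> val (x + y) = val x"
proof -
  have nz: "x + y \<noteq> 0"
    using assms val_neg[of y] by (auto simp: add_eq_0_iff2)
  have "min (v x) (v y) \<le> v (x + y)" using v unfolding valuation_def by blast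
  then have "val x \<le> val (x + y)" using assms nz by (auto simp: v_val min_def split: if_splits)
  moreover have "min (v (x + y)) (v (- y)) \<le> v (x + y + - y)" using v unfolding valuation_def by blast
  then have "val (x + y) \<le> val x"
    using assms nz by (auto simp: v_val val_neg min_def split: if_splits)
  ultimately show ?thesis using nz by auto
qed

text \<open>\<open>czero i\<close> consists of the positive elements whose value vanishes before the coordinate \<open>i\<close>; it is a group
  on which the coordinate \<open>i\<close> of the value is a homomorphism onto the integers.  \<open>cpos i\<close> is the half of it
  where this coordinate is non-negative.\<close>

definition czero :: "'d \<Rightarrow> 'k set" where
  "czero i = {x \<in> P. \<forall>j<i. coord (val x) j = 0}"

definition cpos :: "'d \<Rightarrow> 'k set" where
  "cpos i = {x \<in> czero i. 0 \<le> coord (val x) i}"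

text \<open>The elements whose value has the coordinate \<open>i\<close> as its first non-zero one, which is positive.\<close>

definition slice :: "'d \<Rightarrow> 'k set" where
  "slice i = {x. x \<noteq> 0 \<and> (\<forall>j<i. coord (val x) j = 0) \<and> 0 < coord (val x) i}"

text \<open>The condition on the first coordinates in \<open>cpos\<close> is thereby definable, by inequalities between values.\<close>

lemma coord_nonneg_iff:
  assumes "x \<noteq> 0" "\<And>j. j < i \<Longrightarrow> coord (val x) j = 0"
  shows "v 1 \<le> v (\<tau> i * x ^ 2) \<longleftrightarrow> 0 \<le> coord (val x) i"
    and "v (x ^ 2) \<le> v (\<tau> i) \<longleftrightarrow> coord (val x) i \<le> 0"
proof -
  have "v 1 \<le> v (\<tau> i * x ^ 2) \<longleftrightarrow> 0 \<le> unit_vec i + (val x + val x)"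
    using assms(1) \<tau>_nonzero by (simp add: v_val val_mult val_\<tau> val_1 power2_eq_square)
  then show "v 1 \<le> v (\<tau> i * x ^ 2) \<longleftrightarrow> 0 \<le> coord (val x) i"
    using lex_int_double assms(2) by metis
  have "v (x ^ 2) \<le> v (\<tau> i) \<longleftrightarrow> val x + val x \<le> unit_vec i"
    using assms(1) \<tau>_nonzero by (simp add: v_val val_mult val_\<tau> power2_eq_square)
  also have "\<dots> \<longleftrightarrow> 0 \<le> unit_vec i + (- val x + - val x)"
    by (metis (no_types, opaque_lifting) add_diff_cancel_left' diff_ge_0_iff_ge diff_conv_add_uminus minus_add_distrib add.commute)
  also have "\<dots> \<longleftrightarrow> 0 \<le> coord (- val x) i"
    by (rule lex_int_double) (simp add: coord_simps assms(2))
  finally show "v (x ^ 2) \<le> v (\<tau> i) \<longleftrightarrow> coord (val x) i \<le> 0" by (simp add: coord_simps)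
qed

lemma dset_cpos: "dset (cpos i)"
proof -
  have zero: "(\<forall>j<i. coord (val x) j = 0) \<longleftrightarrow> (\<forall>j\<in>{..<i}. v 1 \<le> v (\<tau> j * x ^ 2) \<and> v (x ^ 2) \<le> v (\<tau> j))"
    if x: "x \<noteq> 0" for x
  proof
    assume z: "\<forall>j<i. coord (val x) j = 0"
    show "\<forall>j\<in>{..<i}. v 1 \<le> v (\<tau> j * x ^ 2) \<and> v (x ^ 2) \<le> v (\<tau> j)"
    proof
      fix j assume "j \<in> {..<i}"
      then have "coord (val x) l = 0" if "l < j" for l using z that by auto
      then show "v 1 \<le> v (\<tau> j * x ^ 2) \<and> v (x ^ 2) \<le> v (\<tau> j)"
        using coord_nonneg_iff[OF x, of j] z \<open>j \<in> {..<i}\<close> by simp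
    qed
  next
    assume *: "\<forall>j\<in>{..<i}. v 1 \<le> v (\<tau> j * x ^ 2) \<and> v (x ^ 2) \<le> v (\<tau> j)"
    show "\<forall>j<i. coord (val x) j = 0"
    proof (rule ccontr)
      define J where "J = {j. j < i \<and> coord (val x) j \<noteq> 0}"
      assume "\<not> (\<forall>j<i. coord (val x) j = 0)"
      then have "J \<noteq> {}" "finite J" by (auto simp: J_def)
      then have J: "Min J \<in> J" "\<And>l. l < Min J \<Longrightarrow> l \<notin> J"
        using Min_le[of J] by (auto simp: not_le[symmetric])
      have z: "coord (val x) l = 0" if "l < Min J" for l
        using J(2)[OF that] J(1) that unfolding J_def by auto
      have "Min J < i" "coord (val x) (Min J) \<noteq> 0" using J(1) by (auto simp: J_def simp del: Min_in)
      moreover from this(1) have "v 1 \<le> v (\<tau> (Min J) * x ^ 2)" "v (x ^ 2) \<le> v (\<tau> (Min J))"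
        using * by blast+
      ultimately show False using coord_nonneg_iff[OF x z] by simp
    qed
  qed
  have "x \<in> cpos i \<longleftrightarrow> x \<in> P \<and> (\<forall>j\<in>{..<i}. v 1 \<le> v (\<tau> j * x ^ 2) \<and> v (x ^ 2) \<le> v (\<tau> j)) \<and>
      v 1 \<le> v (\<tau> i * x ^ 2)" for x
  proof (cases "x \<in> P")
    case True
    then have x: "x \<noteq> 0" by (rule P_nonzero)
    show ?thesis using True zero[OF x] coord_nonneg_iff(1)[OF x] by (auto simp: cpos_def czero_def)
  qed (simp add: cpos_def czero_def)
  then show ?thesis
    unfolding dset_def
    by (simp only:) (intro Def_conj Def_mem[OF dset_P] Def_finite_ball Def_le polyfn_intros finite)
qed

lemma copies_cpos:
  assumes "m > 0"
  shows "\<exists>a>0. copies (cpos i) (a * m) (cpos i)"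
proof -
  define t where "t = (if \<tau> i \<in> P then \<tau> i else - \<tau> i)"
  have t: "t \<in> P" using P_cases[of "\<tau> i"] \<tau>_nonzero by (auto simp: t_def)
  have val_t: "val t = unit_vec i" by (simp add: t_def val_\<tau> val_neg \<tau>_nonzero)
  have cp: "coord (val (y ^ m)) j = int m * coord (val y) j" if "y \<noteq> 0" for y m j
    by (induction m) (use that in \<open>simp_all add: val_1 val_mult coord_simps algebra_simps\<close>)
  have "\<exists>a>0. copies {x \<in> czero i. 0 \<le> coord (val x) i} (a * m) {x \<in> czero i. 0 \<le> coord (val x) i}"
  proof (rule copies_power)
    show "dset {x \<in> czero i. 0 \<le> coord (val x) i}" using dset_cpos by (simp add: cpos_def)
    show "y \<in> czero i" if "m > 0" "y \<in> P" "y ^ m \<in> czero i" for y m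
      using that P_nonzero[of y] by (simp add: czero_def cp)
    show "t \<in> czero i" "coord (val t) i = 1" using t by (auto simp: czero_def val_t coord_simps)
  qed (use assms in \<open>auto simp: czero_def P_one P_mult P_inverse val_1 val_mult val_inverse coord_simps P_nonzero\<close>)
  then show ?thesis by (simp add: cpos_def)
qed

text \<open>The positive and the negative half of \<open>slice i\<close> are the multiples of \<open>cpos i\<close> by \<open>t\<close> and \<open>- t\<close>.\<close>

lemma slice_def_equiv: "slice i \<sim> cpos i"
proof (rule copies_two_absorb[OF dset_cpos copies_cpos])
  define t where "t = (if \<tau> i \<in> P then \<tau> i else - \<tau> i)"
  have t: "t \<in> P" using P_cases[of "\<tau> i"] \<tau>_nonzero by (auto simp: t_def)
  have val_t: "val t = unit_vec i" by (simp add: t_def val_\<tau> val_neg \<tau>_nonzero)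
  have t0: "t \<noteq> 0" using t by (rule P_nonzero)
  have slice: "t * x \<in> slice i \<longleftrightarrow> x \<noteq> 0 \<and> (\<forall>j<i. coord (val x) j = 0) \<and> 0 \<le> coord (val x) i" for x
    using t0 by (cases "x = 0") (auto simp: slice_def val_mult val_t coord_simps)
  have "(\<lambda>x. t * x) ` cpos i = slice i \<inter> P"
  proof
    show "(\<lambda>x. t * x) ` cpos i \<subseteq> slice i \<inter> P"
      using t P_mult P_nonzero by (auto simp: cpos_def czero_def slice)
    show "slice i \<inter> P \<subseteq> (\<lambda>x. t * x) ` cpos i"
    proof
      fix y assume y: "y \<in> slice i \<inter> P"
      then have "t * (inverse t * y) \<in> slice i" using t0 by (simp add: mult.assoc[symmetric])
      moreover have "inverse t * y \<in> P" using y t P_mult P_inverse by blast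
      ultimately have "inverse t * y \<in> cpos i" unfolding slice by (simp add: cpos_def czero_def)
      then show "y \<in> (\<lambda>x. t * x) ` cpos i" using t0 by (intro image_eqI[of _ _ "inverse t * y"]) simp_all
    qed
  qed
  moreover have "(\<lambda>x. - t * x) ` cpos i = slice i - P"
  proof
    have neg: "- x \<in> slice i \<longleftrightarrow> x \<in> slice i" for x by (cases "x = 0") (auto simp: slice_def val_neg)
    show "(\<lambda>x. - t * x) ` cpos i \<subseteq> slice i - P"
      using t P_mult P_nonzero P_uminus by (auto simp: cpos_def czero_def slice neg)
    show "slice i - P \<subseteq> (\<lambda>x. - t * x) ` cpos i"
    proof
      fix y assume y: "y \<in> slice i - P"
      then have "- y \<in> P" using P_cases[of y] by (auto simp: slice_def)
      then have "inverse t * (- y) \<in> P" using t P_mult P_inverse by blast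
      moreover have "t * (inverse t * (- y)) \<in> slice i" using y t0 neg by (simp add: mult.assoc[symmetric])
      ultimately have "inverse t * (- y) \<in> cpos i" unfolding slice by (simp add: cpos_def czero_def)
      then show "y \<in> (\<lambda>x. - t * x) ` cpos i" using t0 by (intro image_eqI[of _ _ "inverse t * (- y)"]) simp_all
    qed
  qed
  moreover have "copies (cpos i) (1 + 1) ((\<lambda>x. t * x) ` cpos i \<union> (\<lambda>x. - t * x) ` cpos i)"
    using t0 calculation
    by (intro copies_add copies_1 def_equiv_sym[OF def_equiv_scale] dset_cpos) auto
  moreover have "slice i \<inter> P \<union> (slice i - P) = slice i" by blast
  ultimately show "copies (cpos i) 2 (slice i)" by (simp add: numeral_2_eq_2)
qed

text \<open>The union of the slices is the maximal ideal without 0, and its image under inversion is the complement of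
  the valuation ring.\<close>

lemma shifted_slices_absorbed:
  "(\<lambda>x. 1 + x) ` (\<Union>i. slice i) \<union> inverse ` (\<Union>i. slice i) \<sim> inverse ` (\<Union>i. slice i)"
proof -
  have dY: "dset (slice i)" for i using slice_def_equiv by (rule def_equiv_dset)
  have pos: "0 < val x" "x \<noteq> 0" if "x \<in> slice i" for x i
    using that by (auto simp: slice_def lex_int_less_iff coord_simps)
  have val0: "val (1 + x) = 0" if "x \<in> slice i" for x i
    using val_add_less[of 1 x] pos[OF that] by (simp add: val_1)
  have val1: "val (inverse x) < 0" if "x \<in> slice i" for x i
    using pos[OF that] by (simp add: val_inverse)
  have disj: "(\<lambda>x. 1 + x) ` slice i \<inter> inverse ` slice j = {}" for i j
  proof -
    have "1 + x \<noteq> inverse y" if "x \<in> slice i" "y \<in> slice j" for x y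
      using val0[OF that(1)] val1[OF that(2)] by auto
    then show ?thesis by blast
  qed
  have slice_inj: "i = j" if "x \<in> slice i" "x \<in> slice j" for x i j
    using that by (cases i j rule: linorder_cases) (auto simp: slice_def)
  have "(\<lambda>x. 1 + x) ` slice i \<union> inverse ` slice i \<sim> inverse ` slice i" for i
  proof -
    have 1: "(\<lambda>x. 1 + x) ` slice i \<sim> cpos i"
      using def_equiv_translate[OF dY] slice_def_equiv def_equiv_sym def_equiv_trans by blast
    have 2: "inverse ` slice i \<sim> cpos i"
      using def_equiv_inverse[OF dY] slice_def_equiv def_equiv_sym def_equiv_trans by blast
    have "copies (cpos i) (1 + 1) ((\<lambda>x. 1 + x) ` slice i \<union> inverse ` slice i)"
      by (intro copies_add copies_1 1 2 disj)
    then have "copies (cpos i) 2 ((\<lambda>x. 1 + x) ` slice i \<union> inverse ` slice i)" by (simp add: numeral_2_eq_2)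
    then have "(\<lambda>x. 1 + x) ` slice i \<union> inverse ` slice i \<sim> cpos i"
      using copies_two_absorb[OF dset_cpos copies_cpos] by blast
    then show ?thesis using 2 def_equiv_sym def_equiv_trans by blast
  qed
  moreover have "disjoint_family_on (\<lambda>i. (\<lambda>x. 1 + x) ` slice i \<union> inverse ` slice i) UNIV"
  proof -
    have "((\<lambda>x. 1 + x) ` slice i \<union> inverse ` slice i) \<inter> ((\<lambda>x. 1 + x) ` slice j \<union> inverse ` slice j) = {}" if "i \<noteq> j" for i j
    proof -
      have "(\<lambda>x. 1 + x) ` slice i \<inter> (\<lambda>x. 1 + x) ` slice j = {}" "inverse ` slice i \<inter> inverse ` slice j = {}"
        using slice_inj that by auto
      then show ?thesis using disj[of i j] disj[of j i] by blast
    qed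
    then show ?thesis by (simp add: disjoint_family_on_def)
  qed
  moreover have "disjoint_family_on (\<lambda>i. inverse ` slice i) UNIV"
    using slice_inj by (auto simp: disjoint_family_on_def)
  ultimately have "(\<Union>i. (\<lambda>x. 1 + x) ` slice i \<union> inverse ` slice i) \<sim> (\<Union>i. inverse ` slice i)"
    by (intro def_equiv_UN) auto
  moreover have "(\<Union>i. (\<lambda>x. 1 + x) ` slice i \<union> inverse ` slice i) = (\<lambda>x. 1 + x) ` (\<Union>i. slice i) \<union> inverse ` (\<Union>i. slice i)"
    by blast
  moreover have "(\<Union>i. inverse ` slice i) = inverse ` (\<Union>i. slice i)" by blast
  ultimately show ?thesis by simp
qed

lemma Union_slice: "x \<in> (\<Union>i. slice i) \<longleftrightarrow> x \<noteq> 0 \<and> 0 < val x"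
  by (auto simp: slice_def lex_int_less_iff coord_simps)

text \<open>The elements of the valuation ring with angular component 1.\<close>

definition ac_one :: "'k set" where
  "ac_one = {x. x \<noteq> 0 \<and> 0 \<le> val x \<and> ac x = ac 1}"

lemma dset_ac_one: "dset ac_one"
proof -
  have "x \<in> ac_one \<longleftrightarrow> \<not> x = 0 \<and> v 1 \<le> v x \<and> ac x = ac 1" for x
    by (auto simp: ac_one_def v_val val_1)
  then show ?thesis
    unfolding dset_def by (simp only:) (intro Def_intros Def_le Def_ac)
qed

lemma ac_mult: "x \<noteq> 0 \<Longrightarrow> y \<noteq> 0 \<Longrightarrow> ac (x * y) = ac x \<otimes>\<^bsub>residue_field v\<^esub> ac y"
proof -
  assume xy: "x \<noteq> 0" "y \<noteq> 0"
  have "ac \<in> hom (mult_of (ring_on UNIV)) (mult_of (residue_field v))"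
    using angular_component_natural_ac[OF v v_\<tau>] by (simp add: angular_component_def)
  from hom_mult[OF this, of x y] show ?thesis using xy by (simp add: ring_on_def)
qed

lemma ac_\<tau>: "ac (\<tau> i) = ac 1"
proof -
  have "(\<Prod>j\<in>UNIV. \<tau> j powi (- coord (unit_vec i) j)) = (\<Prod>j\<in>UNIV. if j = i then inverse (\<tau> i) else 1)"
    by (rule prod.cong) (auto simp: coord_simps power_int_minus)
  also have "\<dots> = inverse (\<tau> i)" by (simp add: prod.delta)
  finally show ?thesis using \<tau>_nonzero by (simp add: natural_ac_def v_\<tau> v_1 coord_simps)
qed

lemma ac_eq_1_iff:
  assumes x: "x \<noteq> 0" "val x = 0"
  shows "ac x = ac 1 \<longleftrightarrow> x = 1 \<or> (x - 1 \<noteq> 0 \<and> 0 < val (x - 1))"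
proof -
  interpret R: cring "val_ring v" by (rule cring_val_ring[OF v])
  interpret I: ideal "val_ideal v" "val_ring v" by (rule ideal_val_ideal[OF v])
  have vx: "v x = 0" using x by (simp add: v_val zero_adjoin_inf_def)
  have carr: "x \<in> carrier (val_ring v)" "1 \<in> carrier (val_ring v)"
    using vx val_one[OF v] by (simp_all add: val_ring_def ring_on_def)
  have minus: "\<ominus>\<^bsub>val_ring v\<^esub> 1 = - 1"
    by (rule R.minus_equality) (use val_one[OF v] val_uminus[OF v, of 1] in \<open>auto simp: val_ring_def ring_on_def\<close>)
  have "ac y = res_class v y" if "v y = 0" for y
    using angular_component_natural_ac[OF v v_\<tau>] that by (simp add: angular_component_def)
  then have "ac x = ac 1 \<longleftrightarrow> res_class v x = res_class v 1" using vx val_one[OF v] by simp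
  also have "\<dots> \<longleftrightarrow> x \<ominus>\<^bsub>val_ring v\<^esub> 1 \<in> val_ideal v"
    unfolding res_class_def using R.quotient_eq_iff_same_a_r_cos[OF I.ideal_axioms carr] by simp
  also have "x \<ominus>\<^bsub>val_ring v\<^esub> 1 = x - 1"
    unfolding a_minus_def minus by (simp add: val_ring_def ring_on_def)
  also have "x - 1 \<in> val_ideal v \<longleftrightarrow> x = 1 \<or> (x - 1 \<noteq> 0 \<and> 0 < val (x - 1))"
    by (cases "x = 1") (simp_all add: val_ideal_def v_0 v_val zero_adjoin_inf_def Fin_less)
  finally show ?thesis .
qed

text \<open>The elements of \<open>ac_one\<close> of positive value are the multiples of \<open>ac_one\<close> by an element \<open>t\<close> of least
  positive value, and those of value 0 form the coset of 1 modulo the maximal ideal.\<close>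

lemma ac_one_decomposition:
  defines "t \<equiv> \<tau> (Max UNIV)"
  shows "ac_one = ((\<lambda>x. t * x) ` ac_one \<union> {1}) \<union> (\<lambda>x. 1 + x) ` (\<Union>i. slice i)"
    and "((\<lambda>x. t * x) ` ac_one \<union> {1}) \<inter> (\<lambda>x. 1 + x) ` (\<Union>i. slice i) = {}"
    and "(\<lambda>x. t * x) ` ac_one \<inter> {1} = {}"
proof -
  have t: "t \<noteq> 0" "val t = unit_vec (Max UNIV)" "ac t = ac 1"
    by (simp_all add: t_def \<tau>_nonzero val_\<tau> ac_\<tau>)
  have tpos: "0 < val t"
    unfolding t(2) lex_int_less_iff by (auto simp: coord_simps intro!: exI[of _ "Max UNIV"])
  have ac_t: "ac (t * x) = ac x" if "x \<noteq> 0" for x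
    using ac_mult[OF t(1) that] ac_mult[of 1 x] that t(3) by simp
  have tX: "(\<lambda>x. t * x) ` ac_one = {x. x \<noteq> 0 \<and> 0 < val x \<and> ac x = ac 1}"
  proof
    show "(\<lambda>x. t * x) ` ac_one \<subseteq> {x. x \<noteq> 0 \<and> 0 < val x \<and> ac x = ac 1}"
      using t(1) tpos ac_t by (auto simp: ac_one_def val_mult intro: add_pos_nonneg)
    show "{x. x \<noteq> 0 \<and> 0 < val x \<and> ac x = ac 1} \<subseteq> (\<lambda>x. t * x) ` ac_one"
    proof clarify
      fix x assume x: "x \<noteq> 0" "0 < val x" "ac x = ac 1"
      define y where "y = inverse t * x"
      have y: "y \<noteq> 0" "x = t * y" using x t(1) by (simp_all add: y_def)
      have "val t \<le> val x" unfolding t(2) by (rule unit_vec_last_least) fact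
      then have "0 \<le> val y" using y t(1) by (simp add: val_mult)
      moreover have "ac y = ac 1" using x(3) ac_t[OF y(1)] y(2) by simp
      ultimately show "x \<in> (\<lambda>x. t * x) ` ac_one" using y by (auto simp: ac_one_def)
    qed
  qed
  have oneY: "(\<lambda>x. 1 + x) ` (\<Union>i. slice i) = {x. x - 1 \<noteq> 0 \<and> 0 < val (x - 1)}"
  proof (rule Set.set_eqI)
    fix x :: 'k
    have "x \<in> (\<lambda>x. 1 + x) ` A \<longleftrightarrow> x - 1 \<in> A" for A
    proof
      assume "x - 1 \<in> A"
      moreover have "x = 1 + (x - 1)" using diff_add_cancel[of x 1] by (simp only: add.commute)
      ultimately show "x \<in> (\<lambda>x. 1 + x) ` A" by (rule image_eqI[rotated])
    qed auto
    then show "x \<in> (\<lambda>x. 1 + x) ` (\<Union>i. slice i) \<longleftrightarrow> x \<in> {x. x - 1 \<noteq> 0 \<and> 0 < val (x - 1)}"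
      using Union_slice[of "x - 1"] by simp
  qed
  have val0: "x \<noteq> 0 \<and> val x = 0" if "x - 1 \<noteq> 0" "0 < val (x - 1)" for x
    using val_add_less[of 1 "x - 1"] that by (simp add: val_1)
  show "ac_one = ((\<lambda>x. t * x) ` ac_one \<union> {1}) \<union> (\<lambda>x. 1 + x) ` (\<Union>i. slice i)"
  proof (rule Set.set_eqI)
    fix x
    have "x \<in> ac_one \<longleftrightarrow> x \<noteq> 0 \<and> 0 < val x \<and> ac x = ac 1 \<or> x \<noteq> 0 \<and> val x = 0 \<and> ac x = ac 1"
      by (auto simp: ac_one_def)
    also have "x \<noteq> 0 \<and> val x = 0 \<and> ac x = ac 1 \<longleftrightarrow> x = 1 \<or> (x - 1 \<noteq> 0 \<and> 0 < val (x - 1))"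
      using ac_eq_1_iff[of x] val0[of x] val_1 by auto
    finally show "x \<in> ac_one \<longleftrightarrow> x \<in> ((\<lambda>x. t * x) ` ac_one \<union> {1}) \<union> (\<lambda>x. 1 + x) ` (\<Union>i. slice i)"
      unfolding tX oneY by blast
  qed
  show "((\<lambda>x. t * x) ` ac_one \<union> {1}) \<inter> (\<lambda>x. 1 + x) ` (\<Union>i. slice i) = {}"
    unfolding tX oneY using val0 by auto
  show "(\<lambda>x. t * x) ` ac_one \<inter> {1} = {}" unfolding tX by (auto simp: val_1)
qed

text \<open>The set \<open>Z\<close>, the union of \<open>ac_one\<close> and the complement \<open>N\<close> of the valuation ring, does not contain 0 and
  is in definable bijection with \<open>Z\<close> together with 0.  The bijection is extended by the identity.\<close>

theorem line_def_equiv_punctured_line: "UNIV \<sim> UNIV - {0}"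
proof -
  define t where "t = \<tau> (Max UNIV)"
  define N where "N = inverse ` (\<Union>i. slice i)"
  note ac_one = ac_one_decomposition[folded t_def]
  have N: "x \<noteq> 0 \<and> val x < 0" if xN: "x \<in> N" for x
  proof -
    obtain y where "x = inverse y" "y \<in> (\<Union>i. slice i)" using xN unfolding N_def by blast
    then show ?thesis using Union_slice[of y] by (simp add: val_inverse)
  qed
  have disjoint: "ac_one \<inter> N = {}" "0 \<notin> ac_one" "0 \<notin> N" using N by (force simp: ac_one_def)+
  have one: "{1} \<sim> {0}"
    using def_equiv_translate[OF dset_singleton, of 1 "-1"] by simp
  have "t \<noteq> 0" by (simp add: t_def \<tau>_nonzero)
  then have "(\<lambda>x. t * x) ` ac_one \<union> {1} \<sim> ac_one \<union> {0}"
    using ac_one(3) disjoint by (intro def_equiv_Un one def_equiv_sym[OF def_equiv_scale] dset_ac_one) auto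
  moreover have "(\<lambda>x. 1 + x) ` (\<Union>i. slice i) \<union> N \<sim> N" unfolding N_def by (rule shifted_slices_absorbed)
  ultimately have "((\<lambda>x. t * x) ` ac_one \<union> {1}) \<union> ((\<lambda>x. 1 + x) ` (\<Union>i. slice i) \<union> N) \<sim> (ac_one \<union> {0}) \<union> N"
  proof (rule def_equiv_Un)
    have "(\<lambda>x. t * x) ` ac_one \<union> {1} \<subseteq> ac_one" using ac_one(1) by blast
    then show "((\<lambda>x. t * x) ` ac_one \<union> {1}) \<inter> ((\<lambda>x. 1 + x) ` (\<Union>i. slice i) \<union> N) = {}"
      using ac_one(2) disjoint(1) by blast
  qed (use disjoint in blast)
  moreover have "((\<lambda>x. t * x) ` ac_one \<union> {1}) \<union> ((\<lambda>x. 1 + x) ` (\<Union>i. slice i) \<union> N) = ac_one \<union> N"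
    using ac_one(1) by blast
  ultimately have Z: "ac_one \<union> N \<sim> (ac_one \<union> {0}) \<union> N" by simp
  let ?C = "UNIV - (ac_one \<union> N) - {0}"
  have "dset ?C" using def_equiv_dset[OF Z] by (intro dset_Diff dset_UNIV dset_singleton)
  then have "(ac_one \<union> N) \<union> ?C \<sim> ((ac_one \<union> {0}) \<union> N) \<union> ?C"
    by (intro def_equiv_Un[OF Z] def_equiv_refl) blast+
  moreover have "(ac_one \<union> N) \<union> ?C = UNIV - {0}" using disjoint by blast
  moreover have "((ac_one \<union> {0}) \<union> N) \<union> ?C = UNIV" by blast
  ultimately show ?thesis using def_equiv_sym by simp
qed

end


section \<open>The group \<open>H\<close>\<close>

context definable_tame
begin

lemma odd_power_eq_1: "odd m \<Longrightarrow> x ^ m = 1 \<Longrightarrow> x = (1 :: 'k)"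
proof -
  assume m: "odd m" and x: "x ^ m = 1"
  have "x \<noteq> 0" using m x by (cases m) auto
  have "x \<in> P"
  proof (rule ccontr)
    assume "x \<notin> P"
    then have "(- x) ^ m \<in> P" using P_cases[of x] \<open>x \<noteq> 0\<close> P_power by blast
    then show False using m x P_one P_uminus by simp
  qed
  then show "x = 1" using P_power_inject[of x 1 m] P_one x m by (simp add: odd_pos)
qed

lemma root_count_odd: "odd m \<Longrightarrow> root_count TYPE('k) m = 1"
proof -
  assume "odd m"
  then have "{x :: 'k. x ^ m = 1} = {1}" using odd_power_eq_1 by auto
  then show ?thesis by (simp add: root_count_def)
qed

lemma root_count_2: "root_count TYPE('k) 2 = 2"
proof -
  have "{x :: 'k. x ^ 2 = 1} = {1, - 1}" by (auto simp: power2_eq_1_iff)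
  moreover have "1 \<noteq> (- 1 :: 'k)" using P_one P_uminus by metis
  ultimately show ?thesis by (simp add: root_count_def)
qed

text \<open>The coset of \<open>x\<close> modulo \<open>m\<close>-th powers.\<close>

definition coset :: "nat \<Rightarrow> 'k \<Rightarrow> 'k set" where
  "coset m x = (*) x ` nth_powers m"

lemma coset_eqI:
  assumes "y \<noteq> 0" "x = r * y ^ m"
  shows "coset m x = coset m r"
proof
  show "coset m x \<subseteq> coset m r"
  proof
    fix w assume "w \<in> coset m x"
    then obtain z where "z \<noteq> 0" "w = x * z ^ m" by (auto simp: coset_def nth_powers_def)
    then have "w = r * (y * z) ^ m" "y * z \<noteq> 0" using assms by (simp_all add: power_mult_distrib mult_ac)
    then show "w \<in> coset m r" unfolding coset_def nth_powers_def by blast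
  qed
  show "coset m r \<subseteq> coset m x"
  proof
    fix w assume "w \<in> coset m r"
    then obtain z where "z \<noteq> 0" "w = r * z ^ m" by (auto simp: coset_def nth_powers_def)
    then have "w = x * (z / y) ^ m" "z / y \<noteq> 0" using assms by (simp_all add: power_divide)
    then show "w \<in> coset m x" unfolding coset_def nth_powers_def by blast
  qed
qed

lemma coset_eqD:
  assumes "coset m r = coset m s"
  obtains z where "z \<noteq> 0" "r = s * z ^ m"
proof -
  have "r \<in> coset m r" unfolding coset_def nth_powers_def
    by (rule image_eqI[of _ _ 1]) (auto intro!: exI[of _ 1])
  then have "r \<in> coset m s" using assms by simp
  then show ?thesis using that by (auto simp: coset_def nth_powers_def)
qed

lemma card_power_cosets_odd:
  assumes R: "power_reps P \<omega> m R" and m: "odd m"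
  shows "finite (power_cosets m :: 'k set set)" "card (power_cosets m :: 'k set set) = card R"
proof -
  note R = power_repsD[OF R]
  have "power_cosets m = coset m ` R"
  proof
    show "coset m ` R \<subseteq> power_cosets m"
      using R(3) P_nonzero unfolding power_cosets_def coset_def by blast
    show "power_cosets m \<subseteq> coset m ` R"
    proof
      fix C :: "'k set" assume "C \<in> power_cosets m"
      then obtain x where x: "x \<noteq> 0" "C = coset m x" by (auto simp: power_cosets_def coset_def)
      obtain r y where ry: "r \<in> R" "y \<noteq> 0" "x = r * y ^ m"
      proof (cases "x \<in> P")
        case True
        then obtain r y where "r \<in> R" "y \<in> P" "x = r * y ^ m" using R(6) by blast
        then show ?thesis using that P_nonzero by blast
      next
        case False
        then have "- x \<in> P" using P_cases[of x] x(1) by blast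
        then obtain r y where ry: "r \<in> R" "y \<in> P" "- x = r * y ^ m" using R(6) by blast
        have "x = - (- x)" by simp
        also have "\<dots> = r * (- y) ^ m" unfolding ry(3) using m by simp
        finally show ?thesis using that[of r "- y"] ry P_nonzero[of y] by simp
      qed
      then show "C \<in> coset m ` R" using x(2) coset_eqI by blast
    qed
  qed
  moreover have "inj_on (coset m) R"
  proof (rule inj_onI)
    fix r s assume rs: "r \<in> R" "s \<in> R" "coset m r = coset m s"
    obtain z where "z \<noteq> 0" "r = s * z ^ m" using coset_eqD[OF rs(3)] .
    then show "r = s" using R(7)[of r s 1 z] rs by simp
  qed
  ultimately show "finite (power_cosets m :: 'k set set)" "card (power_cosets m :: 'k set set) = card R"
    using R(1) by (simp_all add: card_image)
qed

lemma card_power_cosets_2: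
  assumes R: "power_reps P \<omega> 2 R"
  shows "finite (power_cosets 2 :: 'k set set)" "card (power_cosets 2 :: 'k set set) = 2 * card R"
proof -
  note R = power_repsD[OF R]
  have RP: "r \<in> P" if "r \<in> R" for r using R(3) that by blast
  have "power_cosets 2 = coset 2 ` (R \<union> uminus ` R)"
  proof
    show "coset 2 ` (R \<union> uminus ` R) \<subseteq> power_cosets 2"
    proof
      fix C assume "C \<in> coset 2 ` (R \<union> uminus ` R)"
      then obtain x where "x \<in> R \<union> uminus ` R" "C = coset 2 x" by blast
      moreover from this(1) have "x \<noteq> 0" using RP P_nonzero by auto
      ultimately show "C \<in> power_cosets 2" unfolding power_cosets_def coset_def by blast
    qed
    show "power_cosets 2 \<subseteq> coset 2 ` (R \<union> uminus ` R)"
    proof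
      fix C :: "'k set" assume "C \<in> power_cosets 2"
      then obtain x where x: "x \<noteq> 0" "C = coset 2 x" by (auto simp: power_cosets_def coset_def)
      obtain r y where ry: "r \<in> R \<union> uminus ` R" "y \<noteq> 0" "x = r * y ^ 2"
      proof (cases "x \<in> P")
        case True
        then obtain r y where "r \<in> R" "y \<in> P" "x = r * y ^ 2" using R(6) by blast
        then show ?thesis using that P_nonzero by blast
      next
        case False
        then have "- x \<in> P" using P_cases[of x] x(1) by blast
        then obtain r y where ry: "r \<in> R" "y \<in> P" "- x = r * y ^ 2" using R(6) by blast
        have "x = - (- x)" by simp
        also have "\<dots> = - r * y ^ 2" unfolding ry(3) by simp
        finally show ?thesis using that[of "- r" y] ry P_nonzero[of y] by simp
      qed
      then show "C \<in> coset 2 ` (R \<union> uminus ` R)" using x(2) coset_eqI by blast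
    qed
  qed
  moreover have "inj_on (coset 2) (R \<union> uminus ` R)"
  proof (rule inj_onI)
    fix r s assume rs: "r \<in> R \<union> uminus ` R" "s \<in> R \<union> uminus ` R" "coset 2 r = coset 2 s"
    obtain z where z: "z \<noteq> 0" "r = s * z ^ 2" using coset_eqD[OF rs(3)] .
    have zz: "z ^ 2 \<in> P" using P_square[OF z(1)] by (simp add: power2_eq_square)
    consider "r \<in> R" "s \<in> R" | "- r \<in> R" "- s \<in> R" | "r \<in> R" "- s \<in> R" | "- r \<in> R" "s \<in> R"
      using rs(1,2) by auto
    then show "r = s"
    proof cases
      case 1
      then show ?thesis using R(7)[of r s 1 z] z by simp
    next
      case 2
      then have "- r = - s" using R(7)[of "- r" "- s" 1 z] z by simp
      then show ?thesis by simp
    next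
      case 3
      then have "- r \<in> P" using P_mult[OF RP[OF 3(2)] zz] z(2) by simp
      then show ?thesis using RP[OF 3(1)] P_uminus by blast
    next
      case 4
      then have "r \<in> P" using P_mult[OF RP[OF 4(2)] zz] z(2) by simp
      then show ?thesis using RP[OF 4(1)] P_uminus by blast
    qed
  qed
  moreover have "card (R \<union> uminus ` R) = 2 * card R"
  proof -
    have "R \<inter> uminus ` R = {}" using RP P_uminus by auto
    then show ?thesis using R(1) by (simp add: card_Un_disjoint card_image)
  qed
  ultimately show "finite (power_cosets 2 :: 'k set set)" "card (power_cosets 2 :: 'k set set) = 2 * card R"
    using R(1) by (simp_all add: card_image)
qed

text \<open>A definable set on which the \<open>m\<close>-th power map is injective, with all non-zero powers as its image,
  gives a definable root function.\<close>

lemma has_definable_rootI: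
  assumes S: "dset S" "0 \<notin> S" and inj: "inj_on (\<lambda>y. y ^ m) S" and img: "(\<lambda>y. y ^ m) ` S = nth_powers m"
  shows "has_definable_root D m"
proof -
  define r where "r = inv_into S (\<lambda>y. y ^ m)"
  have r: "r (y ^ m) = y" if "y \<in> S" for y unfolding r_def using inv_into_f_f[OF inj that] .
  have r': "r x \<in> S" "r x ^ m = x" if "x \<in> nth_powers m" for x
    using that r unfolding img[symmetric] by auto
  have "dset (nth_powers m :: 'k set)"
  proof -
    have "x \<in> nth_powers m \<longleftrightarrow> (\<exists>y. y \<noteq> 0 \<and> x = y ^ m)" for x :: 'k by (auto simp: nth_powers_def)
    then show ?thesis unfolding dset_def by (simp only:) (intro Def_intros)
  qed
  moreover have "bij_betw (map r) (singles (nth_powers m)) (singles S)"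
    unfolding bij_betw_def
  proof
    show "inj_on (map r) (singles (nth_powers m))"
      by (rule inj_onI) (use r'(2) in \<open>auto simp: singles_def, metis\<close>)
    have "map r ` singles (nth_powers m) = (\<lambda>y. [r (y ^ m)]) ` S"
      unfolding singles_def img[symmetric] by (simp add: image_image)
    then show "map r ` singles (nth_powers m) = singles S" by (simp add: r singles_def)
  qed
  moreover have "D 2 ((\<lambda>x. x @ map r x) ` singles (nth_powers m))"
  proof -
    have gr: "(\<lambda>x. x @ map r x) ` singles (nth_powers m) = (\<lambda>y. [y ^ m, y]) ` S"
      unfolding singles_def img[symmetric] by (simp add: image_image r)
    have "map x [0..<2] \<in> (\<lambda>y. [y ^ m, y]) ` S \<longleftrightarrow> x 1 \<in> S \<and> x 0 = x 1 ^ m" for x :: "nat \<Rightarrow> 'k"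
      by (auto simp: numeral_2_eq_2)
    moreover have "Def (\<lambda>x. x 1 \<in> S \<and> x 0 = x 1 ^ m)" by (intro Def_intros S)
    ultimately show ?thesis unfolding gr D_iff by auto
  qed
  ultimately have "definable_bij D 1 (singles (nth_powers m)) 1 (singles S) (map r)"
    unfolding definable_bij_def D_singles using S(1) by (simp add: numeral_2_eq_2)
  then show ?thesis unfolding has_definable_root_def using S(2) r'(2) by blast
qed

lemma has_definable_root_odd: "odd m \<Longrightarrow> has_definable_root D m"
proof (rule has_definable_rootI[where S = "UNIV - {0}"])
  assume m: "odd m"
  show "dset (UNIV - {0})" by (intro dset_Diff dset_UNIV dset_singleton)
  show "inj_on (\<lambda>y. y ^ m) (UNIV - {0 :: 'k})"
  proof (rule inj_onI)
    fix x y :: 'k assume xy: "x \<in> UNIV - {0}" "y \<in> UNIV - {0}" "x ^ m = y ^ m"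
    then have "(x / y) ^ m = 1" by (simp add: power_divide)
    then have "x / y = 1" by (rule odd_power_eq_1[OF m])
    then show "x = y" using xy(2) by simp
  qed
  show "(\<lambda>y. y ^ m) ` (UNIV - {0 :: 'k}) = nth_powers m" by (auto simp: nth_powers_def)
qed simp

lemma has_definable_root_2: "has_definable_root D 2"
proof (rule has_definable_rootI[OF dset_P zero_notin])
  show "inj_on (\<lambda>y. y ^ 2) P" by (rule inj_onI) (rule P_power_inject, auto)
  show "(\<lambda>y. y ^ 2) ` P = nth_powers 2"
  proof
    show "(\<lambda>y. y ^ 2) ` P \<subseteq> nth_powers 2" using P_nonzero unfolding nth_powers_def by blast
    show "nth_powers 2 \<subseteq> (\<lambda>y. y ^ 2) ` P"
    proof
      fix x :: 'k assume "x \<in> nth_powers 2"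
      then obtain y where y: "y \<noteq> 0" "x = y ^ 2" by (auto simp: nth_powers_def)
      then have "y \<in> P \<or> - y \<in> P" using P_cases by blast
      moreover have "x = (- y) ^ 2" using y(2) by simp
      ultimately show "x \<in> (\<lambda>y. y ^ 2) ` P" using y(2) by blast
    qed
  qed
qed

text \<open>\<open>H\<close> contains an odd number \<open>N = lam D 2 - 1\<close>, and, if \<open>N > 1\<close>, also the number \<open>lam D N - 1\<close>, which is
  congruent to \<open>- 1\<close> modulo \<open>N\<close>.\<close>

theorem H_group_eq_UNIV:
  fixes \<omega> :: "'k \<Rightarrow> int"
  assumes \<omega>: "\<And>x y. x \<noteq> 0 \<Longrightarrow> y \<noteq> 0 \<Longrightarrow> \<omega> (x * y) = \<omega> x + \<omega> y" and t: "t \<noteq> 0" "\<omega> t = 1"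
  shows "H_group D = UNIV"
proof -
  have "\<omega> 1 = 0" using \<omega>[of 1 1] by simp
  then have "\<omega> (- 1) = 0" using \<omega>[of "- 1" "- 1"] by simp
  then have \<omega>m: "\<omega> (- t) = 1" using \<omega>[of "- 1" t] t by simp
  obtain t' where t': "t' \<in> P" "\<omega> t' = 1" using P_cases[of t] t \<omega>m by blast
  have reps: "\<exists>R. power_reps P \<omega> m R" if "m > 0" for m
    by (rule power_class_representatives[where \<tau> = t'])
       (use t' that in \<open>auto simp: P_one P_mult P_inverse \<omega> P_nonzero\<close>)
  obtain R where R: "power_reps P \<omega> 2 R" using reps[of 2] by auto
  note RD = power_repsD[OF R]
  have lam2: "lam D 2 = card R"
    using card_power_cosets_2[OF R] root_count_2 has_definable_root_2 by (simp add: lam_def)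
  have lam_odd: "m dvd lam D m \<and> lam D m > 0" if m: "odd m" for m
  proof -
    have "m > 0" using m by (simp add: odd_pos)
    then obtain R where R: "power_reps P \<omega> m R" using reps by blast
    have "lam D m = card R"
      using card_power_cosets_odd[OF R m] root_count_odd[OF m] has_definable_root_odd[OF m] by (simp add: lam_def)
    then show ?thesis using power_repsD[OF R] by (simp add: card_gt_0_iff)
  qed
  define G where "G = generate integer_group {int (lam D n) - 1 | n. n > 1}"
  have G_add: "x + y \<in> G" if "x \<in> G" "y \<in> G" for x y
    using generate.eng[OF that[unfolded G_def]] by (simp add: G_def)
  have incl: "int (lam D n) - 1 \<in> G" if "n > 1" for n
    unfolding G_def by (rule generate.incl) (use that in blast)
  have "group integer_group" by simp
  then have "subgroup G integer_group" unfolding G_def by (rule group.generate_is_subgroup) simp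
  then have G_minus: "- x \<in> G" if "x \<in> G" for x
    using subgroup.m_inv_closed[OF _ that, of integer_group] by simp
  have G_0: "0 \<in> G" using generate.one[of integer_group] by (simp add: G_def)
  have G_mult: "int n * x \<in> G" if "x \<in> G" for n x
    by (induction n) (use that in \<open>auto simp: G_0 G_add algebra_simps\<close>)
  define N where "N = card R - 1"
  have "even (card R)" "card R > 0" using RD(1,2,4) by (auto simp: card_gt_0_iff)
  then have N: "odd N" "int (lam D 2) - 1 = int N" by (auto simp: N_def lam2)
  have NG: "int N \<in> G" using incl[of 2] N(2) by simp
  have "1 \<in> G"
  proof (cases "N = 1")
    case False
    then have "N > 1" using N(1) by (cases N) auto
    obtain b where b: "lam D N = N * b" using lam_odd[OF N(1)] by (auto elim: dvdE)
    have "int b * int N + - (int (lam D N) - 1) \<in> G"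
      by (intro G_add G_mult NG G_minus incl \<open>N > 1\<close>)
    then show ?thesis by (simp add: b mult.commute)
  qed (use NG in simp)
  then have "int n \<in> G" for n using G_mult[of 1 n] by simp
  then have "x \<in> G" for x using G_minus by (cases x rule: int_cases2) auto
  then show ?thesis unfolding H_group_def G_def[symmetric] by blast
qed

end

section \<open>Iterated Laurent series fields over the reals\<close>

theorem theorem3:
  fixes n :: nat
  assumes "n \<ge> 1"
    and "iterated_laurent n (UNIV :: 'k::field set)"
  shows "H_group (ring_definable :: nat \<Rightarrow> 'k list set \<Rightarrow> bool) = UNIV \<and>
    (\<forall>(v :: 'k \<Rightarrow> 'd::{finite,linorder} lex_int adjoin_inf) (\<tau> :: 'd \<Rightarrow> 'k)
        (Lk :: ('f, 'p, 'k set) expansion) (LG :: ('h, 'q, 'd lex_int adjoin_inf) expansion).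
      valuation v \<and> surj v \<and> (\<forall>i. v (\<tau> i) = Fin (unit_vec i)) \<and>
      expansion_on (carrier (residue_field v)) Lk \<and> expansion_on UNIV LG \<longrightarrow>
        (let D = pas_definable v (natural_ac v \<tau>) Lk LG in
          carrier (K0 D) = {\<zero>\<^bsub>K0 D\<^esub>} \<and>
          (\<exists>f. definable_bij D 1 (singles UNIV) 1 (singles (UNIV - {0})) f)))"
proof (intro conjI allI impI)
  obtain P :: "'k set" where P: "pos_cone UNIV P" "finite_power_classes (UNIV :: 'k set)"
    using iterated_laurent_tame[OF assms(2)] unfolding tame_field_def by blast
  then have tame: "tame_ordered_field P" by unfold_locales
  obtain \<omega> :: "'k \<Rightarrow> int" and t where t: "t \<noteq> 0" "\<omega> t = 1"
    and *: "\<forall>x y. x \<noteq> 0 \<longrightarrow> y \<noteq> 0 \<longrightarrow> \<omega> (x * y) = \<omega> x + \<omega> y"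
    using iterated_laurent_order[OF assms(2,1)] by blast
  have \<omega>: "\<omega> (x * y) = \<omega> x + \<omega> y" if "x \<noteq> 0" "y \<noteq> 0" for x y
    using * that by blast
  show "H_group (ring_definable :: nat \<Rightarrow> 'k list set \<Rightarrow> bool) = UNIV"
    by (rule definable_tame.H_group_eq_UNIV[OF definable_tame.intro[OF ring_definability tame]])
       (fact \<omega> t)+
  fix v :: "'k \<Rightarrow> 'd lex_int adjoin_inf" and \<tau> :: "'d \<Rightarrow> 'k"
    and Lk :: "('f, 'p, 'k set) expansion" and LG :: "('h, 'q, 'd lex_int adjoin_inf) expansion"
  assume *: "valuation v \<and> surj v \<and> (\<forall>i. v (\<tau> i) = Fin (unit_vec i)) \<and>
      expansion_on (carrier (residue_field v)) Lk \<and> expansion_on UNIV LG"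
  then have v: "valuation v" by blast
  interpret valued_tame "pas_definable v (natural_ac v \<tau>) Lk LG" "pas_Def v (natural_ac v \<tau>) Lk LG" P v \<tau>
  proof (intro valued_tame.intro definable_tame.intro pas_definability v tame)
    show "valued_tame_axioms (pas_Def v (natural_ac v \<tau>) Lk LG) v \<tau>"
      by unfold_locales (use * pas_Def_atomic[OF v] in blast)+
  qed
  show "let D = pas_definable v (natural_ac v \<tau>) Lk LG in
      carrier (K0 D) = {\<zero>\<^bsub>K0 D\<^esub>} \<and>
      (\<exists>f. definable_bij D 1 (singles UNIV) 1 (singles (UNIV - {0})) f)"
    unfolding Let_def
    using K0_trivial[OF line_def_equiv_punctured_line]
      def_equiv_definable_bij_singles[OF line_def_equiv_punctured_line] by (rule conjI)
qed

end
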